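(* The promise problem $\textsc{Nim}_2(\mathrm{Succinct},\mathrm{PO})$ is $\mathrm{co}\mathbf{C_{=}P}$-hard under polynomial-time many-one reductions.
   Context: Poset game on a finite poset $P$: players alternate; a move chooses a point $x$ of the current poset $Q$ and replaces $Q$ by $\{y\in Q: x\not\le y\}$; the first player unable to move loses; $P$ is an $\exists$-game if the first player has a winning strategy. $\textsc{Nim}_2(\mathrm{Succinct},\mathrm{PO})$ is the promise problem: Input: a Boolean circuit $C$ with one output bit and two $n$-bit inputs. Promise: the relation $\{(y,z)\in\{0,1\}^n\times\{0,1\}^n: C(y,z)=1\}$ is a partial order on $\{0,1\}^n$, and this poset is a parallel (disjoint, mutually incomparable) union of at most $2$ chains. Question: is this poset an $\exists$-game? $\mathbf{C_{=}P}$ is the class of languages $L$ for which there are a #P function $f$ and a polynomial-time computable function $h$ with $x\in L\iff f(x)=h(x)$; $\mathrm{co}\mathbf{C_{=}P}$ is the class of complements of such languages. *)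

theory Defs
  imports Main
begin

type_synonym bits = "bool list"

fun bin_val :: "bits \<Rightarrow> nat" where
  "bin_val [] = 0"
| "bin_val (b # bs) = (if b then 1 else 0) + 2 * bin_val bs"

fun nat_bits :: "nat \<Rightarrow> bits" where
  "nat_bits n = (if n = 0 then [] else (n mod 2 = 1) # nat_bits (n div 2))"

definition sd :: "bits \<Rightarrow> bits" where
  "sd xs = concat (map (\<lambda>b. [True, b]) xs) @ [False]"

definition enc_nat :: "nat \<Rightarrow> bits" where
  "enc_nat n = sd (nat_bits n)"

definition pair_enc :: "bits \<Rightarrow> bits \<Rightarrow> bits" where
  "pair_enc x y = sd x @ y"

text \<open>Single-tape TM, one-way infinite tape, finitely many states and symbols.
  Symbol 0 = blank, 1 = bit False, 2 = bit True. State 0 = start, state 1 = halt.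
  A move flag True = right, False = left (staying at cell 0 when moving left there).\<close>
record tm =
  nstates :: nat
  nsyms :: nat
  delta :: "nat \<Rightarrow> nat \<Rightarrow> nat \<times> nat \<times> bool"

definition tm_wf :: "tm \<Rightarrow> bool" where
  "tm_wf M \<longleftrightarrow> 2 \<le> nstates M \<and> 3 \<le> nsyms M \<and>
     (\<forall>q < nstates M. \<forall>s < nsyms M.
        fst (delta M q s) < nstates M \<and> fst (snd (delta M q s)) < nsyms M)"

type_synonym config = "nat \<times> nat \<times> (nat \<Rightarrow> nat)"

definition tm_step :: "tm \<Rightarrow> config \<Rightarrow> config" where
  "tm_step M c = (case c of (q, h, t) \<Rightarrow>
     if q = 1 then (q, h, t)
     else (case delta M q (t h) of (q', s', d) \<Rightarrow>
             (q', if d then h + 1 else h - 1, t(h := s'))))"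

definition tm_init :: "bits \<Rightarrow> config" where
  "tm_init x = (0, 0, \<lambda>i. if i < length x then (if x ! i then 2 else 1) else 0)"

definition tm_run :: "tm \<Rightarrow> nat \<Rightarrow> bits \<Rightarrow> config" where
  "tm_run M n x = (tm_step M ^^ n) (tm_init x)"

definition tape_out :: "(nat \<Rightarrow> nat) \<Rightarrow> bits" where
  "tape_out t = map (\<lambda>i. t i = 2) [0..<(LEAST k. t k \<noteq> 1 \<and> t k \<noteq> 2)]"

definition polytime_fun :: "(bits \<Rightarrow> bits) \<Rightarrow> bool" where
  "polytime_fun f \<longleftrightarrow> (\<exists>M c k. tm_wf M \<and> (\<forall>x. \<exists>n. n \<le> c * length x ^ k + c \<and>
      fst (tm_run M n x) = 1 \<and> tape_out (snd (snd (tm_run M n x))) = f x))"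

definition polytime_pred :: "(bits \<Rightarrow> bool) \<Rightarrow> bool" where
  "polytime_pred R \<longleftrightarrow> polytime_fun (\<lambda>x. [R x])"

definition polytime_nat :: "(bits \<Rightarrow> nat) \<Rightarrow> bool" where
  "polytime_nat h \<longleftrightarrow> (\<exists>g. polytime_fun g \<and> (\<forall>x. bin_val (g x) = h x))"

definition sharpP :: "(bits \<Rightarrow> nat) \<Rightarrow> bool" where
  "sharpP f \<longleftrightarrow> (\<exists>R c k. polytime_pred R \<and>
     (\<forall>x. f x = card {y. length y = c * length x ^ k + c \<and> R (pair_enc x y)}))"

definition CeqP :: "bits set \<Rightarrow> bool" where
  "CeqP L \<longleftrightarrow> (\<exists>f h. sharpP f \<and> polytime_nat h \<and> (\<forall>x. x \<in> L \<longleftrightarrow> f x = h x))"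

definition coCeqP :: "bits set \<Rightarrow> bool" where
  "coCeqP L \<longleftrightarrow> CeqP (- L)"

datatype gate = GIn nat | GConst bool | GNot nat | GAnd nat nat | GOr nat nat

text \<open>Circuit n gs: inputs 0..n-1 form y, inputs n..2n-1 form z; gate j may refer to
  earlier gates (indices < j); the output is the last gate.\<close>
datatype circuit = Circuit nat "gate list"

definition lookup :: "bool list \<Rightarrow> nat \<Rightarrow> bool" where
  "lookup vs j = (j < length vs \<and> vs ! j)"

fun gate_val :: "(nat \<Rightarrow> bool) \<Rightarrow> bool list \<Rightarrow> gate \<Rightarrow> bool" where
  "gate_val inp vs (GIn i) = inp i"
| "gate_val inp vs (GConst b) = b"
| "gate_val inp vs (GNot j) = (\<not> lookup vs j)"
| "gate_val inp vs (GAnd j k) = (lookup vs j \<and> lookup vs k)"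
| "gate_val inp vs (GOr j k) = (lookup vs j \<or> lookup vs k)"

definition gates_eval :: "(nat \<Rightarrow> bool) \<Rightarrow> gate list \<Rightarrow> bool list" where
  "gates_eval inp gs = foldl (\<lambda>vs g. vs @ [gate_val inp vs g]) [] gs"

fun circ_n :: "circuit \<Rightarrow> nat" where
  "circ_n (Circuit n gs) = n"

fun circ_eval :: "circuit \<Rightarrow> bits \<Rightarrow> bits \<Rightarrow> bool" where
  "circ_eval (Circuit n gs) y z =
     (let inp = (\<lambda>i. if i < n then lookup y i else if i < 2 * n then lookup z (i - n) else False);
          vs = gates_eval inp gs
      in vs \<noteq> [] \<and> last vs)"

fun enc_gate :: "gate \<Rightarrow> bits" where
  "enc_gate (GIn i) = enc_nat 0 @ enc_nat i"
| "enc_gate (GConst b) = enc_nat 1 @ [b]"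
| "enc_gate (GNot j) = enc_nat 2 @ enc_nat j"
| "enc_gate (GAnd j k) = enc_nat 3 @ enc_nat j @ enc_nat k"
| "enc_gate (GOr j k) = enc_nat 4 @ enc_nat j @ enc_nat k"

fun enc_circuit :: "circuit \<Rightarrow> bits" where
  "enc_circuit (Circuit n gs) = enc_nat n @ enc_nat (length gs) @ concat (map enc_gate gs)"

definition is_po_on :: "'a set \<Rightarrow> ('a \<Rightarrow> 'a \<Rightarrow> bool) \<Rightarrow> bool" where
  "is_po_on V le \<longleftrightarrow> (\<forall>x\<in>V. le x x) \<and>
     (\<forall>x\<in>V. \<forall>y\<in>V. le x y \<and> le y x \<longrightarrow> x = y) \<and>
     (\<forall>x\<in>V. \<forall>y\<in>V. \<forall>z\<in>V. le x y \<and> le y z \<longrightarrow> le x z)"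

definition is_chain_on :: "'a set \<Rightarrow> ('a \<Rightarrow> 'a \<Rightarrow> bool) \<Rightarrow> bool" where
  "is_chain_on A le \<longleftrightarrow> (\<forall>x\<in>A. \<forall>y\<in>A. le x y \<or> le y x)"

definition union_of_two_chains :: "'a set \<Rightarrow> ('a \<Rightarrow> 'a \<Rightarrow> bool) \<Rightarrow> bool" where
  "union_of_two_chains V le \<longleftrightarrow> (\<exists>A B. A \<union> B = V \<and> A \<inter> B = {} \<and>
      is_chain_on A le \<and> is_chain_on B le \<and>
      (\<forall>a\<in>A. \<forall>b\<in>B. \<not> le a b \<and> \<not> le b a))"

text \<open>First player wins on position Q, with move budget k (k \<ge> card Q suffices,
  since every move removes at least the chosen point, by reflexivity).\<close>
fun pg_win :: "('a \<Rightarrow> 'a \<Rightarrow> bool) \<Rightarrow> nat \<Rightarrow> 'a set \<Rightarrow> bool" where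
  "pg_win le 0 Q = False"
| "pg_win le (Suc k) Q = (\<exists>x\<in>Q. \<not> pg_win le k {y\<in>Q. \<not> le x y})"

definition exists_game :: "'a set \<Rightarrow> ('a \<Rightarrow> 'a \<Rightarrow> bool) \<Rightarrow> bool" where
  "exists_game V le \<longleftrightarrow> pg_win le (card V) V"

definition cube :: "nat \<Rightarrow> bits set" where
  "cube n = {y. length y = n}"

definition nim2_promise :: "circuit \<Rightarrow> bool" where
  "nim2_promise C \<longleftrightarrow> is_po_on (cube (circ_n C)) (circ_eval C) \<and>
     union_of_two_chains (cube (circ_n C)) (circ_eval C)"

definition nim2_yes :: "circuit \<Rightarrow> bool" where
  "nim2_yes C \<longleftrightarrow> exists_game (cube (circ_n C)) (circ_eval C)"

definition reduces_to_nim2 :: "bits set \<Rightarrow> bool" where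
  "reduces_to_nim2 L \<longleftrightarrow> (\<exists>r. polytime_fun r \<and> (\<forall>x. \<exists>C. r x = enc_circuit C \<and>
      nim2_promise C \<and> (x \<in> L \<longleftrightarrow> nim2_yes C)))"

end

(* A parallel union of two chains is Nim with two heaps, so the first player wins iff the chains have
   different sizes. Given an instance x of a coC=P language, let R be the witness predicate of f and
   let h be the number to be compared with f(x). Split the cube by D(b, y), which is "h <= y" (y read
   as a number) for b = 1 and "the first bits of y are a witness, the others are 0" for b = 0; order
   both parts by numerical value. Then D has 2^n - h + f(x) points in a cube of size 2^(n+1), so the
   two chains have equal size iff f(x) = h.

   The circuit evaluates D by simulating the Turing machines for R and h on the fixed input x: the
   space-time diagram of a machine is a one-dimensional recurrence with a fixed local rule, hence an
   array of identical blocks of gates whose references are polynomials in the block index and |x|.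
   Such arrays are printed by nested counting loops. To see that printing takes polynomial time on a
   single tape, loops are compiled to programs over finitely many stacks, and each stack becomes a
   track of the tape, with the head returning to cell 0 after every instruction. *)
theory Submission
  imports Defs
begin

section \<open>Stack programs\<close>

text \<open>\<open>polytime_fun\<close> demands one explicit single-tape machine with a step count,
  so the reduction itself has to be run in that model. This dictates a rigid layout: every group of
  gates has a size independent of its contents (shorter ones are padded), so all addresses are
  polynomials in |x| and the loop counters. The numbers handled by the printing program are such
  addresses, hence of polynomial size, and can be kept in unary. Each circuit part occurs twice: as
  a gate list, for which the meaning is proved, and as a syntactic generator (such as
  \<open>eca\<close> beside \<open>ca\<close>), proved to print that list. The exponent n is the
  witness length plus |x| + t + 2, where t bounds the running time for h. So witnesses fit into n
  bits, and h <= 2^n because h is read from a tape with fewer than n non-blank cells.\<close>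

datatype com = Skip | Push nat bool | Pop nat | Seq com com | Ifc nat com com | While nat com

type_synonym store = "nat \<Rightarrow> bool list"

fun cstep :: "com list \<times> store \<Rightarrow> com list \<times> store" where
  "cstep ([], s) = ([], s)"
| "cstep (Skip # \<kappa>, s) = (\<kappa>, s)"
| "cstep (Push r b # \<kappa>, s) = (\<kappa>, s(r := b # s r))"
| "cstep (Pop r # \<kappa>, s) = (\<kappa>, s(r := tl (s r)))"
| "cstep (Seq a b # \<kappa>, s) = (a # b # \<kappa>, s)"
| "cstep (Ifc r a b # \<kappa>, s) = ((if s r \<noteq> [] \<and> hd (s r) then a else b) # \<kappa>, s)"
| "cstep (While r a # \<kappa>, s) = (if s r = [] then \<kappa> else a # While r a # \<kappa>, s)"

text \<open>Quantifying over all continuations makes runs composable, and bounding the number of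
  steps instead of fixing it lets branches of different cost share one bound.\<close>

definition runs :: "com \<Rightarrow> store \<Rightarrow> store \<Rightarrow> nat \<Rightarrow> bool" where
  "runs c s s' T \<longleftrightarrow> (\<exists>t\<le>T. \<forall>\<kappa>. (cstep ^^ t) (c # \<kappa>, s) = (\<kappa>, s'))"

section \<open>Timed rules for programs\<close>

lemma runs_weaken: "runs c s s' T \<Longrightarrow> T \<le> T' \<Longrightarrow> runs c s s' T'"
  unfolding runs_def by (meson le_trans)

lemma runs_eq: "runs c s s1 T \<Longrightarrow> s1 = s' \<Longrightarrow> T \<le> T' \<Longrightarrow> runs c s s' T'"
  using runs_weaken by blast

lemma runs_1: "(\<And>\<kappa>. cstep (c # \<kappa>, s) = (\<kappa>, s')) \<Longrightarrow> runs c s s' 1"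
  unfolding runs_def by (rule exI[of _ 1]) simp

lemma runs_Skip: "runs Skip s s 1"
  by (rule runs_1) simp

lemma runs_Push: "runs (Push r b) s (s(r := b # s r)) 1"
  by (rule runs_1) simp

lemma runs_Pop: "runs (Pop r) s (s(r := tl (s r))) 1"
  by (rule runs_1) simp

lemma funpow_add_app: "(f ^^ (m + n)) x = (f ^^ n) ((f ^^ m) x)"
  by (subst add.commute) (simp add: funpow_add)

lemma runs_pre:
  assumes "\<And>\<kappa>. cstep (c # \<kappa>, s) = (a # \<kappa>, s)" and "runs a s s' T"
  shows "runs c s s' (T + 1)"
proof -
  obtain t where t: "t \<le> T" "\<And>\<kappa>. (cstep ^^ t) (a # \<kappa>, s) = (\<kappa>, s')"
    using assms(2) unfolding runs_def by auto
  have "(cstep ^^ Suc t) (c # \<kappa>, s) = (\<kappa>, s')" for \<kappa>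
    by (simp add: funpow_Suc_right assms(1) t(2) del: funpow.simps)
  then show ?thesis unfolding runs_def using t(1) by (intro exI[of _ "Suc t"]) auto
qed

lemma runs_pre2:
  assumes "\<And>\<kappa>. cstep (c # \<kappa>, s) = (a # b # \<kappa>, s)" and "runs a s s1 T1" and "runs b s1 s2 T2"
  shows "runs c s s2 (T1 + T2 + 1)"
proof -
  obtain t where t: "t \<le> T1" "\<And>\<kappa>. (cstep ^^ t) (a # \<kappa>, s) = (\<kappa>, s1)"
    using assms(2) unfolding runs_def by auto
  obtain u where u: "u \<le> T2" "\<And>\<kappa>. (cstep ^^ u) (b # \<kappa>, s1) = (\<kappa>, s2)"
    using assms(3) unfolding runs_def by auto
  have "(cstep ^^ Suc (t + u)) (c # \<kappa>, s) = (\<kappa>, s2)" for \<kappa>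
    by (simp add: funpow_Suc_right assms(1) funpow_add_app t(2) u(2) del: funpow.simps)
  then show ?thesis unfolding runs_def using t(1) u(1) by (intro exI[of _ "Suc (t + u)"]) auto
qed

lemma runs_Seq: "runs a s s1 T1 \<Longrightarrow> runs b s1 s2 T2 \<Longrightarrow> runs (Seq a b) s s2 (T1 + T2 + 1)"
  by (rule runs_pre2) auto

lemma runs_If_True: "s r \<noteq> [] \<Longrightarrow> hd (s r) \<Longrightarrow> runs a s s' T \<Longrightarrow> runs (Ifc r a b) s s' (T + 1)"
  by (rule runs_pre) auto

lemma runs_If_False: "s r = [] \<or> \<not> hd (s r) \<Longrightarrow> runs b s s' T \<Longrightarrow> runs (Ifc r a b) s s' (T + 1)"
  by (rule runs_pre) auto

lemma runs_While_False: "s r = [] \<Longrightarrow> runs (While r a) s s 1"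
  by (rule runs_1) auto

lemma runs_While_True:
  "s r \<noteq> [] \<Longrightarrow> runs a s s1 T1 \<Longrightarrow> runs (While r a) s1 s2 T2 \<Longrightarrow> runs (While r a) s s2 (T1 + T2 + 1)"
  by (rule runs_pre2) auto

text \<open>The loop is described by the sequence of its stores, so a use only has to provide a
  closed form for the store after i rounds.\<close>

lemma runs_While:
  assumes "\<And>i. i < n \<Longrightarrow> \<sigma> i r \<noteq> []" and "\<sigma> n r = []"
    and "\<And>i. i < n \<Longrightarrow> runs a (\<sigma> i) (\<sigma> (Suc i)) B"
  shows "runs (While r a) (\<sigma> 0) (\<sigma> n) (n * (B + 1) + 1)"
  using assms
proof (induction n arbitrary: \<sigma>)
  case 0
  then show ?case using runs_While_False[of "\<sigma> 0" r a] by simp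
next
  case (Suc n)
  have "runs (While r a) (\<sigma> (Suc 0)) (\<sigma> (Suc n)) (n * (B + 1) + 1)"
    using Suc.IH[of "\<lambda>i. \<sigma> (Suc i)"] Suc.prems by simp
  with Suc.prems(1)[of 0] Suc.prems(3)[of 0] have "runs (While r a) (\<sigma> 0) (\<sigma> (Suc n)) (B + (n * (B + 1) + 1) + 1)"
    by (intro runs_While_True) auto
  then show ?case by (rule runs_weaken) simp
qed

section \<open>Register bounds and the finite control\<close>

fun bnd :: "nat \<Rightarrow> com \<Rightarrow> bool" where
  "bnd k Skip = True"
| "bnd k (Push r b) = (r < k)"
| "bnd k (Pop r) = (r < k)"
| "bnd k (Seq a b) = (bnd k a \<and> bnd k b)"
| "bnd k (Ifc r a b) = (r < k \<and> bnd k a \<and> bnd k b)"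
| "bnd k (While r a) = (r < k \<and> bnd k a)"

lemma bnd_mono: "bnd k c \<Longrightarrow> k \<le> k' \<Longrightarrow> bnd k' c"
  by (induction c) auto

lemma ex_bnd: "\<exists>k>0. bnd k c"
proof (induction c)
  case (Seq a b)
  then obtain k l where "k > 0" "bnd k a" "bnd l b" by blast
  then have "bnd (max k l) a" "bnd (max k l) b" using bnd_mono by auto
  then show ?case using \<open>k > 0\<close> by (intro exI[of _ "max k l"]) auto
next
  case (Ifc r a b)
  then obtain k l where "k > 0" "bnd k a" "bnd l b" by blast
  then have "bnd (Suc r + max k l) a" "bnd (Suc r + max k l) b" by (auto intro: bnd_mono)
  then show ?case by (intro exI[of _ "Suc r + max k l"]) auto
next
  case (While r a)
  then obtain k where "bnd k a" by blast
  then have "bnd (Suc r + k) a" by (auto intro: bnd_mono)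
  then show ?case by (intro exI[of _ "Suc r + k"]) auto
qed auto

text \<open>The continuation stacks that can occur while a program runs in front of a given
  continuation. A loop puts itself back instead of piling up copies, so the set is finite; it
  becomes the state set of the Turing machine.\<close>

fun conts :: "com \<Rightarrow> com list \<Rightarrow> com list set" where
  "conts (Seq a b) \<kappa> = insert (Seq a b # \<kappa>) (conts a (b # \<kappa>) \<union> conts b \<kappa>)"
| "conts (Ifc r a b) \<kappa> = insert (Ifc r a b # \<kappa>) (conts a \<kappa> \<union> conts b \<kappa>)"
| "conts (While r a) \<kappa> = insert (While r a # \<kappa>) (conts a (While r a # \<kappa>))"
| "conts c \<kappa> = {c # \<kappa>}"

lemma finite_conts: "finite (conts c \<kappa>)"
  by (induction c arbitrary: \<kappa>) auto

lemma conts_self: "c # \<kappa> \<in> conts c \<kappa>"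
  by (cases c) auto

fun succs :: "com list \<Rightarrow> com list set" where
  "succs [] = {}"
| "succs (Seq a b # \<kappa>) = {a # b # \<kappa>}"
| "succs (Ifc r a b # \<kappa>) = {a # \<kappa>, b # \<kappa>}"
| "succs (While r a # \<kappa>) = {\<kappa>, a # While r a # \<kappa>}"
| "succs (c # \<kappa>) = {\<kappa>}"

lemma succs_conts: "\<kappa>' \<in> conts c \<kappa> \<Longrightarrow> succs \<kappa>' \<subseteq> insert \<kappa> (conts c \<kappa>)"
proof (induction c arbitrary: \<kappa> \<kappa>')
  case (Seq a b)
  then show ?case using conts_self[of a "b # \<kappa>"] conts_self[of b \<kappa>]
    by (auto dest: subsetD[OF Seq.IH(1)] subsetD[OF Seq.IH(2)])
next
  case (Ifc r a b)
  then show ?case using conts_self[of a \<kappa>] conts_self[of b \<kappa>]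
    by (auto dest: subsetD[OF Ifc.IH(1)] subsetD[OF Ifc.IH(2)])
next
  case (While r a)
  then show ?case using conts_self[of a "While r a # \<kappa>"]
    by (auto dest: subsetD[OF While.IH])
qed auto

lemma bnd_conts: "\<kappa>' \<in> conts c \<kappa> \<Longrightarrow> bnd k c \<Longrightarrow> list_all (bnd k) \<kappa> \<Longrightarrow> list_all (bnd k) \<kappa>'"
proof (induction c arbitrary: \<kappa>)
  case (Seq a b)
  then show ?case using Seq.IH(1)[of "b # \<kappa>"] Seq.IH(2)[of \<kappa>] by auto
next
  case (Ifc r a b)
  then show ?case using Ifc.IH(1)[of \<kappa>] Ifc.IH(2)[of \<kappa>] by auto
next
  case (While r a)
  then show ?case using While.IH[of "While r a # \<kappa>"] by auto
qed auto

section \<open>Compilation of stack programs to Turing machines\<close>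

text \<open>Every instruction starts in cell 0 (\<open>Home\<close>). A stack operation runs right
  to the first empty cell of its track (\<open>Scan\<close>), steps back onto the top symbol if that
  has to be read or erased (\<open>Top\<close>), and runs left to the mark (\<open>Ret\<close>).
  \<open>Init\<close> sets the mark, and \<open>Home []\<close> removes it on the way to
  \<open>Halt\<close>.\<close>

datatype ph = Init | Home "com list" | Scan "com list" | Top "com list" | Ret "com list" | Halt

type_synonym sym = "nat \<Rightarrow> nat"

text \<open>Symbols are vectors of ternary digits: track \<open>r < K\<close> holds register \<open>r\<close> (bottom of the stack in
  cell 0), and track \<open>K\<close> marks cell 0. A left move in cell 0 serves as a non-move.\<close>
fun adelta :: "com \<Rightarrow> nat \<Rightarrow> ph \<Rightarrow> sym \<Rightarrow> ph \<times> sym \<times> bool" where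
  "adelta c K Init f = (Home [c], f(K := 1), False)"
| "adelta c K (Home []) f = (Halt, f(K := 0), False)"
| "adelta c K (Home (Skip # \<kappa>)) f = (Home \<kappa>, f, False)"
| "adelta c K (Home (Seq a b # \<kappa>)) f = (Home (a # b # \<kappa>), f, False)"
| "adelta c K (Home (While r a # \<kappa>)) f = (if f r = 0 then Home \<kappa> else Home (a # While r a # \<kappa>), f, False)"
| "adelta c K (Home (Push r b # \<kappa>)) f = (Scan (Push r b # \<kappa>), f, False)"
| "adelta c K (Home (Pop r # \<kappa>)) f = (if f r = 0 then Home \<kappa> else Scan (Pop r # \<kappa>), f, False)"
| "adelta c K (Home (Ifc r a b # \<kappa>)) f = (if f r = 0 then Home (b # \<kappa>) else Scan (Ifc r a b # \<kappa>), f, False)"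
| "adelta c K (Scan (Push r b # \<kappa>)) f =
     (if f r = 0 then (Ret \<kappa>, f(r := if b then 2 else 1), False) else (Scan (Push r b # \<kappa>), f, True))"
| "adelta c K (Scan (Pop r # \<kappa>)) f =
     (if f r = 0 then (Top (Pop r # \<kappa>), f, False) else (Scan (Pop r # \<kappa>), f, True))"
| "adelta c K (Scan (Ifc r a b # \<kappa>)) f =
     (if f r = 0 then (Top (Ifc r a b # \<kappa>), f, False) else (Scan (Ifc r a b # \<kappa>), f, True))"
| "adelta c K (Top (Pop r # \<kappa>)) f = (Ret \<kappa>, f(r := 0), False)"
| "adelta c K (Top (Ifc r a b # \<kappa>)) f = (Ret ((if f r = 2 then a else b) # \<kappa>), f, False)"
| "adelta c K (Ret \<kappa>) f = (if f K = 1 then Home \<kappa> else Ret \<kappa>, f, False)"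
| "adelta c K q f = (Halt, f, False)"

definition syms :: "nat \<Rightarrow> sym set" where
  "syms K = {f. (\<forall>r. f r < 3) \<and> (\<forall>r>K. f r = 0)}"

definition astep :: "com \<Rightarrow> nat \<Rightarrow> ph \<times> nat \<times> (nat \<Rightarrow> sym) \<Rightarrow> ph \<times> nat \<times> (nat \<Rightarrow> sym)" where
  "astep c K = (\<lambda>(q, h, t). if q = Halt then (q, h, t) else
     (case adelta c K q (t h) of (q', f, d) \<Rightarrow> (q', if d then h + 1 else h - 1, t(h := f))))"

definition phs :: "com \<Rightarrow> ph set" where
  "phs c = {Init, Halt} \<union> (\<Union>\<kappa>\<in>insert [] (conts c []). {Home \<kappa>, Scan \<kappa>, Top \<kappa>, Ret \<kappa>})"

lemma finite_phs: "finite (phs c)"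
  unfolding phs_def by (auto simp: finite_conts)

lemma adelta_closed:
  assumes "q \<in> phs c" "f \<in> syms K" "bnd K c"
  shows "fst (adelta c K q f) \<in> phs c \<and> fst (snd (adelta c K q f)) \<in> syms K"
proof -
  define G where "G = insert [] (conts c [])"
  have S: "succs \<kappa> \<subseteq> G" if "\<kappa> \<in> G" for \<kappa>
    using succs_conts that unfolding G_def by auto
  have R: "list_all (bnd K) \<kappa>" if "\<kappa> \<in> G" for \<kappa>
    using that bnd_conts[OF _ assms(3), of \<kappa> "[]"] unfolding G_def by auto
  have C: "[c] \<in> G" unfolding G_def by (simp add: conts_self)
  have N: "[] \<in> G" unfolding G_def by simp
  have [simp]: "Home \<kappa> \<in> phs c \<longleftrightarrow> \<kappa> \<in> G" "Scan \<kappa> \<in> phs c \<longleftrightarrow> \<kappa> \<in> G"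
    "Top \<kappa> \<in> phs c \<longleftrightarrow> \<kappa> \<in> G" "Ret \<kappa> \<in> phs c \<longleftrightarrow> \<kappa> \<in> G" "Halt \<in> phs c" for \<kappa>
    unfolding phs_def G_def by auto
  have U: "f(r := d) \<in> syms K" if "r \<le> K" "d < 3" for r d
    using assms(2) that unfolding syms_def by auto
  note f = assms(2)
  from assms(1) show ?thesis
  \<comment> \<open>The case numbers are those of the equations of \<open>adelta\<close>, whose
    first two arguments take no part in the pattern matching.\<close>
  proof (cases "(undefined :: com, undefined :: nat, q, f)" rule: adelta.cases)
    case (3 c' K' \<kappa> f')
    then show ?thesis using assms(1) f S[of "Skip # \<kappa>"] by auto
  next
    case (4 c' K' a b \<kappa> f')
    then show ?thesis using assms(1) f S[of "Seq a b # \<kappa>"] by auto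
  next
    case (5 c' K' r a \<kappa> f')
    then show ?thesis using assms(1) f S[of "While r a # \<kappa>"] by auto
  next
    case (7 c' K' r \<kappa> f')
    then show ?thesis using assms(1) f S[of "Pop r # \<kappa>"] by auto
  next
    case (8 c' K' r a b \<kappa> f')
    then show ?thesis using assms(1) f S[of "Ifc r a b # \<kappa>"] by auto
  next
    case (9 c' K' r b \<kappa> f')
    then show ?thesis using assms(1) f S[of "Push r b # \<kappa>"] R[of "Push r b # \<kappa>"] U by auto
  next
    case (12 c' K' r \<kappa> f')
    then show ?thesis using assms(1) f S[of "Pop r # \<kappa>"] R[of "Pop r # \<kappa>"] U by auto
  next
    case (13 c' K' r a b \<kappa> f')
    then show ?thesis using assms(1) f S[of "Ifc r a b # \<kappa>"] by auto
  qed (use f C N U in auto)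
qed

text \<open>Base 3 with track 0 as the lowest digit: the empty vector becomes the blank 0, and a
  vector that uses track 0 only becomes its own digit, so input and output words need no
  conversion.\<close>

fun symcode :: "nat \<Rightarrow> sym \<Rightarrow> nat" where
  "symcode 0 f = f 0"
| "symcode (Suc K) f = f 0 + 3 * symcode K (\<lambda>r. f (Suc r))"

lemma symcode_lt: "(\<And>r. f r < 3) \<Longrightarrow> symcode K f < 3 ^ Suc K"
proof (induction K arbitrary: f)
  case (Suc K)
  have "symcode K (\<lambda>r. f (Suc r)) < 3 ^ Suc K" by (rule Suc.IH) (rule Suc.prems)
  with Suc.prems[of 0] show ?case by simp
qed auto

lemma symcode_inj:
  "(\<And>r. f r < 3) \<Longrightarrow> (\<And>r. g r < 3) \<Longrightarrow> symcode K f = symcode K g \<Longrightarrow> r \<le> K \<Longrightarrow> f r = g r"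
proof (induction K arbitrary: f g r)
  case (Suc K)
  have lt: "f 0 < 3" "g 0 < 3" using Suc.prems by auto
  have e: "f 0 + 3 * symcode K (\<lambda>r. f (Suc r)) = g 0 + 3 * symcode K (\<lambda>r. g (Suc r))"
    using Suc.prems by simp
  have "f 0 = g 0" using e lt by presburger
  moreover have "symcode K (\<lambda>r. f (Suc r)) = symcode K (\<lambda>r. g (Suc r))" using e lt by presburger
  then have "r' \<le> K \<Longrightarrow> f (Suc r') = g (Suc r')" for r'
    using Suc.IH[of "\<lambda>r. f (Suc r)" "\<lambda>r. g (Suc r)" r'] Suc.prems by auto
  ultimately show ?case using Suc.prems(4) by (cases r) auto
qed auto

lemma inj_symcode: "inj_on (symcode K) (syms K)"
proof (rule inj_onI)
  fix f g assume fg: "f \<in> syms K" "g \<in> syms K" "symcode K f = symcode K g"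
  show "f = g"
  proof
    fix r show "f r = g r"
      using fg symcode_inj[of f g K r] unfolding syms_def by (cases "r \<le> K") auto
  qed
qed

lemma symcode_zero [simp]: "symcode K (\<lambda>r. 0) = 0"
  by (induction K) auto

lemma symcode_reg0: "(\<And>r. r > 0 \<Longrightarrow> f r = 0) \<Longrightarrow> symcode K f = f 0"
  by (cases K) auto

text \<open>The digits are the symbols of the machine model. The list is reversed because its head
  is the top of the stack, whereas cell 0 holds the bottom.\<close>

definition dig :: "store \<Rightarrow> nat \<Rightarrow> nat \<Rightarrow> nat" where
  "dig s i r = (if i < length (s r) then (if rev (s r) ! i then 2 else 1) else 0)"

definition atape :: "nat \<Rightarrow> store \<Rightarrow> nat \<Rightarrow> sym" where
  "atape K s i = (\<lambda>r. if r < K then dig s i r else if r = K \<and> i = 0 then 1 else 0)"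

definition areach :: "com \<Rightarrow> nat \<Rightarrow> _ \<Rightarrow> _ \<Rightarrow> nat \<Rightarrow> bool" where
  "areach c K a b T \<longleftrightarrow> (\<exists>n\<le>T. (astep c K ^^ n) a = b)"

lemma areach_refl: "areach c K a a 0"
  unfolding areach_def by auto

lemma areach_step: "astep c K a = b \<Longrightarrow> areach c K b d T \<Longrightarrow> areach c K a d (Suc T)"
  unfolding areach_def by (metis Suc_le_mono funpow_simps_right(2) comp_apply)

lemma areach_trans: "areach c K a b T \<Longrightarrow> areach c K b d U \<Longrightarrow> areach c K a d (T + U)"
  unfolding areach_def by (metis add_mono funpow_add_app)

lemma areach_weaken: "areach c K a b T \<Longrightarrow> T \<le> U \<Longrightarrow> areach c K a b U"
  unfolding areach_def using le_trans by blast

lemma areach_Ret: "areach c K (Ret \<kappa>, h, atape K s) (Home \<kappa>, 0, atape K s) (Suc h)"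
proof (induction h)
  case 0
  show ?case by (rule areach_step[OF _ areach_refl]) (simp add: astep_def atape_def fun_upd_idem)
next
  case (Suc h)
  show ?case by (rule areach_step[OF _ Suc.IH]) (simp add: astep_def atape_def fun_upd_idem)
qed

lemma areach_Scan:
  assumes "(\<exists>b. i = Push r b) \<or> i = Pop r \<or> (\<exists>a b. i = Ifc r a b)" and "r < K"
  shows "h \<le> length (s r) \<Longrightarrow>
    areach c K (Scan (i # \<kappa>), h, atape K s) (Scan (i # \<kappa>), length (s r), atape K s) (length (s r) - h)"
proof (induction "length (s r) - h" arbitrary: h)
  case 0
  then show ?case using areach_refl by simp
next
  case (Suc n)
  have "astep c K (Scan (i # \<kappa>), h, atape K s) = (Scan (i # \<kappa>), Suc h, atape K s)"
    using assms Suc.hyps(2) by (auto simp: astep_def atape_def dig_def fun_upd_idem)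
  moreover have "areach c K (Scan (i # \<kappa>), Suc h, atape K s) (Scan (i # \<kappa>), length (s r), atape K s) n"
  proof -
    have "n = length (s r) - Suc h" "Suc h \<le> length (s r)" using Suc.hyps(2) by linarith+
    then show ?thesis using Suc.hyps(1)[of "Suc h"] by metis
  qed
  ultimately have "areach c K (Scan (i # \<kappa>), h, atape K s) (Scan (i # \<kappa>), length (s r), atape K s) (Suc n)"
    by (rule areach_step)
  then show ?case using Suc.hyps(2) by simp
qed

lemma atape_push:
  "r < K \<Longrightarrow> (atape K s)(length (s r) := (atape K s (length (s r)))(r := if b then 2 else 1)) = atape K (s(r := b # s r))"
  by (rule ext, rule ext) (auto simp: atape_def dig_def nth_append)

lemma atape_pop:
  assumes "r < K" "s r \<noteq> []"
  shows "(atape K s)(length (s r) - 1 := (atape K s (length (s r) - 1))(r := 0)) = atape K (s(r := tl (s r)))"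
proof -
  obtain b bs where "s r = b # bs" using assms by (cases "s r") auto
  then show ?thesis using assms
    by (intro ext) (auto simp: atape_def dig_def nth_append)
qed

text \<open>The cost is that of one walk to the top of a stack and back, plus a constant.\<close>

lemma areach_cstep:
  assumes "bnd K i" and L: "\<And>r. length (s r) \<le> L"
    and st: "cstep (i # \<kappa>, s) = (\<kappa>', s')"
  shows "areach c K (Home (i # \<kappa>), 0, atape K s) (Home \<kappa>', 0, atape K s') (2 * L + 4)"
proof (cases i)
  case Skip
  then show ?thesis using st
    by (intro areach_weaken[OF areach_step[OF _ areach_refl]]) (auto simp: astep_def fun_upd_idem)
next
  case (Seq a b)
  then show ?thesis using st
    by (intro areach_weaken[OF areach_step[OF _ areach_refl]]) (auto simp: astep_def fun_upd_idem)
next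
  case (While r a)
  then show ?thesis using st assms(1)
    by (intro areach_weaken[OF areach_step[OF _ areach_refl]])
      (auto simp: astep_def fun_upd_idem atape_def dig_def)
next
  case (Push r b)
  have 1: "astep c K (Home (i # \<kappa>), 0, atape K s) = (Scan (i # \<kappa>), 0, atape K s)"
    using Push by (auto simp: astep_def fun_upd_idem)
  have 2: "areach c K (Scan (i # \<kappa>), 0, atape K s) (Scan (i # \<kappa>), length (s r), atape K s) (length (s r) - 0)"
    using Push assms by (intro areach_Scan) auto
  have e: "atape K s (length (s r)) r = 0" using Push assms by (auto simp: atape_def dig_def)
  have 3: "astep c K (Scan (i # \<kappa>), length (s r), atape K s) = (Ret \<kappa>, length (s r) - 1, atape K s')"
    using Push st assms(1) e atape_push[of r K s b] by (simp add: astep_def)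
  have "areach c K (Home (i # \<kappa>), 0, atape K s) (Home \<kappa>, 0, atape K s')
     (Suc ((length (s r) - 0) + Suc (Suc (length (s r) - 1))))"
    by (rule areach_step[OF 1 areach_trans[OF 2 areach_step[OF 3 areach_Ret]]])
  moreover have "\<kappa>' = \<kappa>" using Push st by simp
  ultimately show ?thesis using L[of r] by (auto elim!: areach_weaken)
next
  case (Pop r)
  show ?thesis
  proof (cases "s r = []")
    case True
    then show ?thesis using st assms(1) Pop
      by (intro areach_weaken[OF areach_step[OF _ areach_refl]])
        (auto simp: astep_def fun_upd_idem atape_def dig_def)
  next
    case False
    have 1: "astep c K (Home (i # \<kappa>), 0, atape K s) = (Scan (i # \<kappa>), 0, atape K s)"
      using Pop False assms(1) by (auto simp: astep_def fun_upd_idem atape_def dig_def)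
    have 2: "areach c K (Scan (i # \<kappa>), 0, atape K s) (Scan (i # \<kappa>), length (s r), atape K s) (length (s r) - 0)"
      using Pop assms by (intro areach_Scan) auto
    have 3: "astep c K (Scan (i # \<kappa>), length (s r), atape K s) = (Top (i # \<kappa>), length (s r) - 1, atape K s)"
      using Pop st assms(1) by (auto simp: astep_def fun_upd_idem atape_def dig_def)
    have 4: "astep c K (Top (i # \<kappa>), length (s r) - 1, atape K s) = (Ret \<kappa>, length (s r) - 1 - 1, atape K s')"
      using Pop st assms(1) False atape_pop[of r K s] by (simp add: astep_def)
    have "areach c K (Home (i # \<kappa>), 0, atape K s) (Home \<kappa>, 0, atape K s')
       (Suc ((length (s r) - 0) + Suc (Suc (Suc (length (s r) - 1 - 1)))))"
      by (rule areach_step[OF 1 areach_trans[OF 2 areach_step[OF 3 areach_step[OF 4 areach_Ret]]]])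
    moreover have "\<kappa>' = \<kappa>" using Pop st by simp
    ultimately show ?thesis using L[of r] by (auto elim!: areach_weaken)
  qed
next
  case (Ifc r a b)
  show ?thesis
  proof (cases "s r = []")
    case True
    then show ?thesis using st assms(1) Ifc
      by (intro areach_weaken[OF areach_step[OF _ areach_refl]])
        (auto simp: astep_def fun_upd_idem atape_def dig_def)
  next
    case False
    then obtain d ds where d: "s r = d # ds" by (cases "s r") auto
    have 1: "astep c K (Home (i # \<kappa>), 0, atape K s) = (Scan (i # \<kappa>), 0, atape K s)"
      using Ifc False assms(1) by (auto simp: astep_def fun_upd_idem atape_def dig_def)
    have 2: "areach c K (Scan (i # \<kappa>), 0, atape K s) (Scan (i # \<kappa>), length (s r), atape K s) (length (s r) - 0)"
      using Ifc assms by (intro areach_Scan) auto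
    have 3: "astep c K (Scan (i # \<kappa>), length (s r), atape K s) = (Top (i # \<kappa>), length (s r) - 1, atape K s)"
      using Ifc st assms(1) by (auto simp: astep_def fun_upd_idem atape_def dig_def)
    have 4: "astep c K (Top (i # \<kappa>), length (s r) - 1, atape K s) = (Ret \<kappa>', length (s r) - 1 - 1, atape K s')"
      using Ifc st assms(1) d by (auto simp: astep_def fun_upd_idem atape_def dig_def nth_append)
    have "areach c K (Home (i # \<kappa>), 0, atape K s) (Home \<kappa>', 0, atape K s')
       (Suc ((length (s r) - 0) + Suc (Suc (Suc (length (s r) - 1 - 1)))))"
      by (rule areach_step[OF 1 areach_trans[OF 2 areach_step[OF 3 areach_step[OF 4 areach_Ret]]]])
    then show ?thesis using L[of r] by (auto elim!: areach_weaken)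
  qed
qed

text \<open>Each step pushes at most one bit, so after n steps every stack has height at most L + n.
  This bounds all walks and keeps the slowdown quadratic.\<close>

lemma areach_csteps:
  assumes "bnd K c"
  shows "(cstep ^^ n) ([c], s) = (\<kappa>, s') \<Longrightarrow> (\<And>r. length (s r) \<le> L) \<Longrightarrow>
    areach c K (Home [c], 0, atape K s) (Home \<kappa>, 0, atape K s') (n * (2 * (L + n) + 4)) \<and>
    list_all (bnd K) \<kappa> \<and> (\<forall>r. length (s' r) \<le> L + n)"
proof (induction n arbitrary: \<kappa> s')
  case 0
  then show ?case using areach_refl assms by auto
next
  case (Suc n)
  obtain \<kappa>1 s1 where 1: "(cstep ^^ n) ([c], s) = (\<kappa>1, s1)" by fastforce
  note IH = Suc.IH[OF 1 Suc.prems(2)]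
  have st: "cstep (\<kappa>1, s1) = (\<kappa>, s')" using Suc.prems(1) 1 by simp
  have len: "length (s' r) \<le> L + Suc n" for r
    using st IH by (cases "(\<kappa>1, s1)" rule: cstep.cases) (auto split: if_splits intro: le_SucI simp: le_diff_conv le_Suc_eq)
  have bnd: "list_all (bnd K) \<kappa>"
    using st IH by (cases "(\<kappa>1, s1)" rule: cstep.cases) (auto split: if_splits)
  have "areach c K (Home \<kappa>1, 0, atape K s1) (Home \<kappa>, 0, atape K s') (2 * (L + n) + 4)"
  proof (cases \<kappa>1)
    case Nil
    then show ?thesis using st by (auto intro: areach_weaken[OF areach_refl])
  next
    case (Cons i \<kappa>2)
    then show ?thesis using areach_cstep[of K i s1 "L + n" \<kappa>2 \<kappa> s' c] st IH by auto
  qed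
  then have "areach c K (Home [c], 0, atape K s) (Home \<kappa>, 0, atape K s')
      (n * (2 * (L + n) + 4) + (2 * (L + n) + 4))"
    using IH areach_trans by blast
  then have "areach c K (Home [c], 0, atape K s) (Home \<kappa>, 0, atape K s') (Suc n * (2 * (L + Suc n) + 4))"
    by (rule areach_weaken) (simp add: algebra_simps)
  with len bnd show ?case by blast
qed

text \<open>Reversal puts the first bit of the word at the bottom of the stack, that is, into cell
  0, where \<open>tm_init\<close> and \<open>tape_out\<close> expect it.\<close>

definition store0 :: "bits \<Rightarrow> store" where
  "store0 x = (\<lambda>r. if r = 0 then rev x else [])"

text \<open>The additive 2 pays for setting and removing the mark in cell 0.\<close>

lemma areach_runs:
  assumes "bnd K c" "K > 0" "runs c (store0 x) (store0 y) T"
  shows "areach c K (Init, 0, \<lambda>i r. if r < K then dig (store0 x) i r else 0)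
     (Halt, 0, \<lambda>i r. if r < K then dig (store0 y) i r else 0) (T * (2 * (length x + T) + 4) + 2)"
proof -
  obtain t where t: "t \<le> T" "(cstep ^^ t) ([c], store0 x) = ([], store0 y)"
    using assms(3) unfolding runs_def by auto
  have A: "areach c K (Home [c], 0, atape K (store0 x)) (Home [], 0, atape K (store0 y))
      (t * (2 * (length x + t) + 4))"
    using areach_csteps[OF assms(1) t(2), of "length x"] by (auto simp: store0_def)
  have 1: "astep c K (Init, 0, \<lambda>i r. if r < K then dig (store0 x) i r else 0) =
     (Home [c], 0, atape K (store0 x))"
    by (auto simp: astep_def atape_def fun_eq_iff)
  have 2: "astep c K (Home [], 0, atape K (store0 y)) =
     (Halt, 0, \<lambda>i r. if r < K then dig (store0 y) i r else 0)"
    by (auto simp: astep_def atape_def fun_eq_iff)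
  have "areach c K (Init, 0, \<lambda>i r. if r < K then dig (store0 x) i r else 0)
     (Halt, 0, \<lambda>i r. if r < K then dig (store0 y) i r else 0) (Suc (t * (2 * (length x + t) + 4) + Suc 0))"
    by (rule areach_step[OF 1 areach_trans[OF A areach_step[OF 2 areach_refl]]])
  then show ?thesis
  proof (rule areach_weaken)
    have "t * (2 * (length x + t) + 4) \<le> T * (2 * (length x + T) + 4)"
      using t(1) by (intro mult_mono) auto
    then show "Suc (t * (2 * (length x + t) + 4) + Suc 0) \<le> T * (2 * (length x + T) + 4) + 2" by simp
  qed
qed

lemma tape_out_eq:
  assumes "\<And>i. t i = (if i < length y then (if y ! i then 2 else 1) else 0)"
  shows "tape_out t = y"
proof -
  have "(LEAST k. t k \<noteq> 1 \<and> t k \<noteq> 2) = length y"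
    by (rule Least_equality) (auto simp: assms split: if_splits intro: leI)
  then show ?thesis unfolding tape_out_def by (auto intro!: nth_equalityI simp: assms)
qed

lemma ex_tm:
  assumes "K > 0" "bnd K c"
  shows "\<exists>M. tm_wf M \<and> (\<forall>x y T. runs c (store0 x) (store0 y) T \<longrightarrow>
    (\<exists>n\<le>T * (2 * (length x + T) + 4) + 2. fst (tm_run M n x) = 1 \<and> tape_out (snd (snd (tm_run M n x))) = y))"
proof -
  obtain g :: "ph \<Rightarrow> nat" where g: "inj_on g (phs c)"
    using finite_imp_inj_to_nat_seg[OF finite_phs[of c]] by auto
  \<comment> \<open>The numbers 0 and 1 are reserved for the start and the halting state; all others
    are moved up by 2.\<close>
  define pc where "pc q = (if q = Init then 0 else if q = Halt then 1 else g q + 2)" for q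
  have pc_inj: "inj_on pc (phs c)"
    using g unfolding inj_on_def pc_def by auto
  define ns where "ns = Suc (Max (pc ` phs c)) + 2"
  have ns: "pc q < ns" if "q \<in> phs c" for q
    using that finite_phs unfolding ns_def by (auto simp: less_Suc_eq_le intro!: trans_le_add1 le_SucI)
  define sy where "sy = symcode K"
  have sy_inj: "inj_on sy (syms K)" unfolding sy_def by (rule inj_symcode)
  \<comment> \<open>Outside the codes of states and symbols the value is arbitrary, as long as
    \<open>tm_wf\<close> holds.\<close>
  define D where "D q a = (if q \<in> pc ` phs c \<and> a \<in> sy ` syms K then
     (case adelta c K (inv_into (phs c) pc q) (inv_into (syms K) sy a) of (q', f, d) \<Rightarrow> (pc q', sy f, d))
     else (0, 0, False))" for q a
  define M where "M = \<lparr>nstates = ns, nsyms = 3 ^ Suc K, delta = D\<rparr>"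
  have D: "D (pc q) (sy f) = (case adelta c K q f of (q', f, d) \<Rightarrow> (pc q', sy f, d))"
    if "q \<in> phs c" "f \<in> syms K" for q f
    using that pc_inj sy_inj by (simp add: D_def)
  have sylt: "sy f < 3 ^ Suc K" if "f \<in> syms K" for f
    using that symcode_lt unfolding sy_def syms_def by blast
  have wf: "tm_wf M"
  proof -
    have "fst (D q a) < ns \<and> fst (snd (D q a)) < 3 ^ Suc K" for q a
    proof (cases "q \<in> pc ` phs c \<and> a \<in> sy ` syms K")
      case True
      then obtain q0 f0 where qf: "q0 \<in> phs c" "q = pc q0" "f0 \<in> syms K" "a = sy f0" by blast
      show ?thesis using adelta_closed[OF qf(1,3) assms(2)] D[OF qf(1,3)] ns sylt qf
        by (auto split: prod.splits)
    next
      case False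
      then have "D q a = (0, 0, False)" unfolding D_def by (simp only: if_False)
      then show ?thesis unfolding ns_def by simp
    qed
    then show ?thesis using assms(1) unfolding tm_wf_def M_def ns_def
      by (auto simp: Suc_le_eq)
  qed
  define enc where "enc = (\<lambda>(q, h :: nat, t :: nat \<Rightarrow> sym). (pc q, h, \<lambda>i. sy (t i)))"
  define ok where "ok = (\<lambda>(q, h :: nat, t). q \<in> phs c \<and> (\<forall>i :: nat. t i \<in> syms K))"
  have sim1: "ok (astep c K a) \<and> tm_step M (enc a) = enc (astep c K a)" if "ok a" for a
  proof -
    obtain q h t where a: "a = (q, h, t)" by (cases a)
    have q: "q \<in> phs c" "t i \<in> syms K" for i using that a unfolding ok_def by auto
    show ?thesis
    proof (cases "q = Halt")
      case True
      then show ?thesis using that unfolding a ok_def enc_def astep_def tm_step_def pc_def by simp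
    next
      case False
      then have "pc q \<noteq> 1" unfolding pc_def by auto
      obtain q' f d where e: "adelta c K q (t h) = (q', f, d)" by (metis prod_cases3)
      have c: "q' \<in> phs c" "f \<in> syms K"
        using adelta_closed[OF q(1) q(2)[of h] assms(2)] e by auto
      have "delta M (pc q) (sy (t h)) = (pc q', sy f, d)"
        using D[OF q(1) q(2)[of h]] e by (simp add: M_def)
      moreover have "(\<lambda>i. sy (t i))(h := sy f) = (\<lambda>i. sy ((t(h := f)) i))" by (rule ext) simp
      ultimately show ?thesis using c q False \<open>pc q \<noteq> 1\<close>
        unfolding a ok_def enc_def astep_def tm_step_def by (simp add: e)
    qed
  qed
  have simn: "ok ((astep c K ^^ n) a) \<and> (tm_step M ^^ n) (enc a) = enc ((astep c K ^^ n) a)" if "ok a" for a n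
    using that by (induction n) (auto simp: sim1)
  have "\<exists>n\<le>T * (2 * (length x + T) + 4) + 2. fst (tm_run M n x) = 1 \<and> tape_out (snd (snd (tm_run M n x))) = y"
    if r: "runs c (store0 x) (store0 y) T" for x y T
  proof -
    define tp where "tp z = (\<lambda>i r. if r < K then dig (store0 z) i r else 0)" for z
    have tp0: "sy (tp z i) = (if i < length z then (if z ! i then 2 else 1) else 0)" for z i
    proof -
      have "sy (tp z i) = tp z i 0"
        unfolding sy_def by (rule symcode_reg0) (auto simp: tp_def dig_def store0_def)
      then show ?thesis using assms(1) by (auto simp: tp_def dig_def store0_def)
    qed
    obtain n where n: "n \<le> T * (2 * (length x + T) + 4) + 2" "(astep c K ^^ n) (Init, 0, tp x) = (Halt, 0, tp y)"
      using areach_runs[OF assms(2,1) r] unfolding areach_def tp_def by blast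
    have "ok (Init, 0, tp x)"
      by (auto simp: ok_def phs_def tp_def syms_def dig_def)
    moreover have "enc (Init, 0, tp x) = tm_init x"
      by (auto simp: enc_def tm_init_def pc_def tp0 fun_eq_iff)
    ultimately have "tm_run M n x = enc (Halt, 0, tp y)"
      using simn[of "(Init, 0, tp x)" n] n(2) unfolding tm_run_def by simp
    moreover have "tape_out (\<lambda>i. sy (tp y i)) = y" by (rule tape_out_eq) (simp add: tp0)
    ultimately show ?thesis using n(1) by (intro exI[of _ n]) (auto simp: enc_def pc_def)
  qed
  with wf show ?thesis by blast
qed

text \<open>One-parameter polynomial bounds, closed under sums, products and composition.\<close>
definition pb :: "(nat \<Rightarrow> nat) \<Rightarrow> bool" where
  "pb f \<longleftrightarrow> (\<exists>k. \<forall>n. f n \<le> (n + 2) ^ k)"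

text \<open>The base n + 2 is at least 2 for every n, so constants and constant factors are absorbed
  by a larger exponent.\<close>

lemma pb_const: "pb (\<lambda>n. c)"
  unfolding pb_def
proof (intro exI allI)
  fix n :: nat
  have "c \<le> 2 ^ c" using less_exp[of c] by (simp add: less_imp_le)
  also have "\<dots> \<le> (n + 2) ^ c" by (rule power_mono) auto
  finally show "c \<le> (n + 2) ^ c" .
qed

lemma pb_id: "pb (\<lambda>n. n)"
  unfolding pb_def by (rule exI[of _ 1]) simp

lemma pb_mult:
  assumes "pb f" "pb g"
  shows "pb (\<lambda>n. f n * g n)"
proof -
  obtain k l where "\<And>n. f n \<le> (n + 2) ^ k" "\<And>n. g n \<le> (n + 2) ^ l"
    using assms unfolding pb_def by blast
  then have "f n * g n \<le> (n + 2) ^ (k + l)" for n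
    by (simp add: power_add mult_mono)
  then show ?thesis unfolding pb_def by blast
qed

lemma pb_add:
  assumes "pb f" "pb g"
  shows "pb (\<lambda>n. f n + g n)"
proof -
  obtain k l where kl: "\<And>n. f n \<le> (n + 2) ^ k" "\<And>n. g n \<le> (n + 2) ^ l"
    using assms unfolding pb_def by blast
  have "f n + g n \<le> (n + 2) ^ Suc (max k l)" for n
  proof -
    have "(n + 2) ^ k \<le> (n + 2) ^ max k l" "(n + 2) ^ l \<le> (n + 2) ^ max k l"
      by (auto intro!: power_increasing)
    with kl[of n] have "f n + g n \<le> 2 * (n + 2) ^ max k l" by linarith
    also have "\<dots> \<le> (n + 2) ^ Suc (max k l)" by simp
    finally show ?thesis .
  qed
  then show ?thesis unfolding pb_def by blast
qed

lemma pb_comp: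
  assumes "pb f" "pb g"
  shows "pb (\<lambda>n. f (g n))"
proof -
  obtain k l where kl: "\<And>n. f n \<le> (n + 2) ^ k" "\<And>n. g n \<le> (n + 2) ^ l"
    using assms unfolding pb_def by blast
  have "f (g n) \<le> (n + 2) ^ ((l + 2) * k)" for n
  proof -
    have "1 \<le> (n + 2) ^ l" by simp
    \<comment> \<open>The factor 4 is convenient because 4 <= (n + 2)^2, so it costs 2 in the
      exponent.\<close>
    then have "g n + 2 \<le> 4 * (n + 2) ^ l" using kl(2)[of n] by linarith
    also have "\<dots> \<le> (n + 2) ^ 2 * (n + 2) ^ l"
      using power_mono[of 2 "n + 2" 2] by (intro mult_right_mono) auto
    also have "\<dots> = (n + 2) ^ (l + 2)" by (simp only: power_add mult.commute)
    finally have "g n + 2 \<le> (n + 2) ^ (l + 2)" .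
    then have "(g n + 2) ^ k \<le> ((n + 2) ^ (l + 2)) ^ k" by (rule power_mono) simp
    then show ?thesis using kl(1)[of "g n"] by (metis le_trans power_mult)
  qed
  then show ?thesis unfolding pb_def by blast
qed

text \<open>This returns to the shape of bound in \<open>polytime_fun\<close>: n + 2 is at most 3 n
  for n > 0, and the additive constant covers n = 0.\<close>

lemma pb_monomial:
  assumes "pb f"
  shows "\<exists>c k. \<forall>n. f n \<le> c * n ^ k + c"
proof -
  obtain k where k: "\<And>n. f n \<le> (n + 2) ^ k" using assms unfolding pb_def by blast
  have "(n + 2) ^ k \<le> 3 ^ k * n ^ k + 3 ^ k" for n :: nat
  proof (cases "n = 0")
    case True
    have "(2 :: nat) ^ k \<le> 3 ^ k" by (rule power_mono) auto
    then show ?thesis using True by (simp only: add_0 trans_le_add2)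
  next
    case False
    then have "(n + 2) ^ k \<le> (3 * n) ^ k" by (intro power_mono) auto
    then show ?thesis by (simp add: power_mult_distrib)
  qed
  then show ?thesis using k le_trans by blast
qed

lemma polytime_runs:
  assumes "pb T" "\<And>x. runs c (store0 x) (store0 (f x)) (T (length x))"
  shows "polytime_fun f"
proof -
  obtain K where K: "K > 0" "bnd K c" using ex_bnd by blast
  obtain M where M: "tm_wf M" "\<And>x y T. runs c (store0 x) (store0 y) T \<Longrightarrow>
    (\<exists>n\<le>T * (2 * (length x + T) + 4) + 2. fst (tm_run M n x) = 1 \<and> tape_out (snd (snd (tm_run M n x))) = y)"
    using ex_tm[OF K] by blast
  have "pb (\<lambda>n. T n * (2 * (n + T n) + 4) + 2)"
    by (intro pb_add pb_mult pb_const pb_id assms(1))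
  then obtain a k where ak: "\<And>n. T n * (2 * (n + T n) + 4) + 2 \<le> a * n ^ k + a"
    using pb_monomial by blast
  have "\<exists>n\<le>a * length x ^ k + a. fst (tm_run M n x) = 1 \<and> tape_out (snd (snd (tm_run M n x))) = f x" for x
    using M(2)[OF assms(2)[of x]] ak[of "length x"] le_trans by blast
  then show ?thesis unfolding polytime_fun_def using M(1) by blast
qed

section \<open>Generators of bit strings\<close>

text \<open>Polynomials without subtraction are monotone, so replacing all variables by a common
  upper bound M bounds every value and every loop length.\<close>

datatype exp = EC nat | EV nat | Add exp exp | Mul exp exp

fun ev :: "exp \<Rightarrow> (nat \<Rightarrow> nat) \<Rightarrow> nat" where
  "ev (EC c) e = c"
| "ev (EV v) e = e v"
| "ev (Add a b) e = ev a e + ev b e"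
| "ev (Mul a b) e = ev a e * ev b e"

datatype gen = GLit bits | GNat exp | GBit exp | GSeq gen gen | GFor nat exp gen

fun den :: "gen \<Rightarrow> bits \<Rightarrow> (nat \<Rightarrow> nat) \<Rightarrow> bits" where
  "den (GLit l) x e = l"
| "den (GNat a) x e = enc_nat (ev a e)"
| "den (GBit a) x e = [x ! ev a e]"
| "den (GSeq f g) x e = den f x e @ den g x e"
| "den (GFor v a g) x e = concat (map (\<lambda>i. den g x (e(v := i))) [0..<ev a e])"

text \<open>The register of a loop variable must be empty on entry, since the loop counts it up from
  0 and clears it at the end.\<close>

fun gok :: "gen \<Rightarrow> bits \<Rightarrow> (nat \<Rightarrow> nat) \<Rightarrow> bool" where
  "gok (GBit a) x e \<longleftrightarrow> ev a e < length x"
| "gok (GSeq f g) x e \<longleftrightarrow> gok f x e \<and> gok g x e"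
| "gok (GFor v a g) x e \<longleftrightarrow> e v = 0 \<and> (\<forall>i<ev a e. gok g x (e(v := i)))"
| "gok _ x e \<longleftrightarrow> True"

text \<open>Registers: 0 for the (reversed) output, 1 for the input, 2 as scratch space,
  odd numbers from 3 on for variables, even numbers from 4 on for temporaries.\<close>
definition tr :: "nat \<Rightarrow> nat" where "tr k = 2 * k + 4"
definition vr :: "nat \<Rightarrow> nat" where "vr v = 2 * v + 3"

lemma tr_neq [simp]: "tr k \<noteq> 0" "tr k \<noteq> Suc 0" "tr k \<noteq> 2" "vr k \<noteq> 0" "vr k \<noteq> Suc 0" "vr k \<noteq> 2"
    "tr k \<noteq> vr j" "vr j \<noteq> tr k" "tr k = tr j \<longleftrightarrow> k = j" "vr k = vr j \<longleftrightarrow> k = j"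
    "2 \<noteq> tr k" "2 \<noteq> vr k"
  unfolding tr_def vr_def by presburger+

abbreviation un :: "nat \<Rightarrow> bool list" where "un n \<equiv> replicate n True"

text \<open>Normal form of stores between the pieces of a generator: variables and temporaries in
  unary, scratch register 2 empty. The index computations invert \<open>tr\<close> and
  \<open>vr\<close>.\<close>

definition st :: "bits \<Rightarrow> bits \<Rightarrow> (nat \<Rightarrow> nat) \<Rightarrow> (nat \<Rightarrow> nat) \<Rightarrow> store" where
  "st out x e t = (\<lambda>r. if r = 0 then out else if r = 1 then x else if r = 2 then []
      else if even r then un (t (r div 2 - 2)) else un (e (r div 2 - 1)))"

lemma st_simps [simp]:
  "st out x e t 0 = out" "st out x e t (Suc 0) = x" "st out x e t 2 = []"
  "st out x e t (tr k) = un (t k)" "st out x e t (vr v) = un (e v)"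
  unfolding st_def tr_def vr_def by auto

lemma st_cong:
  "out = out' \<Longrightarrow> x = x' \<Longrightarrow> (\<And>v. e v = e' v) \<Longrightarrow> (\<And>k. t k = t' k) \<Longrightarrow> st out x e t = st out' x' e' t'"
  unfolding st_def by auto

lemma st_upd [simp]:
  "(st out x e t)(0 := out') = st out' x e t"
  "(st out x e t)(Suc 0 := x') = st out x' e t"
  unfolding st_def by (auto simp: fun_eq_iff)

lemma st_upd_tr: "(st out x e t)(tr k := un n) = st out x e (t(k := n))"
  unfolding st_def tr_def by (auto simp: fun_eq_iff)

lemma st_upd_vr: "(st out x e t)(vr v := un n) = st out x (e(v := n)) t"
  unfolding st_def vr_def by (auto simp: fun_eq_iff) presburger

lemma runs_Push_tr: "runs (Push (tr k) True) (st out x e t) (st out x e (t(k := Suc (t k)))) 1"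
  by (rule runs_eq[OF runs_Push]) (auto simp flip: st_upd_tr)

lemma runs_Pop_tr: "runs (Pop (tr k)) (st out x e t) (st out x e (t(k := t k - 1))) 1"
  by (rule runs_eq[OF runs_Pop]) (auto simp flip: st_upd_tr)

lemma runs_Push_vr: "runs (Push (vr v) True) (st out x e t) (st out x (e(v := Suc (e v))) t) 1"
  by (rule runs_eq[OF runs_Push]) (auto simp flip: st_upd_vr)

lemma runs_Push_out: "runs (Push 0 b) (st out x e t) (st (b # out) x e t) 1"
  by (rule runs_eq[OF runs_Push]) auto

section \<open>Arithmetic in unary registers\<close>

fun pushn :: "nat \<Rightarrow> nat \<Rightarrow> com" where
  "pushn r 0 = Skip"
| "pushn r (Suc n) = Seq (Push r True) (pushn r n)"

lemma runs_pushn: "runs (pushn r n) s (s(r := un n @ s r)) (2 * n + 1)"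
proof (induction n arbitrary: s)
  case 0
  then show ?case using runs_Skip[of s] by simp
next
  case (Suc n)
  have "runs (pushn r (Suc n)) s ((s(r := True # s r))(r := un n @ (s(r := True # s r)) r)) (1 + (2 * n + 1) + 1)"
    unfolding pushn.simps by (rule runs_Seq[OF runs_Push Suc])
  moreover have "(s(r := True # s r))(r := un n @ (s(r := True # s r)) r) = s(r := un (Suc n) @ s r)"
    by (simp add: replicate_app_Cons_same)
  ultimately have "runs (pushn r (Suc n)) s (s(r := un (Suc n) @ s r)) (1 + (2 * n + 1) + 1)" by metis
  then show ?case by (rule runs_weaken) simp
qed

text \<open>Reading a stack destroys it, so a variable is emptied into the target and into register
  2 simultaneously and then restored from there. Multiplication is repeated addition, counted by
  temporary k.\<close>

fun addto :: "nat \<Rightarrow> nat \<Rightarrow> exp \<Rightarrow> com" where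
  "addto d k (EC c) = pushn (tr d) c"
| "addto d k (EV v) = Seq (While (vr v) (Seq (Pop (vr v)) (Seq (Push (tr d) True) (Push 2 True))))
      (While 2 (Seq (Pop 2) (Push (vr v) True)))"
| "addto d k (Add a b) = Seq (addto d k a) (addto d k b)"
| "addto d k (Mul a b) = Seq (addto k (Suc k) a) (While (tr k) (Seq (Pop (tr k)) (addto d (Suc k) b)))"

fun te :: "exp \<Rightarrow> nat \<Rightarrow> nat" where
  "te (EC c) M = 2 * c + 1"
| "te (EV v) M = 10 * M + 3"
| "te (Add a b) M = te a M + te b M + 1"
| "te (Mul a b) M = te a M + (ev a (\<lambda>_. M) * (te b M + 3) + 2)"

lemma ev_mono: "(\<And>v. e v \<le> M) \<Longrightarrow> ev a e \<le> ev a (\<lambda>_. M)"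
  by (induction a) (auto intro: add_mono mult_mono)

lemma runs_move:
  assumes "s (vr v) = un n" "s 2 = []" "d \<noteq> vr v" "d \<noteq> 2"
  shows "runs (Seq (While (vr v) (Seq (Pop (vr v)) (Seq (Push d True) (Push 2 True))))
      (While 2 (Seq (Pop 2) (Push (vr v) True)))) s (s(d := un n @ s d)) (10 * n + 3)"
proof -
  define \<sigma> where "\<sigma> i = s(vr v := un (n - i), 2 := un i, d := un i @ s d)" for i
  define \<tau> where "\<tau> i = s(vr v := un i, 2 := un (n - i), d := un n @ s d)" for i
  have "runs (Seq (Pop (vr v)) (Seq (Push d True) (Push 2 True))) (\<sigma> i) (\<sigma> (Suc i)) 5" if i: "i < n" for i
  proof -
    obtain j where j: "n - i = Suc j" "n - Suc i = j" using i by (cases "n - i") auto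
    show ?thesis
      by (rule runs_eq[OF runs_Seq[OF runs_Pop runs_Seq[OF runs_Push runs_Push]]])
        (use j assms(3,4) in \<open>auto simp: \<sigma>_def fun_eq_iff\<close>)
  qed
  then have 1: "runs (While (vr v) (Seq (Pop (vr v)) (Seq (Push d True) (Push 2 True)))) (\<sigma> 0) (\<sigma> n) (n * (5 + 1) + 1)"
    by (rule runs_While[rotated 2]) (use assms(3,4) in \<open>auto simp: \<sigma>_def\<close>)
  have "runs (Seq (Pop 2) (Push (vr v) True)) (\<tau> i) (\<tau> (Suc i)) 3" if i: "i < n" for i
  proof -
    obtain j where j: "n - i = Suc j" "n - Suc i = j" using i by (cases "n - i") auto
    show ?thesis
      by (rule runs_eq[OF runs_Seq[OF runs_Pop runs_Push]])
        (use j assms(3,4) in \<open>auto simp: \<tau>_def fun_eq_iff\<close>)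
  qed
  then have 2: "runs (While 2 (Seq (Pop 2) (Push (vr v) True))) (\<tau> 0) (\<tau> n) (n * (3 + 1) + 1)"
    by (rule runs_While[rotated 2]) (use assms(3,4) in \<open>auto simp: \<tau>_def\<close>)
  have "\<sigma> 0 = s" "\<sigma> n = \<tau> 0" "\<tau> n = s(d := un n @ s d)"
    using assms by (auto simp: \<sigma>_def \<tau>_def fun_eq_iff)
  with 1 2 have "runs (While (vr v) (Seq (Pop (vr v)) (Seq (Push d True) (Push 2 True)))) s (\<tau> 0) (n * (5 + 1) + 1)"
    "runs (While 2 (Seq (Pop 2) (Push (vr v) True))) (\<tau> 0) (s(d := un n @ s d)) (n * (3 + 1) + 1)"
    by metis+
  from runs_Seq[OF this] show ?thesis by (rule runs_weaken) simp
qed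

lemma runs_addto:
  assumes "\<And>v. e v \<le> M"
  shows "d < k \<Longrightarrow> (\<And>j. j \<ge> k \<Longrightarrow> t j = 0) \<Longrightarrow>
    runs (addto d k a) (st out x e t) (st out x e (t(d := ev a e + t d))) (te a M)"
proof (induction a arbitrary: d k t)
  case (EC c)
  have "runs (pushn (tr d) c) (st out x e t) (st out x e (t(d := c + t d))) (2 * c + 1)"
    using runs_pushn[of "tr d" c "st out x e t"] by (simp add: st_upd_tr flip: replicate_add)
  then show ?case unfolding addto.simps ev.simps te.simps .
next
  case (EV v)
  have "runs (addto d k (EV v)) (st out x e t) ((st out x e t)(tr d := un (e v) @ st out x e t (tr d))) (10 * e v + 3)"
    unfolding addto.simps by (intro runs_move) auto
  then have "runs (addto d k (EV v)) (st out x e t) (st out x e (t(d := e v + t d))) (10 * e v + 3)"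
    by (simp add: st_upd_tr flip: replicate_add)
  then show ?case unfolding ev.simps by (rule runs_weaken) (use assms[of v] in auto)
next
  case (Add a b)
  have 1: "runs (addto d k a) (st out x e t) (st out x e (t(d := ev a e + t d))) (te a M)"
    by (rule Add.IH(1)) (use Add.prems in auto)
  have 2: "runs (addto d k b) (st out x e (t(d := ev a e + t d)))
     (st out x e ((t(d := ev a e + t d))(d := ev b e + (t(d := ev a e + t d)) d))) (te b M)"
    by (rule Add.IH(2)) (use Add.prems in auto)
  show ?case unfolding addto.simps
    by (rule runs_eq[OF runs_Seq[OF 1 2]]) (auto intro!: st_cong)
next
  case (Mul a b)
  have 1: "runs (addto k (Suc k) a) (st out x e t) (st out x e (t(k := ev a e + t k))) (te a M)"
    by (rule Mul.IH(1)) (use Mul.prems in auto)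
  \<comment> \<open>The store after i rounds: the counter k has gone down by i, and d has gained i
    times the second factor.\<close>
  define \<sigma> where "\<sigma> i = st out x e (t(k := ev a e - i, d := i * ev b e + t d))" for i
  have "runs (Seq (Pop (tr k)) (addto d (Suc k) b)) (\<sigma> i) (\<sigma> (Suc i)) (te b M + 2)" if i: "i < ev a e" for i
  proof -
    obtain j where j: "ev a e - i = Suc j" "ev a e - Suc i = j" using i by (cases "ev a e - i") auto
    have "runs (Pop (tr k)) (\<sigma> i) (st out x e (t(k := j, d := i * ev b e + t d))) 1"
      by (rule runs_eq[OF runs_Pop_tr[of k out x e "t(k := ev a e - i, d := i * ev b e + t d)", folded \<sigma>_def]])
        (use j Mul.prems(1) in \<open>auto intro!: st_cong\<close>)
    moreover have "runs (addto d (Suc k) b) (st out x e (t(k := j, d := i * ev b e + t d)))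
       (st out x e ((t(k := j, d := i * ev b e + t d))(d := ev b e + (t(k := j, d := i * ev b e + t d)) d))) (te b M)"
      by (rule Mul.IH(2)) (use Mul.prems in auto)
    ultimately have "runs (Seq (Pop (tr k)) (addto d (Suc k) b)) (\<sigma> i)
       (st out x e ((t(k := j, d := i * ev b e + t d))(d := ev b e + (t(k := j, d := i * ev b e + t d)) d))) (1 + te b M + 1)"
      by (rule runs_Seq)
    then show ?thesis by (rule runs_eq) (use j in \<open>auto simp: \<sigma>_def intro!: st_cong\<close>)
  qed
  then have 2: "runs (While (tr k) (Seq (Pop (tr k)) (addto d (Suc k) b))) (\<sigma> 0) (\<sigma> (ev a e)) (ev a e * (te b M + 2 + 1) + 1)"
    by (rule runs_While[rotated 2]) (use Mul.prems in \<open>auto simp: \<sigma>_def\<close>)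
  have s0: "\<sigma> 0 = st out x e (t(k := ev a e + t k))"
    using Mul.prems by (auto simp: \<sigma>_def intro!: st_cong)
  have sn: "\<sigma> (ev a e) = st out x e (t(d := ev (Mul a b) e + t d))"
    using Mul.prems by (auto simp: \<sigma>_def intro!: st_cong)
  have "ev a e * (te b M + 3) \<le> ev a (\<lambda>_. M) * (te b M + 3)"
    by (rule mult_right_mono[OF ev_mono[OF assms]]) simp
  then have "te a M + (ev a e * (te b M + 2 + 1) + 1) + 1 \<le> te (Mul a b) M"
    unfolding te.simps distrib_left by linarith
  then show ?case unfolding addto.simps
    by (intro runs_eq[OF runs_Seq[OF 1 2[unfolded s0]]]) (simp_all only: sn addto.simps)
qed

lemma pb_ev: "pb (\<lambda>M. ev a (\<lambda>_. M))"
  by (induction a) (auto intro: pb_const pb_id pb_add pb_mult)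

lemma pb_te: "pb (te a)"
proof (induction a)
  case (EC c)
  then show ?case by (simp add: pb_const)
next
  case (EV v)
  have "pb (\<lambda>M. 10 * M + 3)" by (intro pb_add pb_mult pb_const pb_id)
  then show ?case by simp
next
  case (Add a b)
  then have "pb (\<lambda>M. te a M + te b M + 1)" by (intro pb_add pb_const)
  then show ?case by simp
next
  case (Mul a b)
  then have "pb (\<lambda>M. te a M + (ev a (\<lambda>_. M) * (te b M + 3) + 2))"
    by (intro pb_add pb_mult pb_const pb_ev)
  then show ?case by simp
qed

fun emit :: "bits \<Rightarrow> com" where
  "emit [] = Skip"
| "emit (b # l) = Seq (Push 0 b) (emit l)"

lemma runs_emit: "runs (emit l) (st out x e t) (st (rev l @ out) x e t) (2 * length l + 1)"
proof (induction l arbitrary: out)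
  case Nil
  then show ?case using runs_Skip by simp
next
  case (Cons b l)
  show ?case unfolding emit.simps by (rule runs_eq[OF runs_Seq[OF runs_Push_out Cons]]) auto
qed

text \<open>Units are taken off in pairs: each pair adds one unit to temporary k + 1, and an
  unpaired unit goes to k + 2, which thus receives the parity.\<close>

definition halve :: "nat \<Rightarrow> com" where
  "halve k = While (tr k) (Seq (Pop (tr k))
     (Ifc (tr k) (Seq (Pop (tr k)) (Push (tr (k + 1)) True)) (Push (tr (k + 2)) True)))"

lemma runs_halve:
  "runs (halve k) (st out x e (t(k := n, k + 1 := m, k + 2 := 0)))
     (st out x e (t(k := 0, k + 1 := m + n div 2, k + 2 := n mod 2))) (7 * n + 1)"
  unfolding halve_def
proof (induction n arbitrary: m rule: less_induct)
  case (less n)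
  consider "n = 0" | "n = 1" | n' where "n = Suc (Suc n')"
    by (cases n; cases "n - 1") auto
  then show ?case
  proof cases
    case 1
    then show ?thesis by (intro runs_eq[OF runs_While_False]) (auto intro!: st_cong)
  next
    case 2
    show ?thesis
      by (rule runs_eq[OF runs_While_True[OF _ runs_Seq[OF runs_Pop_tr runs_If_False[OF _ runs_Push_tr]] runs_While_False]])
        (auto simp: 2 intro!: st_cong)
  next
    case (3 n')
    have e: "t(k := n, k + 1 := m, k + 2 := 0, k := n - 1, k := n - 1 - 1, k + 1 := Suc m) = t(k := n', k + 1 := Suc m, k + 2 := 0)"
      using 3 by (auto simp: fun_eq_iff)
    have IH: "runs (While (tr k) (Seq (Pop (tr k))
     (Ifc (tr k) (Seq (Pop (tr k)) (Push (tr (k + 1)) True)) (Push (tr (k + 2)) True))))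
      (st out x e (t(k := n, k + 1 := m, k + 2 := 0, k := n - 1, k := n - 1 - 1, k + 1 := Suc m)))
      (st out x e (t(k := 0, k + 1 := Suc m + n' div 2, k + 2 := n' mod 2))) (7 * n' + 1)"
      unfolding e by (rule less.IH) (simp add: 3)
    have p: "runs (Seq (Pop (tr k)) (Ifc (tr k) (Seq (Pop (tr k)) (Push (tr (k + 1)) True)) (Push (tr (k + 2)) True)))
      (st out x e (t(k := n, k + 1 := m, k + 2 := 0)))
      (st out x e (t(k := n, k + 1 := m, k + 2 := 0, k := n - 1, k := n - 1 - 1, k + 1 := Suc m))) 6"
      by (rule runs_eq[OF runs_Seq[OF runs_Pop_tr runs_If_True[OF _ _ runs_Seq[OF runs_Pop_tr runs_Push_tr]]]])
        (auto simp: 3 intro!: st_cong)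
    show ?thesis
      by (rule runs_eq[OF runs_While_True[OF _ p IH]]) (auto simp: 3 intro!: st_cong)
  qed
qed

definition moveback :: "nat \<Rightarrow> com" where
  "moveback k = While (tr (k + 1)) (Seq (Pop (tr (k + 1))) (Push (tr k) True))"

lemma runs_moveback:
  "runs (moveback k) (st out x e (t(k := m, k + 1 := n))) (st out x e (t(k := m + n, k + 1 := 0))) (4 * n + 1)"
  unfolding moveback_def
proof (induction n arbitrary: m)
  case 0
  then show ?case by (intro runs_eq[OF runs_While_False]) (auto intro!: st_cong)
next
  case (Suc n)
  have p: "runs (Seq (Pop (tr (k + 1))) (Push (tr k) True)) (st out x e (t(k := m, k + 1 := Suc n)))
      (st out x e (t(k := Suc m, k + 1 := n))) 3"
    by (rule runs_eq[OF runs_Seq[OF runs_Pop_tr runs_Push_tr]]) (auto intro!: st_cong)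
  show ?case by (rule runs_eq[OF runs_While_True[OF _ p Suc]]) (auto intro!: st_cong)
qed

text \<open>Repeated halving yields the bits from the least significant one on, as in
  \<open>nat_bits\<close>; the \<open>True\<close> before each digit and the final
  \<open>False\<close> come from \<open>sd\<close>.\<close>

definition emitnat :: "nat \<Rightarrow> com" where
  "emitnat k = Seq (While (tr k) (Seq (Push 0 True) (Seq (halve k)
      (Seq (Ifc (tr (k + 2)) (Seq (Push 0 True) (Pop (tr (k + 2)))) (Push 0 False)) (moveback k)))))
    (Push 0 False)"

lemma runs_emitnat_loop:
  assumes "t (k + 1) = 0" "t (k + 2) = 0"
  shows "runs (While (tr k) (Seq (Push 0 True) (Seq (halve k)
      (Seq (Ifc (tr (k + 2)) (Seq (Push 0 True) (Pop (tr (k + 2)))) (Push 0 False)) (moveback k)))))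
    (st out x e (t(k := n))) (st (rev (concat (map (\<lambda>b. [True, b]) (nat_bits n))) @ out) x e (t(k := 0)))
    (n * (11 * n + 20) + 1)"
proof (induction n arbitrary: out rule: less_induct)
  case (less n)
  show ?case
  proof (cases "n = 0")
    case True
    then show ?thesis by (intro runs_eq[OF runs_While_False]) (auto intro!: st_cong)
  next
    case False
    let ?b = "n mod 2 = 1"
    have 1: "runs (Push 0 True) (st out x e (t(k := n))) (st (True # out) x e (t(k := n))) 1"
      by (rule runs_eq[OF runs_Push]) auto
    have 2: "runs (halve k) (st (True # out) x e (t(k := n)))
       (st (True # out) x e (t(k := 0, k + 1 := n div 2, k + 2 := n mod 2))) (7 * n + 1)"
    proof -
      have "t(k := n) = t(k := n, k + 1 := 0, k + 2 := 0)" using assms by (auto simp: fun_eq_iff)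
      then show ?thesis using runs_halve[of k "True # out" x e t n 0] by simp
    qed
    have 3: "runs (Ifc (tr (k + 2)) (Seq (Push 0 True) (Pop (tr (k + 2)))) (Push 0 False))
       (st (True # out) x e (t(k := 0, k + 1 := n div 2, k + 2 := n mod 2)))
       (st (?b # True # out) x e (t(k := 0, k + 1 := n div 2))) 4"
    proof (cases ?b)
      case True
      show ?thesis
        by (rule runs_eq[OF runs_If_True[OF _ _ runs_Seq[OF runs_Push_out runs_Pop_tr]]])
          (use True assms in \<open>auto intro!: st_cong\<close>)
    next
      case False
      then show ?thesis
        by (intro runs_eq[OF runs_If_False[OF _ runs_Push_out]]) (use assms in \<open>auto intro!: st_cong\<close>)
    qed
    have 4: "runs (moveback k) (st (?b # True # out) x e (t(k := 0, k + 1 := n div 2)))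
       (st (?b # True # out) x e (t(k := n div 2))) (4 * (n div 2) + 1)"
    proof -
      have "t(k := n div 2, k + 1 := 0) = t(k := n div 2)" using assms by (auto simp: fun_eq_iff)
      then show ?thesis using runs_moveback[of k "?b # True # out" x e t 0 "n div 2"] by simp
    qed
    have lt: "n div 2 < n" using False by simp
    note 5 = runs_While_True[OF _ runs_Seq[OF 1 runs_Seq[OF 2 runs_Seq[OF 3 4]]] less.IH[OF lt]]
    show ?thesis
    proof (rule runs_eq[OF 5])
      show "st out x e (t(k := n)) (tr k) \<noteq> []" using False by simp
      show "st (rev (concat (map (\<lambda>b. [True, b]) (nat_bits (n div 2)))) @ ?b # True # out) x e (t(k := 0)) =
        st (rev (concat (map (\<lambda>b. [True, b]) (nat_bits n))) @ out) x e (t(k := 0))"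
        using False by (subst (2) nat_bits.simps) (simp del: nat_bits.simps)
      \<comment> \<open>A crude estimate suffices: n div 2 is at most n - 1, and one round costs at
        most 11 * n + 20.\<close>
      have "n div 2 * (11 * (n div 2) + 20) \<le> (n - 1) * (11 * n + 20)"
        using lt by (intro mult_mono) auto
      also have "\<dots> + (11 * n + 20) = n * (11 * n + 20)" using False by (cases n) auto
      finally show "1 + (7 * n + 1 + (4 + (4 * (n div 2) + 1) + 1) + 1) + 1 +
          (n div 2 * (11 * (n div 2) + 20) + 1) + 1 \<le> n * (11 * n + 20) + 1"
        by simp
    qed
  qed
qed

lemma runs_emitnat:
  assumes "t (k + 1) = 0" "t (k + 2) = 0"
  shows "runs (emitnat k) (st out x e (t(k := n))) (st (rev (enc_nat n) @ out) x e (t(k := 0))) (n * (11 * n + 20) + 3)"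
  unfolding emitnat_def
  by (rule runs_eq[OF runs_Seq[OF runs_emitnat_loop[OF assms] runs_Push_out]])
    (auto simp: enc_nat_def sd_def simp del: nat_bits.simps)

definition copytop :: "nat \<Rightarrow> nat \<Rightarrow> com" where
  "copytop r q = Ifc r (Push q True) (Push q False)"

lemma runs_copytop: "s r \<noteq> [] \<Longrightarrow> runs (copytop r q) s (s(q := hd (s r) # s q)) 2"
  unfolding copytop_def
  by (cases "hd (s r)") (auto intro: runs_eq[OF runs_If_True[OF _ _ runs_Push]] runs_eq[OF runs_If_False[OF _ runs_Push]])

text \<open>A stack has no indexed access: the bits before the wanted one are moved aside into
  register 2, the bit now on top is printed, and the moved bits are put back.\<close>

definition emitbit :: "nat \<Rightarrow> com" where
  "emitbit k = Seq (While (tr k) (Seq (Pop (tr k)) (Seq (copytop 1 2) (Pop 1))))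
     (Seq (copytop 1 0) (While 2 (Seq (copytop 2 1) (Pop 2))))"

lemma runs_emitbit:
  assumes "n < length x"
  shows "runs (emitbit k) (st out x e (t(k := n))) (st (x ! n # out) x e (t(k := 0))) (12 * n + 6)"
proof -
  define \<sigma> where "\<sigma> i = (st out x e (t(k := n - i)))(1 := drop i x, 2 := rev (take i x))" for i
  define \<tau> where "\<tau> i = (st (x ! n # out) x e (t(k := 0)))(1 := drop (n - i) x, 2 := rev (take (n - i) x))" for i
  have "runs (Seq (Pop (tr k)) (Seq (copytop 1 2) (Pop 1))) (\<sigma> i) (\<sigma> (Suc i)) 6" if i: "i < n" for i
  proof -
    obtain j where j: "n - i = Suc j" "n - Suc i = j" using i by (cases "n - i") auto
    have 1: "runs (Pop (tr k)) (\<sigma> i) ((st out x e (t(k := n - Suc i)))(1 := drop i x, 2 := rev (take i x))) 1"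
      by (rule runs_eq[OF runs_Pop])
       (use j st_upd_tr[of out "drop i x" e "t(k := Suc j)" k j] in \<open>auto simp: \<sigma>_def fun_upd_twist[of 2 "tr k"]\<close>)
    have ne: "drop i x \<noteq> []" using i assms by simp
    show ?thesis
      by (rule runs_eq[OF runs_Seq[OF 1 runs_Seq[OF runs_copytop runs_Pop]]])
        (use ne i assms in \<open>auto simp: \<sigma>_def hd_drop_conv_nth take_Suc_conv_app_nth fun_upd_twist tl_drop drop_Suc fun_eq_iff\<close>)
  qed
  then have 1: "runs (While (tr k) (Seq (Pop (tr k)) (Seq (copytop 1 2) (Pop 1)))) (\<sigma> 0) (\<sigma> n) (n * (6 + 1) + 1)"
    by (rule runs_While[rotated 2]) (auto simp: \<sigma>_def)
  have 2: "runs (copytop 1 0) (\<sigma> n) (\<tau> 0) 2"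
    by (rule runs_eq[OF runs_copytop]) (use assms in \<open>auto simp: \<sigma>_def \<tau>_def hd_drop_conv_nth fun_upd_twist\<close>)
  have "runs (Seq (copytop 2 1) (Pop 2)) (\<tau> i) (\<tau> (Suc i)) 4" if i: "i < n" for i
  proof -
    obtain j where j: "n - i = Suc j" "n - Suc i = j" using i by (cases "n - i") auto
    have r: "rev (take (Suc j) x) = x ! j # rev (take j x)"
      using assms j by (simp add: take_Suc_conv_app_nth)
    show ?thesis
      by (rule runs_eq[OF runs_Seq[OF runs_copytop runs_Pop]])
        (use r j assms in \<open>auto simp: \<tau>_def fun_upd_twist Cons_nth_drop_Suc fun_eq_iff\<close>)
  qed
  then have 3: "runs (While 2 (Seq (copytop 2 1) (Pop 2))) (\<tau> 0) (\<tau> n) (n * (4 + 1) + 1)"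
    by (rule runs_While[rotated 2]) (use assms in \<open>auto simp: \<tau>_def\<close>)
  have "\<sigma> 0 = st out x e (t(k := n))" "\<tau> n = st (x ! n # out) x e (t(k := 0))"
    by (auto simp: \<sigma>_def \<tau>_def fun_eq_iff)
  then show ?thesis unfolding emitbit_def
    using runs_eq[OF runs_Seq[OF 1 runs_Seq[OF 2 3]], of "\<tau> n"] by simp
qed

text \<open>Temporaries from k on are free. A loop uses temporary k as a countdown and the register
  of its variable as the counter that the body sees.\<close>

fun cg :: "nat \<Rightarrow> gen \<Rightarrow> com" where
  "cg k (GLit l) = emit l"
| "cg k (GNat a) = Seq (addto k (Suc k) a) (emitnat k)"
| "cg k (GBit a) = Seq (addto k (Suc k) a) (emitbit k)"
| "cg k (GSeq f g) = Seq (cg k f) (cg k g)"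
| "cg k (GFor v a g) = Seq (addto k (Suc k) a)
     (Seq (While (tr k) (Seq (Pop (tr k)) (Seq (cg (Suc k) g) (Push (vr v) True))))
       (While (vr v) (Pop (vr v))))"

text \<open>Inside a loop the bound on the variables grows by the number of rounds, since the loop
  variable may exceed the old bound.\<close>

fun tg :: "gen \<Rightarrow> nat \<Rightarrow> nat" where
  "tg (GLit l) M = 2 * length l + 1"
| "tg (GNat a) M = te a M + (ev a (\<lambda>_. M) * (11 * ev a (\<lambda>_. M) + 20) + 3) + 1"
| "tg (GBit a) M = te a M + (12 * ev a (\<lambda>_. M) + 6) + 1"
| "tg (GSeq f g) M = tg f M + tg g M + 1"
| "tg (GFor v a g) M = te a M + ev a (\<lambda>_. M) * (tg g (M + ev a (\<lambda>_. M)) + 7) + 4"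

lemma pb_tg: "pb (tg g)"
proof (induction g)
  case (GLit l)
  then show ?case by (simp add: pb_const)
next
  case (GNat a)
  have "pb (\<lambda>M. te a M + (ev a (\<lambda>_. M) * (11 * ev a (\<lambda>_. M) + 20) + 3) + 1)"
    by (intro pb_add pb_mult pb_const pb_ev pb_te)
  then show ?case by simp
next
  case (GBit a)
  have "pb (\<lambda>M. te a M + (12 * ev a (\<lambda>_. M) + 6) + 1)"
    by (intro pb_add pb_mult pb_const pb_ev pb_te)
  then show ?case by simp
next
  case (GSeq f g)
  then have "pb (\<lambda>M. tg f M + tg g M + 1)" by (intro pb_add pb_const)
  then show ?case by simp
next
  case (GFor v a g)
  have "pb (\<lambda>M. tg g (M + ev a (\<lambda>_. M)))"
    by (rule pb_comp[OF GFor]) (intro pb_add pb_id pb_ev)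
  then have "pb (\<lambda>M. te a M + ev a (\<lambda>_. M) * (tg g (M + ev a (\<lambda>_. M)) + 7) + 4)"
    by (intro pb_add pb_mult pb_const pb_ev pb_te)
  then show ?case by simp
qed

lemma runs_clear: "runs (While r (Pop r)) s (s(r := [])) (2 * length (s r) + 1)"
proof -
  define \<sigma> where "\<sigma> i = s(r := drop i (s r))" for i
  have "runs (Pop r) (\<sigma> i) (\<sigma> (Suc i)) 1" for i
    by (rule runs_eq[OF runs_Pop]) (auto simp: \<sigma>_def tl_drop drop_Suc)
  then have "runs (While r (Pop r)) (\<sigma> 0) (\<sigma> (length (s r))) (length (s r) * (1 + 1) + 1)"
    by (rule runs_While[rotated 2]) (auto simp: \<sigma>_def)
  then show ?thesis by (simp add: \<sigma>_def mult_2)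
qed

lemma runs_cg:
  "gok g x e \<Longrightarrow> (\<And>j. j \<ge> k \<Longrightarrow> t j = 0) \<Longrightarrow> (\<And>v. e v \<le> M) \<Longrightarrow>
    runs (cg k g) (st out x e t) (st (rev (den g x e) @ out) x e t) (tg g M)"
proof (induction g arbitrary: e t k M out)
  case (GLit l)
  then show ?case using runs_emit by simp
next
  case (GNat a)
  have 1: "runs (addto k (Suc k) a) (st out x e t) (st out x e (t(k := ev a e + t k))) (te a M)"
    by (rule runs_addto) (use GNat.prems in auto)
  have 2: "runs (emitnat k) (st out x e (t(k := ev a e + t k)))
     (st (rev (enc_nat (ev a e)) @ out) x e (t(k := 0))) (ev a e * (11 * ev a e + 20) + 3)"
    using runs_emitnat[of t k out x e "ev a e"] GNat.prems by simp
  have "ev a e \<le> ev a (\<lambda>_. M)" by (rule ev_mono) (use GNat.prems in auto)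
  then have "ev a e * (11 * ev a e + 20) \<le> ev a (\<lambda>_. M) * (11 * ev a (\<lambda>_. M) + 20)"
    by (intro mult_mono) auto
  then show ?case unfolding cg.simps
    by (intro runs_eq[OF runs_Seq[OF 1 2]]) (use GNat.prems in \<open>auto intro!: st_cong\<close>)
next
  case (GBit a)
  have 1: "runs (addto k (Suc k) a) (st out x e t) (st out x e (t(k := ev a e + t k))) (te a M)"
    by (rule runs_addto) (use GBit.prems in auto)
  have 2: "runs (emitbit k) (st out x e (t(k := ev a e + t k)))
     (st (x ! ev a e # out) x e (t(k := 0))) (12 * ev a e + 6)"
    using runs_emitbit[of "ev a e" x k out e t] GBit.prems by simp
  have "ev a e \<le> ev a (\<lambda>_. M)" by (rule ev_mono) (use GBit.prems in auto)
  then show ?case unfolding cg.simps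
    by (intro runs_eq[OF runs_Seq[OF 1 2]]) (use GBit.prems in \<open>auto intro!: st_cong\<close>)
next
  case (GSeq f g)
  have 1: "runs (cg k f) (st out x e t) (st (rev (den f x e) @ out) x e t) (tg f M)"
    by (rule GSeq.IH(1)) (use GSeq.prems in auto)
  have 2: "runs (cg k g) (st (rev (den f x e) @ out) x e t)
     (st (rev (den g x e) @ rev (den f x e) @ out) x e t) (tg g M)"
    by (rule GSeq.IH(2)) (use GSeq.prems in auto)
  show ?case unfolding cg.simps by (rule runs_eq[OF runs_Seq[OF 1 2]]) auto
next
  case (GFor v a g)
  let ?n = "ev a e"
  have tk: "t k = 0" and ev0: "e v = 0" using GFor.prems by auto
  have nM: "?n \<le> ev a (\<lambda>_. M)" by (rule ev_mono) (use GFor.prems in auto)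
  have 1: "runs (addto k (Suc k) a) (st out x e t) (st out x e (t(k := ev a e + t k))) (te a M)"
    by (rule runs_addto) (use GFor.prems in auto)
  let ?T = "tg g (M + ev a (\<lambda>_. M))"
  define \<sigma> where "\<sigma> i = st (rev (concat (map (\<lambda>i. den g x (e(v := i))) [0..<i])) @ out) x (e(v := i)) (t(k := ?n - i))" for i
  have "runs (Seq (Pop (tr k)) (Seq (cg (Suc k) g) (Push (vr v) True))) (\<sigma> i) (\<sigma> (Suc i)) (?T + 4)" if i: "i < ?n" for i
  proof -
    define O1 where "O1 = rev (concat (map (\<lambda>i. den g x (e(v := i))) [0..<i])) @ out"
    obtain j where j: "?n - i = Suc j" "?n - Suc i = j" using i by (cases "?n - i") auto
    have a: "runs (Pop (tr k)) (\<sigma> i) (st O1 x (e(v := i)) (t(k := ?n - Suc i))) 1"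
      unfolding \<sigma>_def O1_def by (rule runs_eq[OF runs_Pop_tr]) (use j in \<open>auto intro!: st_cong\<close>)
    have b: "runs (cg (Suc k) g) (st O1 x (e(v := i)) (t(k := ?n - Suc i)))
      (st (rev (den g x (e(v := i))) @ O1) x (e(v := i)) (t(k := ?n - Suc i))) ?T"
    proof (rule GFor.IH)
      show "(e(v := i)) w \<le> M + ev a (\<lambda>_. M)" for w
        using i nM GFor.prems(3)[of w] by auto
      show "gok g x (e(v := i))" using GFor.prems(1) i by simp
    qed (use GFor.prems i in auto)
    have c: "runs (Push (vr v) True) (st (rev (den g x (e(v := i))) @ O1) x (e(v := i)) (t(k := ?n - Suc i))) (\<sigma> (Suc i)) 1"
      unfolding \<sigma>_def O1_def by (rule runs_eq[OF runs_Push_vr]) (auto intro!: st_cong)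
    show ?thesis by (rule runs_eq[OF runs_Seq[OF a runs_Seq[OF b c]]]) auto
  qed
  then have 2: "runs (While (tr k) (Seq (Pop (tr k)) (Seq (cg (Suc k) g) (Push (vr v) True)))) (\<sigma> 0) (\<sigma> ?n) (?n * (?T + 4 + 1) + 1)"
    by (rule runs_While[rotated 2]) (auto simp: \<sigma>_def)
  have s0: "\<sigma> 0 = st out x e (t(k := ev a e + t k))"
    using tk ev0 by (simp add: \<sigma>_def fun_upd_idem)
  have 3: "runs (While (vr v) (Pop (vr v))) (\<sigma> ?n) (st (rev (den (GFor v a g) x e) @ out) x e t) (2 * ?n + 1)"
    by (rule runs_eq[OF runs_clear])
      (use tk ev0 st_upd_vr[of "rev (den (GFor v a g) x e) @ out" x "e(v := ?n)" t v 0] in \<open>auto simp: \<sigma>_def fun_upd_idem\<close>)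
  have "?n * (?T + 7) \<le> ev a (\<lambda>_. M) * (?T + 7)" using nM by (rule mult_right_mono) simp
  then show ?case unfolding cg.simps
    by (intro runs_eq[OF runs_Seq[OF 1[folded s0] runs_Seq[OF 2 3]]]) (auto simp: algebra_simps)
qed

definition env0 :: "nat \<Rightarrow> nat \<Rightarrow> nat" where
  "env0 N = (\<lambda>v. if v = 0 then N else 0)"

text \<open>Register 0 holds the input reversed, so moving it bit by bit to register 1 restores the
  natural order; its length is counted in variable 0 on the way.\<close>

definition reader :: com where
  "reader = While 0 (Seq (copytop 0 1) (Seq (Pop 0) (Push (vr 0) True)))"

lemma runs_reader: "runs reader (store0 x) (st [] x (env0 (length x)) (\<lambda>_. 0)) (7 * length x + 1)"
proof -
  let ?n = "length x"
  define \<sigma> where "\<sigma> i = st (rev (take (?n - i) x)) (drop (?n - i) x) (env0 i) (\<lambda>_. 0)" for i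
  have "runs (Seq (copytop 0 1) (Seq (Pop 0) (Push (vr 0) True))) (\<sigma> i) (\<sigma> (Suc i)) 6" if i: "i < ?n" for i
  proof -
    obtain j where j: "?n - i = Suc j" "?n - Suc i = j" using i by (cases "?n - i") auto
    have jl: "j < ?n" using j i by linarith
    have r: "rev (take (Suc j) x) = x ! j # rev (take j x)"
      using jl by (simp add: take_Suc_conv_app_nth)
    have a: "runs (copytop 0 1) (\<sigma> i) (st (rev (take (Suc j) x)) (drop j x) (env0 i) (\<lambda>_. 0)) 2"
      by (rule runs_eq[OF runs_copytop]) (use r j jl in \<open>auto simp: \<sigma>_def Cons_nth_drop_Suc\<close>)
    have b: "runs (Pop 0) (st (rev (take (Suc j) x)) (drop j x) (env0 i) (\<lambda>_. 0))
      (st (rev (take j x)) (drop j x) (env0 i) (\<lambda>_. 0)) 1"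
      by (rule runs_eq[OF runs_Pop]) (use r in auto)
    have c: "runs (Push (vr 0) True) (st (rev (take j x)) (drop j x) (env0 i) (\<lambda>_. 0)) (\<sigma> (Suc i)) 1"
      unfolding \<sigma>_def by (rule runs_eq[OF runs_Push_vr]) (use j in \<open>auto simp: env0_def intro!: st_cong\<close>)
    show ?thesis by (rule runs_eq[OF runs_Seq[OF a runs_Seq[OF b c]]]) auto
  qed
  then have "runs reader (\<sigma> 0) (\<sigma> ?n) (?n * (6 + 1) + 1)"
    unfolding reader_def by (rule runs_While[rotated 2]) (auto simp: \<sigma>_def)
  moreover have "\<sigma> 0 = store0 x" by (auto simp: \<sigma>_def store0_def st_def env0_def fun_eq_iff)
  ultimately show ?thesis by (simp add: \<sigma>_def mult.commute)
qed

theorem polytime_den: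
  assumes "\<And>x. gok g x (env0 (length x))"
  shows "polytime_fun (\<lambda>x. den g x (env0 (length x)))"
proof (rule polytime_runs)
  let ?c = "Seq reader (Seq (cg 0 g) (Seq (While 1 (Pop 1)) (While (vr 0) (Pop (vr 0)))))"
  show "pb (\<lambda>n. 11 * n + tg g n + 6)" by (intro pb_add pb_mult pb_const pb_id pb_tg)
  fix x
  let ?y = "den g x (env0 (length x))"
  have 1: "runs (cg 0 g) (st [] x (env0 (length x)) (\<lambda>_. 0)) (st (rev ?y @ []) x (env0 (length x)) (\<lambda>_. 0)) (tg g (length x))"
    by (rule runs_cg) (use assms in \<open>auto simp: env0_def\<close>)
  have 2: "runs (While 1 (Pop 1)) (st (rev ?y @ []) x (env0 (length x)) (\<lambda>_. 0))
     (st (rev ?y) [] (env0 (length x)) (\<lambda>_. 0)) (2 * length x + 1)"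
    by (rule runs_eq[OF runs_clear]) auto
  have e0: "(env0 (length x))(0 := 0) = (\<lambda>_. 0)" by (auto simp: env0_def)
  \<comment> \<open>The output has been pushed in printing order, so it lies reversed in register 0,
    just as \<open>store0\<close> asks.\<close>
  have "st (rev ?y) [] (\<lambda>_. 0) (\<lambda>_. 0) = store0 ?y"
    by (auto simp: st_def store0_def fun_eq_iff)
  then have 3: "runs (While (vr 0) (Pop (vr 0))) (st (rev ?y) [] (env0 (length x)) (\<lambda>_. 0)) (store0 ?y) (2 * length x + 1)"
    using runs_eq[OF runs_clear[of "vr 0" "st (rev ?y) [] (env0 (length x)) (\<lambda>_. 0)"], of "store0 ?y" "2 * length x + 1"]
     st_upd_vr[of "rev ?y" "[]" "env0 (length x)" "\<lambda>_. 0" 0 0] st_simps(5)[of "rev ?y" "[]" "env0 (length x)" "\<lambda>_. 0" 0] e0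
    by (simp add: env0_def)
  show "runs ?c (store0 x) (store0 ?y) (11 * length x + tg g (length x) + 6)"
    by (rule runs_eq[OF runs_Seq[OF runs_reader runs_Seq[OF 1 runs_Seq[OF 2 3]]]]) auto
qed

section \<open>Circuits\<close>

fun gate_ok :: "nat \<Rightarrow> gate \<Rightarrow> bool" where
  "gate_ok j (GNot a) = (a < j)"
| "gate_ok j (GAnd a b) = (a < j \<and> b < j)"
| "gate_ok j (GOr a b) = (a < j \<and> b < j)"
| "gate_ok j _ = True"

fun gv :: "(nat \<Rightarrow> bool) \<Rightarrow> (nat \<Rightarrow> bool) \<Rightarrow> gate \<Rightarrow> bool" where
  "gv inp V (GIn i) = inp i"
| "gv inp V (GConst b) = b"
| "gv inp V (GNot a) = (\<not> V a)"
| "gv inp V (GAnd a b) = (V a \<and> V b)"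
| "gv inp V (GOr a b) = (V a \<or> V b)"

text \<open>Well-formedness and satisfaction are both conditions on gates at absolute positions; as
  instances of one predicate they share the splitting lemmas.\<close>

definition pos :: "(nat \<Rightarrow> gate \<Rightarrow> bool) \<Rightarrow> nat \<Rightarrow> gate list \<Rightarrow> bool" where
  "pos P q gs \<longleftrightarrow> (\<forall>j<length gs. P (q + j) (gs ! j))"

abbreviation refs_ok :: "nat \<Rightarrow> gate list \<Rightarrow> bool" where
  "refs_ok \<equiv> pos gate_ok"

text \<open>An assignment to all positions that obeys every gate equation. Unlike evaluation from
  left to right this is a local condition, so each block can be analysed at its own place.\<close>

abbreviation sat :: "(nat \<Rightarrow> bool) \<Rightarrow> (nat \<Rightarrow> bool) \<Rightarrow> nat \<Rightarrow> gate list \<Rightarrow> bool" where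
  "sat inp V \<equiv> pos (\<lambda>j g. V j = gv inp V g)"

lemma pos_Nil [simp]: "pos P q []"
  by (simp add: pos_def)

lemma pos_Cons [simp]: "pos P q (g # gs) \<longleftrightarrow> P q g \<and> pos P (Suc q) gs"
  unfolding pos_def by (auto simp: less_Suc_eq_0_disj)

lemma pos_append [simp]: "pos P q (a @ b) \<longleftrightarrow> pos P q a \<and> pos P (q + length a) b"
  by (induction a arbitrary: q) auto

lemma length_concat_const:
  "(\<And>p. p < n \<Longrightarrow> length (f p) = B) \<Longrightarrow> length (concat (map f [0..<n])) = n * B"
  by (induction n) auto

lemma pos_concat:
  assumes "\<And>p. p < n \<Longrightarrow> length (f p) = B"
  shows "pos P q (concat (map f [0..<n])) \<longleftrightarrow> (\<forall>p<n. pos P (q + p * B) (f p))"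
  using assms
proof (induction n)
  case (Suc n)
  then have "length (concat (map f [0..<n])) = n * B" by (intro length_concat_const) auto
  with Suc show ?case by (auto simp: less_Suc_eq)
qed auto

lemma gates_eval_snoc: "gates_eval inp (gs @ [g]) = gates_eval inp gs @ [gate_val inp (gates_eval inp gs) g]"
  unfolding gates_eval_def by simp

lemma length_gates_eval [simp]: "length (gates_eval inp gs) = length gs"
  by (induction gs rule: rev_induct) (auto simp: gates_eval_snoc gates_eval_def)

lemma gate_val_gv:
  "gate_ok j g \<Longrightarrow> (\<And>i. i < j \<Longrightarrow> lookup vs i = V i) \<Longrightarrow> gate_val inp vs g = gv inp V g"
  by (cases g) auto

text \<open>References go backwards only, so appending a gate changes no earlier value, and the
  evaluated list obeys all equations at once.\<close>

lemma sat_gates_eval: "refs_ok 0 gs \<Longrightarrow> sat inp (lookup (gates_eval inp gs)) 0 gs"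
proof (induction gs rule: rev_induct)
  case (snoc g gs)
  let ?vs = "gates_eval inp gs" and ?vs' = "gates_eval inp (gs @ [g])"
  have l: "lookup ?vs' i = lookup ?vs i" if "i < length gs" for i
    using that by (auto simp: lookup_def gates_eval_snoc nth_append)
  have wfs: "refs_ok 0 gs" "gate_ok (length gs) g" using snoc.prems by auto
  have "lookup ?vs' j = gv inp (lookup ?vs') (gs ! j)" if j: "j < length gs" for j
  proof -
    have ok: "gate_ok j (gs ! j)" using wfs(1) j unfolding pos_def by simp
    have "lookup ?vs j = gv inp (lookup ?vs) (gs ! j)" using snoc.IH[OF wfs(1)] j unfolding pos_def by simp
    also have "\<dots> = gv inp (lookup ?vs') (gs ! j)" using ok l j by (cases "gs ! j") auto
    finally show ?thesis unfolding l[OF j] .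
  qed
  moreover have "lookup ?vs' (length gs) = gate_val inp ?vs g"
    by (simp add: lookup_def gates_eval_snoc nth_append)
  moreover have "gate_val inp ?vs g = gv inp (lookup ?vs') g"
    by (rule gate_val_gv[OF wfs(2)]) (simp add: l)
  ultimately have "sat inp (lookup ?vs') 0 gs" "lookup ?vs' (length gs) = gv inp (lookup ?vs') g"
    unfolding pos_def add_0 by metis+
  then show ?case unfolding pos_append pos_Cons add_0 by (intro conjI pos_Nil)
qed simp

lemma circ_eval_sat:
  assumes "refs_ok 0 gs" "gs \<noteq> []" "length y = n" "length z = n"
  obtains V where "sat (\<lambda>i. i < 2 * n \<and> (y @ z) ! i) V 0 gs" "circ_eval (Circuit n gs) y z = V (length gs - 1)"
proof
  let ?inp = "\<lambda>i. if i < n then lookup y i else if i < 2 * n then lookup z (i - n) else False"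
  let ?V = "lookup (gates_eval ?inp gs)"
  have i: "?inp = (\<lambda>i. i < 2 * n \<and> (y @ z) ! i)"
  proof
    fix i
    consider "i < n" | "\<not> i < n" "i < 2 * n" | "\<not> i < n" "\<not> i < 2 * n" by blast
    then show "(if i < n then lookup y i else if i < 2 * n then lookup z (i - n) else False) = (i < 2 * n \<and> (y @ z) ! i)"
    proof cases
      case 1
      then show ?thesis by (simp add: lookup_def nth_append assms(3))
    next
      case 2
      then have "i - n < n" by linarith
      with 2 show ?thesis by (simp add: lookup_def nth_append assms(3,4))
    qed simp
  qed
  show "sat (\<lambda>i. i < 2 * n \<and> (y @ z) ! i) ?V 0 gs"
    using sat_gates_eval[OF assms(1), of ?inp] unfolding i .
  have last: "(vs \<noteq> [] \<and> last vs) = lookup vs (length gs - 1)" if "length vs = length gs" for vs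
    using that assms(2) by (cases "vs = []") (auto simp: last_conv_nth lookup_def)
  show "circ_eval (Circuit n gs) y z = ?V (length gs - 1)"
    unfolding circ_eval.simps Let_def by (rule last[OF length_gates_eval])
qed

section \<open>Boolean functions as gate lists\<close>

datatype bx = BC bool | BV nat | BN bx | BA bx bx | BO bx bx

fun bev :: "(nat \<Rightarrow> bool) \<Rightarrow> bx \<Rightarrow> bool" where
  "bev V (BC b) = b"
| "bev V (BV i) = V i"
| "bev V (BN a) = (\<not> bev V a)"
| "bev V (BA a b) = (bev V a \<and> bev V b)"
| "bev V (BO a b) = (bev V a \<or> bev V b)"

fun bvars :: "bx \<Rightarrow> nat set" where
  "bvars (BC b) = {}"
| "bvars (BV i) = {i}"
| "bvars (BN a) = bvars a"
| "bvars (BA a b) = bvars a \<union> bvars b"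
| "bvars (BO a b) = bvars a \<union> bvars b"

text \<open>Gates for an expression, placed from position \<open>q\<close> on; the last gate carries the value.\<close>
fun bco :: "nat \<Rightarrow> bx \<Rightarrow> gate list" where
  "bco q (BC b) = [GConst b]"
| "bco q (BV i) = [GOr i i]"
| "bco q (BN a) = (let A = bco q a in A @ [GNot (q + length A - 1)])"
| "bco q (BA a b) = (let A = bco q a; B = bco (q + length A) b in
     A @ B @ [GAnd (q + length A - 1) (q + length A + length B - 1)])"
| "bco q (BO a b) = (let A = bco q a; B = bco (q + length A) b in
     A @ B @ [GOr (q + length A - 1) (q + length A + length B - 1)])"

lemma bco_pos: "length (bco q b) > 0"
  by (cases b) (auto simp: Let_def)

lemma bco_sat: "sat inp V q (bco q b) \<Longrightarrow> V (q + length (bco q b) - 1) = bev V b"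
proof (induction b arbitrary: q)
  case (BA a b)
  then show ?case using BA.IH(1)[of q] BA.IH(2)[of "q + length (bco q a)"] by (auto simp: Let_def add.assoc)
next
  case (BO a b)
  then show ?case using BO.IH(1)[of q] BO.IH(2)[of "q + length (bco q a)"] by (auto simp: Let_def add.assoc)
qed (auto simp: Let_def)

lemma bco_wf: "\<forall>i\<in>bvars b. i < q \<Longrightarrow> refs_ok q (bco q b)"
proof (induction b arbitrary: q)
  case (BN b)
  then show ?case using bco_pos[of q b] by (auto simp: Let_def simp del: length_greater_0_conv)
next
  case (BA a b)
  have "\<forall>i\<in>bvars b. i < q + length (bco q a)" using BA.prems by (auto intro: trans_less_add1)
  then show ?case using BA bco_pos[of q a] bco_pos[of "q + length (bco q a)" b] by (auto simp: Let_def simp del: length_greater_0_conv)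
next
  case (BO a b)
  have "\<forall>i\<in>bvars b. i < q + length (bco q a)" using BO.prems by (auto intro: trans_less_add1)
  then show ?case using BO bco_pos[of q a] bco_pos[of "q + length (bco q a)" b] by (auto simp: Let_def simp del: length_greater_0_conv)
qed auto

text \<open>Shannon expansion, last variable first. Its size is exponential in the number of
  variables, but that number depends only on the fixed machines and never on the input.\<close>

fun shannon :: "nat \<Rightarrow> (bool list \<Rightarrow> bool) \<Rightarrow> bx" where
  "shannon 0 f = BC (f [])"
| "shannon (Suc r) f = BO (BA (BV r) (shannon r (\<lambda>bs. f (bs @ [True]))))
     (BA (BN (BV r)) (shannon r (\<lambda>bs. f (bs @ [False]))))"

lemma bev_shannon: "bev V (shannon r f) = f (map V [0..<r])"
proof (induction r arbitrary: f)
  case (Suc r)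
  then show ?case by (cases "V r") auto
qed auto

lemma bvars_shannon: "i \<in> bvars (shannon r f) \<Longrightarrow> i < r"
  by (induction r arbitrary: f) (auto simp: less_Suc_eq)

fun bcos :: "nat \<Rightarrow> bx list \<Rightarrow> gate list" where
  "bcos q [] = []"
| "bcos q (b # bs) = bco q b @ bcos (q + length (bco q b)) bs"

fun bres :: "nat \<Rightarrow> bx list \<Rightarrow> nat list" where
  "bres q [] = []"
| "bres q (b # bs) = (q + length (bco q b) - 1) # bres (q + length (bco q b)) bs"

lemma length_bres [simp]: "length (bres q bs) = length bs"
  by (induction bs arbitrary: q) auto

lemma bcos_sat: "sat inp V q (bcos q bs) \<Longrightarrow> l < length bs \<Longrightarrow> V (bres q bs ! l) = bev V (bs ! l)"
proof (induction bs arbitrary: q l)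
  case (Cons b bs)
  then show ?case using bco_sat[of V inp q b] by (cases l) auto
qed auto

lemma bcos_wf: "\<forall>b\<in>set bs. \<forall>i\<in>bvars b. i < q \<Longrightarrow> refs_ok q (bcos q bs)"
proof (induction bs arbitrary: q)
  case (Cons b bs)
  have "\<forall>b'\<in>set bs. \<forall>i\<in>bvars b'. i < q + length (bco q b)" using Cons.prems by (auto intro: trans_less_add1)
  then show ?case using Cons bco_wf[of b q] by auto
qed auto

lemma bres_less: "l < length bs \<Longrightarrow> bres q bs ! l < q + length (bcos q bs)"
proof (induction bs arbitrary: q l)
  case (Cons b bs)
  have "bco q b \<noteq> []" using bco_pos[of q b] by auto
  then show ?case
  proof (cases l)
    case 0
    then show ?thesis using \<open>bco q b \<noteq> []\<close> by (cases "bco q b") auto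
  next
    case (Suc k)
    then show ?thesis using Cons.IH[of k "q + length (bco q b)"] Cons.prems by (simp add: add.assoc)
  qed
qed auto

text \<open>A circuit for \<open>F\<close> whose \<open>r\<close> inputs are the gates \<open>0, \<dots>, r - 1\<close>; the outputs are the last \<open>K\<close> gates.\<close>
definition core :: "nat \<Rightarrow> nat \<Rightarrow> (bool list \<Rightarrow> bool list) \<Rightarrow> gate list" where
  "core r K F = (let es = map (\<lambda>l. shannon r (\<lambda>bs. F bs ! l)) [0..<K] in
     bcos r es @ map (\<lambda>p. GOr p p) (bres r es))"

lemma length_core_ge: "K \<le> length (core r K F)"
  by (simp add: core_def Let_def)

lemma core_sat:
  assumes "sat inp V r (core r K F)" "l < K"
  shows "V (r + (length (core r K F) - K) + l) = F (map V [0..<r]) ! l"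
proof -
  define es where "es = map (\<lambda>l. shannon r (\<lambda>bs. F bs ! l)) [0..<K]"
  have K: "length es = K" by (simp add: es_def)
  have c: "core r K F = bcos r es @ map (\<lambda>p. GOr p p) (bres r es)" by (simp add: core_def es_def Let_def)
  have s: "sat inp V r (bcos r es)" "sat inp V (r + length (bcos r es)) (map (\<lambda>p. GOr p p) (bres r es))"
    using assms(1) unfolding c by simp_all
  have "V (r + length (bcos r es) + l) = V (bres r es ! l)"
    using s(2) assms(2) K unfolding pos_def by auto
  also have "\<dots> = bev V (es ! l)" using bcos_sat[OF s(1)] K assms(2) by simp
  also have "\<dots> = F (map V [0..<r]) ! l" using assms(2) by (simp add: es_def bev_shannon)
  finally show ?thesis by (simp add: c K)
qed

lemma core_wf: "refs_ok r (core r K F)"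
proof -
  define es where "es = map (\<lambda>l. shannon r (\<lambda>bs. F bs ! l)) [0..<K]"
  have c: "core r K F = bcos r es @ map (\<lambda>p. GOr p p) (bres r es)" by (simp add: core_def es_def Let_def)
  have "refs_ok r (bcos r es)" by (rule bcos_wf) (auto simp: es_def dest: bvars_shannon)
  moreover have "refs_ok (r + length (bcos r es)) (map (\<lambda>p. GOr p p) (bres r es))"
    using bres_less[of _ es r] by (auto simp: pos_def intro: trans_less_add1)
  ultimately show ?thesis unfolding c by simp
qed

text \<open>Only references to gates move; the inputs of the circuit are addressed
  absolutely.\<close>

fun shift :: "nat \<Rightarrow> gate \<Rightarrow> gate" where
  "shift q (GNot a) = GNot (q + a)"
| "shift q (GAnd a b) = GAnd (q + a) (q + b)"
| "shift q (GOr a b) = GOr (q + a) (q + b)"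
| "shift q g = g"

lemma gv_shift: "gv inp V (shift q g) = gv inp (\<lambda>j. V (q + j)) g"
  by (cases g) auto

lemma gate_ok_shift: "gate_ok (q + j) (shift q g) = gate_ok j g"
  by (cases g) auto

lemma sat_shift: "sat inp V (q + r) (map (shift q) gs) \<longleftrightarrow> sat inp (\<lambda>j. V (q + j)) r gs"
  by (auto simp: pos_def gv_shift add.assoc)

lemma wf_shift: "refs_ok (q + r) (map (shift q) gs) \<longleftrightarrow> refs_ok r gs"
  unfolding pos_def using gate_ok_shift[of q] by (auto simp: add.assoc)

text \<open>The r load gates \<open>ls\<close> fetch operands from anywhere, and the shifted core
  refers only to gates of the same block. Thus the loads alone vary in structure from block to
  block, and the size is constant.\<close>

definition blk :: "nat \<Rightarrow> gate list \<Rightarrow> nat \<Rightarrow> nat \<Rightarrow> (bool list \<Rightarrow> bool list) \<Rightarrow> gate list" where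
  "blk q ls r K F = ls @ map (shift q) (core r K F)"

definition bsize :: "nat \<Rightarrow> nat \<Rightarrow> (bool list \<Rightarrow> bool list) \<Rightarrow> nat" where
  "bsize r K F = r + length (core r K F)"

lemma bsize_ge: "K \<le> bsize r K F"
  using length_core_ge[of K r F] by (simp add: bsize_def)

lemma length_blk: "length ls = r \<Longrightarrow> length (blk q ls r K F) = bsize r K F"
  by (simp add: blk_def bsize_def)

lemma blk_wf: "length ls = r \<Longrightarrow> refs_ok q ls \<Longrightarrow> refs_ok q (blk q ls r K F)"
  by (simp add: blk_def wf_shift core_wf)

lemma blk_sat:
  assumes "sat inp V q (blk q ls r K F)" "length ls = r" "l < K"
  shows "V (q + (bsize r K F - K) + l) = F (map (gv inp V) ls) ! l"
proof -
  have s: "sat inp V q ls" "sat inp (\<lambda>j. V (q + j)) r (core r K F)"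
    using assms(1,2) by (auto simp: blk_def sat_shift)
  have "V (q + (r + (length (core r K F) - K) + l)) = F (map (\<lambda>j. V (q + j)) [0..<r]) ! l"
    by (rule core_sat[OF s(2) assms(3)])
  moreover have "map (\<lambda>j. V (q + j)) [0..<r] = map (gv inp V) ls"
    using s(1) assms(2) by (auto intro!: nth_equalityI simp: pos_def)
  moreover have "q + (bsize r K F - K) + l = q + (r + (length (core r K F) - K) + l)"
    using length_core_ge[of K r F] by (simp add: bsize_def)
  ultimately show ?thesis by metis
qed

section \<open>Gates with polynomial references, and their printing\<close>

datatype eg = EIn exp | EConst bool | EBit exp | ENot exp | EAnd exp exp | EOr exp exp

text \<open>\<open>EBit\<close> is the only place where the word x matters beyond its
  length.\<close>

fun geg :: "bits \<Rightarrow> (nat \<Rightarrow> nat) \<Rightarrow> eg \<Rightarrow> gate" where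
  "geg x e (EIn a) = GIn (ev a e)"
| "geg x e (EConst b) = GConst b"
| "geg x e (EBit a) = GConst (x ! ev a e)"
| "geg x e (ENot a) = GNot (ev a e)"
| "geg x e (EAnd a b) = GAnd (ev a e) (ev b e)"
| "geg x e (EOr a b) = GOr (ev a e) (ev b e)"

fun eg_ok :: "bits \<Rightarrow> (nat \<Rightarrow> nat) \<Rightarrow> eg \<Rightarrow> bool" where
  "eg_ok x e (EBit a) = (ev a e < length x)"
| "eg_ok x e _ = True"

fun eg_gen :: "eg \<Rightarrow> gen" where
  "eg_gen (EIn a) = GSeq (GLit (enc_nat 0)) (GNat a)"
| "eg_gen (EConst b) = GLit (enc_nat 1 @ [b])"
| "eg_gen (EBit a) = GSeq (GLit (enc_nat 1)) (GBit a)"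
| "eg_gen (ENot a) = GSeq (GLit (enc_nat 2)) (GNat a)"
| "eg_gen (EAnd a b) = GSeq (GLit (enc_nat 3)) (GSeq (GNat a) (GNat b))"
| "eg_gen (EOr a b) = GSeq (GLit (enc_nat 4)) (GSeq (GNat a) (GNat b))"

lemma den_eg_gen: "den (eg_gen a) x e = enc_gate (geg x e a)"
  by (cases a) auto

lemma gok_eg_gen: "gok (eg_gen a) x e = eg_ok x e a"
  by (cases a) auto

datatype cgen = CG "eg list" | CFor nat exp cgen | CSeq cgen cgen

fun gl :: "cgen \<Rightarrow> bits \<Rightarrow> (nat \<Rightarrow> nat) \<Rightarrow> gate list" where
  "gl (CG l) x e = map (geg x e) l"
| "gl (CFor v a c) x e = concat (map (\<lambda>i. gl c x (e(v := i))) [0..<ev a e])"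
| "gl (CSeq c d) x e = gl c x e @ gl d x e"

fun cok :: "cgen \<Rightarrow> bits \<Rightarrow> (nat \<Rightarrow> nat) \<Rightarrow> bool" where
  "cok (CG l) x e = list_all (eg_ok x e) l"
| "cok (CFor v a c) x e \<longleftrightarrow> e v = 0 \<and> (\<forall>i<ev a e. cok c x (e(v := i)))"
| "cok (CSeq c d) x e \<longleftrightarrow> cok c x e \<and> cok d x e"

fun cgen_gen :: "cgen \<Rightarrow> gen" where
  "cgen_gen (CG l) = foldr GSeq (map eg_gen l) (GLit [])"
| "cgen_gen (CFor v a c) = GFor v a (cgen_gen c)"
| "cgen_gen (CSeq c d) = GSeq (cgen_gen c) (cgen_gen d)"

lemma concat_map_concat: "concat (map f (concat xss)) = concat (map (\<lambda>xs. concat (map f xs)) xss)"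
  by (induction xss) auto

lemma den_cgen_gen: "den (cgen_gen c) x e = concat (map enc_gate (gl c x e))"
proof (induction c arbitrary: e)
  case (CG l)
  show ?case by (induction l) (auto simp: den_eg_gen)
next
  case (CFor v a c)
  then show ?case by (simp add: concat_map_concat o_def fun_upd_def)
qed auto

lemma gok_cgen_gen: "gok (cgen_gen c) x e = cok c x e"
proof (induction c arbitrary: e)
  case (CG l)
  show ?case by (induction l) (auto simp: gok_eg_gen)
qed auto

text \<open>The encoding announces the number of gates before the gates themselves, so this number
  has to be available as a polynomial \<open>len\<close>.\<close>

theorem polytime_circuit:
  assumes "\<And>x. cok c x (env0 (length x))"
    and "\<And>x. length (gl c x (env0 (length x))) = ev len (env0 (length x))"
  shows "polytime_fun (\<lambda>x. enc_circuit (Circuit (ev n (env0 (length x))) (gl c x (env0 (length x)))))"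
proof -
  have "polytime_fun (\<lambda>x. den (GSeq (GNat n) (GSeq (GNat len) (cgen_gen c))) x (env0 (length x)))"
    by (rule polytime_den) (simp add: gok_cgen_gen assms(1))
  then show ?thesis by (simp add: den_cgen_gen assms(2))
qed

fun eshift :: "exp \<Rightarrow> gate \<Rightarrow> eg" where
  "eshift q (GIn i) = EIn (EC i)"
| "eshift q (GConst b) = EConst b"
| "eshift q (GNot a) = ENot (Add q (EC a))"
| "eshift q (GAnd a b) = EAnd (Add q (EC a)) (Add q (EC b))"
| "eshift q (GOr a b) = EOr (Add q (EC a)) (Add q (EC b))"

lemma geg_eshift [simp]: "geg x e (eshift q g) = shift (ev q e) g"
  by (cases g) auto

lemma eg_ok_eshift [simp]: "eg_ok x e (eshift q g)"
  by (cases g) auto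

definition eblk :: "exp \<Rightarrow> eg list \<Rightarrow> nat \<Rightarrow> nat \<Rightarrow> (bool list \<Rightarrow> bool list) \<Rightarrow> cgen" where
  "eblk q ls r K F = CG (ls @ map (eshift q) (core r K F))"

lemma gl_eblk: "gl (eblk q ls r K F) x e = blk (ev q e) (map (geg x e) ls) r K F"
  by (simp add: eblk_def blk_def)

lemma cok_eblk: "cok (eblk q ls r K F) x e = list_all (eg_ok x e) ls"
  by (auto simp: eblk_def list_all_iff)

section \<open>Circuits simulating Turing machines\<close>

text \<open>A space-time diagram of a Turing machine, read row by row with row length \<open>W\<close>, is a sequence in
  which entry \<open>p + W + 1\<close> depends on the entries \<open>p\<close>, \<open>p + 1\<close>, \<open>p + 2\<close>. The wall in column 0 bounds the
  row on both sides, because column 0 of the next row follows the last column. The start wall launches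
  the head in the first step, so that row \<open>\<tau> + 1\<close> shows the configuration at time \<open>\<tau>\<close>.\<close>
datatype cell = Wall | SWall | Cell nat "nat option"

fun arrive :: "tm \<Rightarrow> bool \<Rightarrow> cell \<Rightarrow> nat option" where
  "arrive M d (Cell a (Some q)) = (if q \<noteq> 1 \<and> snd (snd (delta M q a)) = d then Some (fst (delta M q a)) else None)"
| "arrive M d _ = None"

text \<open>A halted head stays. Otherwise a head comes from the start wall (in state 0), from the
  left or from the right; the last case is a left move in tape cell 0, recognised by the wall on the
  left, where the head stays in place.\<close>

definition newhead :: "tm \<Rightarrow> cell \<Rightarrow> nat \<Rightarrow> nat option \<Rightarrow> cell \<Rightarrow> nat option" where
  "newhead M l a h r =
     (if h = Some 1 then Some 1
      else if l = SWall then Some 0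
      else if arrive M True l \<noteq> None then arrive M True l
      else if arrive M False r \<noteq> None then arrive M False r
      else if l = Wall then arrive M False (Cell a h) else None)"

text \<open>Any wall in the centre yields a plain wall, so the start wall acts in the first step
  only.\<close>

fun phi :: "tm \<Rightarrow> cell \<Rightarrow> cell \<Rightarrow> cell \<Rightarrow> cell" where
  "phi M l (Cell a h) r = Cell (case h of None \<Rightarrow> a | Some q \<Rightarrow> if q = 1 then a else fst (snd (delta M q a)))
     (newhead M l a h r)"
| "phi M l _ r = Wall"

fun ccell :: "config \<Rightarrow> nat \<Rightarrow> cell" where
  "ccell (q, h, t) i = Cell (t i) (if i = h then Some q else None)"

text \<open>At the right end of a row a wall stands in for the next cell; this does no harm while
  the head is not on that cell.\<close>

lemma phi_ccell:
  assumes "r = ccell c (i + 1) \<or> r = Wall \<and> fst (snd c) \<noteq> i + 1"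
  shows "phi M (if i = 0 then Wall else ccell c (i - 1)) (ccell c i) r = ccell (tm_step M c) i"
proof -
  obtain q h t where c: "c = (q, h, t)" by (cases c)
  obtain q' a' d where d: "delta M q (t h) = (q', a', d)" by (metis prod_cases3)
  show ?thesis
  proof (cases "q = 1")
    case True
    then show ?thesis using assms by (auto split: if_splits simp: c tm_step_def newhead_def)
  next
    case False
    show ?thesis
    proof (cases i)
      case 0
      consider "h = 0" | "h = 1" | "h \<noteq> 0" "h \<noteq> 1" by blast
      then show ?thesis
        using assms False d unfolding 0
        by cases (auto simp: c tm_step_def newhead_def)
    next
      case (Suc j)
      consider "h = j" | "h = Suc j" | "h = Suc (Suc j)" | "h \<noteq> j" "h \<noteq> Suc j" "h \<noteq> Suc (Suc j)" by blast
      then show ?thesis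
        using assms False d unfolding Suc
        by cases (auto simp: c tm_step_def newhead_def)
    qed
  qed
qed

lemma tm_run_Suc: "tm_run M (Suc n) x = tm_step M (tm_run M n x)"
  by (simp add: tm_run_def)

lemma tm_run_head: "fst (snd (tm_run M n x)) \<le> n"
proof (induction n)
  case 0
  then show ?case by (simp add: tm_run_def tm_init_def)
next
  case (Suc n)
  then show ?case unfolding tm_run_Suc
    by (cases "tm_run M n x") (auto simp: tm_step_def split: prod.splits)
qed

lemma tm_run_halted:
  assumes "fst (tm_run M n x) = 1" "n \<le> T"
  shows "tm_run M T x = tm_run M n x"
  using assms(2)
proof (induction T rule: dec_induct)
  case (step T)
  then show ?case unfolding tm_run_Suc using assms(1)
    by (cases "tm_run M n x") (auto simp: tm_step_def)
qed simp

text \<open>Row s starts at index s * W. At time t the head is at most in cell t, so W >= T + 2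
  keeps it off the cell that the wall on the right hides.\<close>

lemma rows_simulate:
  fixes w :: "nat \<Rightarrow> cell"
  assumes W: "W \<ge> 3" and w0: "w 0 = SWall" "w W = Wall"
    and wi: "\<And>i. 1 \<le> i \<Longrightarrow> i < W \<Longrightarrow> w i = Cell (snd (snd (tm_init x)) (i - 1)) None"
    and wS: "\<And>p. p < P \<Longrightarrow> w (p + W + 1) = phi M (w p) (w (p + 1)) (w (p + 2))"
    and P: "(T + 1) * W \<le> P" and T: "T + 2 \<le> W"
  shows "\<tau> \<le> T \<Longrightarrow> i < W \<Longrightarrow>
    w ((\<tau> + 1) * W + i) = (if i = 0 then Wall else ccell (tm_run M \<tau> x) (i - 1))"
proof (induction \<tau> arbitrary: i)
  case 0
  show ?case
  proof (cases "i = 0")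
    case False
    then obtain j where j: "i = Suc j" by (cases i) auto
    have "W \<le> P" using P by simp
    then have "w (j + W + 1) = phi M (w j) (w (j + 1)) (w (j + 2))" using wS[of j] 0 j by simp
    moreover have "w (j + 1) = Cell (snd (snd (tm_init x)) j) None" using wi[of "j + 1"] 0 j by simp
    moreover have "j \<noteq> 0 \<Longrightarrow> \<exists>a. w j = Cell a None" using wi[of j] 0 j by auto
    moreover have "w (j + 2) = Wall \<or> (\<exists>a. w (j + 2) = Cell a None)"
      using wi[of "j + 2"] w0(2) 0 j by (cases "j + 2 = W") auto
    ultimately show ?thesis using w0(1)
      by (cases "j = 0") (auto simp: j tm_run_def tm_init_def newhead_def add.commute)
  qed (use w0 in simp)
next
  case (Suc \<tau>)
  have IH: "w ((\<tau> + 1) * W + i) = (if i = 0 then Wall else ccell (tm_run M \<tau> x) (i - 1))" if "i < W" for i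
    using Suc.IH[of i] Suc.prems(1) that by simp
  have "(\<tau> + 1) * W + W \<le> (T + 1) * W" using Suc.prems(1) mult_le_mono1[of "\<tau> + 2" "T + 1" W] by simp
  then have PS: "(\<tau> + 1) * W + W \<le> P" using P by linarith
  have 0: "w ((Suc \<tau> + 1) * W) = Wall"
  proof -
    \<comment> \<open>The centre p + 1 is the wall in column 0 of the row before, and walls are
      preserved.\<close>
    define p where "p = (\<tau> + 1) * W - 1"
    have p: "p + 1 = (\<tau> + 1) * W" using W by (simp add: p_def)
    then have "p < P" using PS by linarith
    then have "w (p + W + 1) = Wall" using wS[of p] IH[of 0] W unfolding p by simp
    moreover have e: "p + W + 1 = (Suc \<tau> + 1) * W" using p by simp
    ultimately show ?thesis unfolding e by blast
  qed
  show ?case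
  proof (cases "i = 0")
    case False
    then obtain j where j: "i = Suc j" by (cases i) auto
    define p where "p = (\<tau> + 1) * W + j"
    have "p < P" using PS Suc.prems(2) j unfolding p_def by linarith
    then have a: "w (p + W + 1) = phi M (w p) (w (p + 1)) (w (p + 2))" by (rule wS)
    have b: "w p = (if j = 0 then Wall else ccell (tm_run M \<tau> x) (j - 1))"
      using IH[of j] Suc.prems(2) j by (simp add: p_def)
    have c: "w (p + 1) = ccell (tm_run M \<tau> x) j"
      using IH[of "j + 1"] Suc.prems(2) j by (simp add: p_def)
    have "w (p + 2) = ccell (tm_run M \<tau> x) (j + 1) \<or>
        w (p + 2) = Wall \<and> fst (snd (tm_run M \<tau> x)) \<noteq> j + 1"
    proof (cases "j + 2 < W")
      case True
      then show ?thesis using IH[of "j + 2"] by (simp add: p_def)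
    next
      case False
      then have jW: "j + 2 = W" using Suc.prems(2) j by linarith
      \<comment> \<open>To the right of the last column lies column 0 of the next row, already known
        to be a wall.\<close>
      then have "p + 2 = (Suc \<tau> + 1) * W" by (simp add: p_def)
      moreover have "fst (snd (tm_run M \<tau> x)) \<noteq> j + 1"
        using tm_run_head[of M \<tau> x] jW T Suc.prems(1) by linarith
      ultimately show ?thesis using 0 by simp
    qed
    then have "w (p + W + 1) = ccell (tm_step M (tm_run M \<tau> x)) j"
      unfolding a b c by (rule phi_ccell)
    moreover have "p + W + 1 = (Suc \<tau> + 1) * W + i" by (simp add: p_def j)
    ultimately have "w ((Suc \<tau> + 1) * W + i) = ccell (tm_run M (Suc \<tau>) x) j"
      unfolding tm_run_Suc by metis
    then show ?thesis using False unfolding j by (simp only: if_False diff_Suc_1)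
  qed (use 0 in simp)
qed

section \<open>Cells as bit strings\<close>

definition cells :: "tm \<Rightarrow> cell set" where
  "cells M = {Wall, SWall} \<union> (\<lambda>(a, h). Cell a h) ` ({..<nsyms M} \<times> insert None (Some ` {..<nstates M}))"

lemma finite_cells: "finite (cells M)"
  by (simp add: cells_def)

lemma Cell_in_cells: "Cell a h \<in> cells M \<longleftrightarrow> a < nsyms M \<and> (\<forall>q. h = Some q \<longrightarrow> q < nstates M)"
  by (cases h) (auto simp: cells_def)

lemma walls_in_cells [simp]: "Wall \<in> cells M" "SWall \<in> cells M"
  by (auto simp: cells_def)

lemma arrive_less:
  assumes "tm_wf M" "c \<in> cells M" "arrive M d c = Some q"
  shows "q < nstates M"
  using assms(2,3) assms(1)[unfolded tm_wf_def]
  by (cases "(M, d, c)" rule: arrive.cases) (auto simp: Cell_in_cells split: if_splits)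

lemma phi_in_cells:
  assumes "tm_wf M" "l \<in> cells M" "c \<in> cells M" "r \<in> cells M"
  shows "phi M l c r \<in> cells M"
proof (cases c)
  case (Cell a h)
  have n: "2 \<le> nstates M" using assms(1) unfolding tm_wf_def by blast
  have "q < nstates M" if "newhead M l a h r = Some q" for q
    using that n arrive_less[OF assms(1)] assms(2-4) unfolding newhead_def Cell
    by (auto split: if_splits)
  moreover have "(case h of None \<Rightarrow> a | Some q \<Rightarrow> if q = 1 then a else fst (snd (delta M q a))) < nsyms M"
    using assms(1,3) unfolding Cell tm_wf_def by (auto simp: Cell_in_cells split: option.splits)
  ultimately show ?thesis unfolding Cell by (simp add: Cell_in_cells)
qed auto

definition cnum :: "tm \<Rightarrow> cell \<Rightarrow> nat" where
  "cnum M = (SOME f. inj_on f (cells M))"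

lemma inj_cnum: "inj_on (cnum M) (cells M)"
proof -
  have "\<exists>f :: cell \<Rightarrow> nat. inj_on f (cells M)"
    using finite_imp_inj_to_nat_seg[OF finite_cells[of M]] by blast
  then show ?thesis unfolding cnum_def by (rule someI_ex)
qed

definition cmax :: "tm \<Rightarrow> nat" where
  "cmax M = Suc (Max (cnum M ` cells M))"

text \<open>The codes of the input symbols 1 and 2 differ in the first bit only, so that an input bit
  directly provides its cell.\<close>
definition code :: "tm \<Rightarrow> cell \<Rightarrow> bool list" where
  "code M c = (c = Cell 2 None) #
     map (\<lambda>i. i = cnum M c \<and> c \<noteq> Cell 1 None \<and> c \<noteq> Cell 2 None) [0..<cmax M]"

definition cbits :: "tm \<Rightarrow> nat" where
  "cbits M = Suc (cmax M)"

lemma length_code [simp]: "length (code M c) = cbits M"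
  by (simp add: code_def cbits_def)

lemma cbits_pos [simp]: "cbits M > 0"
  by (simp add: cbits_def)

lemma code_bit: "code M (Cell (if b then 2 else 1) None) = b # replicate (cbits M - 1) False"
  by (auto simp: code_def cbits_def map_replicate_const intro!: nth_equalityI)

lemma cnum_less: "c \<in> cells M \<Longrightarrow> cnum M c < cmax M"
  using finite_cells by (auto simp: cmax_def less_Suc_eq_le)

lemma inj_code: "inj_on (code M) (cells M)"
proof (rule inj_onI)
  fix c d assume cd: "c \<in> cells M" "d \<in> cells M" "code M c = code M d"
  have nth: "code M e ! Suc i \<longleftrightarrow> i = cnum M e \<and> e \<noteq> Cell 1 None \<and> e \<noteq> Cell 2 None" if "i < cmax M" for e i
    using that by (simp add: code_def)
  have "(c = Cell 2 None) = (d = Cell 2 None)" using cd(3) by (simp add: code_def)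
  moreover have "cnum M c = cnum M d" if "c \<noteq> Cell 1 None" "c \<noteq> Cell 2 None"
    using nth[OF cnum_less[OF cd(1)], of c] nth[OF cnum_less[OF cd(1)], of d] cd(3) that by simp
  moreover have "cnum M c = cnum M d" if "d \<noteq> Cell 1 None" "d \<noteq> Cell 2 None"
    using nth[OF cnum_less[OF cd(2)], of c] nth[OF cnum_less[OF cd(2)], of d] cd(3) that by simp
  ultimately show "c = d" using inj_onD[OF inj_cnum] cd(1,2) by metis
qed

text \<open>Sending bit lists that are no codes to \<open>Wall\<close> keeps every decoded cell
  inside \<open>cells M\<close>, where the local rule stays.\<close>

definition dec :: "tm \<Rightarrow> bool list \<Rightarrow> cell" where
  "dec M bs = (if bs \<in> code M ` cells M then inv_into (cells M) (code M) bs else Wall)"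

lemma dec_code: "c \<in> cells M \<Longrightarrow> dec M (code M c) = c"
  using inj_code by (simp add: dec_def)

lemma dec_in_cells: "dec M bs \<in> cells M"
  by (auto simp: dec_def inv_into_into)

definition ca_rule :: "tm \<Rightarrow> bool list \<Rightarrow> bool list" where
  "ca_rule M bs = (let K = cbits M in
     code M (phi M (dec M (take K bs)) (dec M (take K (drop K bs))) (dec M (drop (2 * K) bs))))"

lemma ca_rule_append:
  "length a = cbits M \<Longrightarrow> length b = cbits M \<Longrightarrow> ca_rule M (a @ b @ c) = code M (phi M (dec M a) (dec M b) (dec M c))"
  by (simp add: ca_rule_def)

text \<open>The disjunction of a gate with itself serves as the identity gate.\<close>

definition copies :: "nat \<Rightarrow> nat \<Rightarrow> gate list" where
  "copies a K = map (\<lambda>l. GOr (a + l) (a + l)) [0..<K]"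

definition vals :: "(nat \<Rightarrow> bool) \<Rightarrow> nat \<Rightarrow> nat \<Rightarrow> bool list" where
  "vals V a K = map (\<lambda>l. V (a + l)) [0..<K]"

lemma length_copies [simp]: "length (copies a K) = K"
  by (simp add: copies_def)

lemma length_vals [simp]: "length (vals V a K) = K"
  by (simp add: vals_def)

lemma gv_copies: "map (gv inp V) (copies a K) = vals V a K"
  by (simp add: copies_def vals_def)

lemma wf_copies: "a + K \<le> q \<Longrightarrow> refs_ok q (copies a K)"
  by (auto simp: copies_def pos_def)

text \<open>The filling goes in front, so the payload sits in the last gates, as it does in a block;
  given and computed entries are then addressed alike.\<close>

definition pad :: "nat \<Rightarrow> gate list \<Rightarrow> gate list" where
  "pad B ls = replicate (B - length ls) (GConst False) @ ls"

lemma length_pad: "length ls \<le> B \<Longrightarrow> length (pad B ls) = B"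
  by (simp add: pad_def)

lemma pos_replicate: "pos P q (replicate n g) \<longleftrightarrow> (\<forall>j<n. P (q + j) g)"
  by (auto simp: pos_def)

lemma pad_sat:
  assumes "sat inp V q (pad B ls)" "length ls = K"
  shows "vals V (q + (B - K)) K = map (gv inp V) ls"
  using assms unfolding pad_def pos_append by (auto simp: vals_def pos_def intro!: nth_equalityI)

lemma wf_pad: "(\<And>g j. g \<in> set ls \<Longrightarrow> gate_ok j g) \<Longrightarrow> refs_ok q (pad B ls)"
  by (auto simp: pad_def pos_replicate) (auto simp: pos_def)

lemma blk_vals:
  assumes "sat inp V q (blk q ls r K F)" "length ls = r" "length (F (map (gv inp V) ls)) = K"
  shows "vals V (q + (bsize r K F - K)) K = F (map (gv inp V) ls)"
  using blk_sat[OF assms(1,2)] assms(3) by (auto simp: vals_def intro!: nth_equalityI)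

lemma pos_concat_list:
  assumes "\<And>a. a \<in> set xs \<Longrightarrow> length (f a) = B"
  shows "pos P q (concat (map f xs)) \<longleftrightarrow> (\<forall>p<length xs. pos P (q + p * B) (f (xs ! p)))"
  using assms
proof (induction xs arbitrary: q)
  case (Cons a xs)
  then show ?case by (auto simp: less_Suc_eq_0_disj algebra_simps)
qed auto

lemma length_concat_list:
  "(\<And>a. a \<in> set xs \<Longrightarrow> length (f a) = B) \<Longrightarrow> length (concat (map f xs)) = length xs * B"
  by (induction xs) auto

section \<open>The circuit of a space-time diagram\<close>

definition csize :: "tm \<Rightarrow> nat" where
  "csize M = bsize (3 * cbits M) (cbits M) (ca_rule M)"

definition cgates :: "bool list \<Rightarrow> gate list" where
  "cgates bs = map GConst bs"

definition bitcell :: "tm \<Rightarrow> gate \<Rightarrow> gate list" where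
  "bitcell M g = g # replicate (cbits M - 1) (GConst False)"

text \<open>Row 0 and the wall that opens row 1. With row length W = |input| + T + 3 these are W + 1
  entries, exactly what the recurrence needs to start.\<close>

definition inicells :: "tm \<Rightarrow> gate list \<Rightarrow> nat \<Rightarrow> gate list list" where
  "inicells M bgs T = cgates (code M SWall) # map (bitcell M) bgs @
     replicate (T + 2) (cgates (code M (Cell 0 None))) @ [cgates (code M Wall)]"

definition caloads :: "tm \<Rightarrow> nat \<Rightarrow> nat \<Rightarrow> gate list" where
  "caloads M q p = concat (map (\<lambda>d. copies (q + (p + d) * csize M + (csize M - cbits M)) (cbits M)) [0..<3])"

text \<open>Row T + 1 shows time T, so (T + 1) * W computed entries reach its end.\<close>

definition ca :: "tm \<Rightarrow> nat \<Rightarrow> gate list \<Rightarrow> nat \<Rightarrow> gate list" where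
  "ca M q bgs T = (let W = length bgs + T + 3 in
     concat (map (pad (csize M)) (inicells M bgs T)) @
     concat (map (\<lambda>p. blk (q + (p + W + 1) * csize M) (caloads M q p) (3 * cbits M) (cbits M) (ca_rule M)) [0..<(T + 1) * W]))"

definition ca_len :: "tm \<Rightarrow> nat \<Rightarrow> nat \<Rightarrow> nat" where
  "ca_len M L T = (let W = L + T + 3 in (W + 1 + (T + 1) * W) * csize M)"

text \<open>Address of the code of tape cell \<open>i\<close> at time \<open>T\<close>.\<close>
definition ca_out :: "tm \<Rightarrow> nat \<Rightarrow> nat \<Rightarrow> nat \<Rightarrow> nat \<Rightarrow> nat" where
  "ca_out M q L T i = q + ((T + 1) * (L + T + 3) + i + 1) * csize M + (csize M - cbits M)"

lemma csize_ge: "cbits M \<le> csize M"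
  unfolding csize_def by (rule bsize_ge)

lemma length_inicell: "ls \<in> set (inicells M bgs T) \<Longrightarrow> length ls = cbits M"
  using cbits_pos[of M] by (auto simp: inicells_def cgates_def bitcell_def simp del: cbits_pos)

lemma length_inicells: "length (inicells M bgs T) = length bgs + T + 4"
  by (simp add: inicells_def)

lemma length_caloads: "length (caloads M q p) = 3 * cbits M"
  unfolding caloads_def by (subst length_concat_const[where B = "cbits M"]) auto

lemma length_cablk: "length (blk q' (caloads M q p) (3 * cbits M) (cbits M) (ca_rule M)) = csize M"
  unfolding csize_def by (rule length_blk[OF length_caloads])

lemma length_ini_part: "length (concat (map (pad (csize M)) (inicells M bgs T))) = (length bgs + T + 4) * csize M"
  by (subst length_concat_list[where B = "csize M"]) (auto simp: length_pad length_inicell csize_ge length_inicells)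

lemma length_ca: "length (ca M q bgs T) = ca_len M (length bgs) T"
proof -
  let ?W = "length bgs + T + 3"
  have "length (concat (map (\<lambda>p. blk (q + (p + ?W + 1) * csize M) (caloads M q p) (3 * cbits M) (cbits M) (ca_rule M))
     [0..<(T + 1) * ?W])) = (T + 1) * ?W * csize M"
    by (rule length_concat_const) (simp add: length_cablk)
  then show ?thesis unfolding ca_def ca_len_def Let_def length_append length_ini_part
    by (simp add: algebra_simps)
qed

lemma pos_ca:
  "pos P q (ca M q bgs T) \<longleftrightarrow>
    (\<forall>p < length bgs + T + 4. pos P (q + p * csize M) (pad (csize M) (inicells M bgs T ! p))) \<and>
    (\<forall>p < (T + 1) * (length bgs + T + 3). pos P (q + (p + (length bgs + T + 3) + 1) * csize M)
       (blk (q + (p + (length bgs + T + 3) + 1) * csize M) (caloads M q p) (3 * cbits M) (cbits M) (ca_rule M)))"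
proof -
  let ?W = "length bgs + T + 3"
  have 1: "pos P q (concat (map (pad (csize M)) (inicells M bgs T))) \<longleftrightarrow>
    (\<forall>p < length bgs + T + 4. pos P (q + p * csize M) (pad (csize M) (inicells M bgs T ! p)))"
    by (subst pos_concat_list[where B = "csize M"]) (auto simp: length_pad length_inicell csize_ge length_inicells)
  have e: "q + (length bgs + T + 4) * csize M + p * csize M = q + (p + ?W + 1) * csize M" for p
    by (simp add: algebra_simps)
  have 2: "pos P (q + (length bgs + T + 4) * csize M) (concat (map (\<lambda>p. blk (q + (p + ?W + 1) * csize M) (caloads M q p) (3 * cbits M) (cbits M) (ca_rule M))
     [0..<(T + 1) * ?W])) \<longleftrightarrow> (\<forall>p < (T + 1) * ?W. pos P (q + (p + ?W + 1) * csize M)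
       (blk (q + (p + ?W + 1) * csize M) (caloads M q p) (3 * cbits M) (cbits M) (ca_rule M)))"
    by (subst pos_concat[where B = "csize M"]) (auto simp: length_cablk e)
  show ?thesis unfolding ca_def Let_def pos_append length_ini_part 1 2 ..
qed

lemma wf_ca:
  assumes "\<And>g j. g \<in> set bgs \<Longrightarrow> gate_ok j g"
  shows "refs_ok q (ca M q bgs T)"
  unfolding pos_ca
proof (intro conjI allI impI)
  fix p assume "p < length bgs + T + 4"
  then have "inicells M bgs T ! p \<in> set (inicells M bgs T)" by (simp add: length_inicells)
  then show "refs_ok (q + p * csize M) (pad (csize M) (inicells M bgs T ! p))"
    by (intro wf_pad) (auto simp: inicells_def cgates_def bitcell_def assms)
next
  fix p
  let ?W = "length bgs + T + 3"
  show "refs_ok (q + (p + ?W + 1) * csize M) (blk (q + (p + ?W + 1) * csize M) (caloads M q p) (3 * cbits M) (cbits M) (ca_rule M))"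
  proof (rule blk_wf[OF length_caloads])
    have "refs_ok q' (copies (q + (p + d) * csize M + (csize M - cbits M)) (cbits M))"
      if "d < 3" "q + (p + ?W + 1) * csize M \<le> q'" for d q'
    proof (rule wf_copies)
      have "q + (p + d) * csize M + (csize M - cbits M) + cbits M = q + (p + d + 1) * csize M"
        using csize_ge[of M] by simp
      also have "\<dots> \<le> q + (p + ?W + 1) * csize M" using that by (intro add_left_mono mult_right_mono) auto
      finally show "q + (p + d) * csize M + (csize M - cbits M) + cbits M \<le> q'" using that by linarith
    qed
    then show "refs_ok (q + (p + ?W + 1) * csize M) (caloads M q p)"
      unfolding caloads_def by (subst pos_concat[where B = "cbits M"]) auto
  qed
qed

lemma gv_bitcell: "map (gv inp V) (bitcell M g) = code M (Cell (if gv inp V g then 2 else 1) None)"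
  by (simp only: code_bit) (simp add: bitcell_def)

lemma gv_cgates: "map (gv inp V) (cgates bs) = bs"
  by (simp add: cgates_def o_def)

theorem ca_simulates:
  assumes M: "tm_wf M" and s: "sat inp V q (ca M q bgs T)" and i: "i < length bgs + T + 2"
  shows "vals V (ca_out M q (length bgs) T i) (cbits M) = code M (ccell (tm_run M T (map (gv inp V) bgs)) i)"
proof -
  define W where "W = length bgs + T + 3"
  define z where "z = map (gv inp V) bgs"
  define cv where "cv p = vals V (q + p * csize M + (csize M - cbits M)) (cbits M)" for p
  define w where "w p = dec M (cv p)" for p
  have len: "length (cv p) = cbits M" for p by (simp add: cv_def)
  have n3: "3 \<le> nsyms M" using M unfolding tm_wf_def by blast
  have ini: "cv p = map (gv inp V) (inicells M bgs T ! p)" if "p < length bgs + T + 4" for p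
    unfolding cv_def by (rule pad_sat) (use s that in \<open>auto simp: pos_ca length_inicells intro!: length_inicell[of _ M bgs T]\<close>)
  have ini': "cv p = code M (w p) \<and> w p = (if p = 0 then SWall else if p = W then Wall else Cell (snd (snd (tm_init z)) (p - 1)) None)"
    if p: "p \<le> W" for p
  proof -
    let ?c = "if p = 0 then SWall else if p = W then Wall else Cell (snd (snd (tm_init z)) (p - 1)) None"
    have "cv p = code M ?c"
    proof (cases p)
      case 0
      then show ?thesis using ini[of p] by (simp add: inicells_def gv_cgates)
    next
      case (Suc j)
      consider "j < length bgs" | "length bgs \<le> j" "j < length bgs + (T + 2)" | "j = length bgs + (T + 2)"
        using p Suc unfolding W_def by linarith
      then show ?thesis
      proof cases
        case 1
        then have "inicells M bgs T ! p = bitcell M (bgs ! j)" by (simp add: inicells_def Suc nth_append)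
        then have "cv p = code M (Cell (if z ! j then 2 else 1) None)"
          using ini[of p] p 1 unfolding W_def by (simp only: gv_bitcell) (simp add: z_def)
        then show ?thesis using 1 Suc by (simp add: tm_init_def W_def z_def)
      next
        case 2
        then have "inicells M bgs T ! p = cgates (code M (Cell 0 None))"
          by (auto simp: inicells_def Suc nth_append simp del: replicate.simps add_2_eq_Suc add_2_eq_Suc')
        then have "cv p = code M (Cell 0 None)"
          using ini[of p] p unfolding W_def by (simp add: gv_cgates)
        then show ?thesis using 2 Suc by (simp add: tm_init_def W_def z_def)
      next
        case 3
        then have "inicells M bgs T ! p = cgates (code M Wall)"
          by (auto simp: inicells_def Suc nth_append simp del: replicate.simps add_2_eq_Suc add_2_eq_Suc')
        then have "cv p = code M Wall"
          using ini[of p] p unfolding W_def by (simp add: gv_cgates)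
        then show ?thesis using 3 Suc by (simp add: W_def)
      qed
    qed
    moreover have "?c \<in> cells M" using n3 by (auto simp: tm_init_def Cell_in_cells)
    ultimately show ?thesis by (simp add: w_def dec_code)
  qed
  have rec: "cv (p + W + 1) = code M (phi M (w p) (w (p + 1)) (w (p + 2)))" if "p < (T + 1) * W" for p
  proof -
    have "sat inp V (q + (p + W + 1) * csize M) (blk (q + (p + W + 1) * csize M) (caloads M q p) (3 * cbits M) (cbits M) (ca_rule M))"
      using s that unfolding pos_ca W_def by blast
    from blk_vals[OF this length_caloads] have "cv (p + W + 1) = ca_rule M (map (gv inp V) (caloads M q p))"
      unfolding cv_def csize_def by (simp add: ca_rule_def Let_def)
    also have "map (gv inp V) (caloads M q p) = cv p @ cv (p + 1) @ cv (p + 2)"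
      by (simp add: caloads_def numeral_3_eq_3 gv_copies cv_def)
    also have "ca_rule M \<dots> = code M (phi M (w p) (w (p + 1)) (w (p + 2)))"
      by (simp add: ca_rule_append len w_def)
    finally show ?thesis .
  qed
  have rec': "w (p + W + 1) = phi M (w p) (w (p + 1)) (w (p + 2))" if "p < (T + 1) * W" for p
    unfolding w_def[of "p + W + 1"] rec[OF that]
    by (intro dec_code phi_in_cells M) (simp_all add: w_def dec_in_cells)
  \<comment> \<open>Every entry is a proper code: the given ones by construction, the others because
    the rule outputs only codes.\<close>
  have cvw: "cv p = code M (w p)" if "p < (T + 1) * W + W + 1" for p
  proof (cases "p \<le> W")
    case False
    then obtain p' where p': "p = p' + W + 1" by (metis add.commute less_imp_Suc_add not_le add_Suc_right Suc_eq_plus1)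
    with that have "p' < (T + 1) * W" by simp
    then show ?thesis using rec rec' p' by simp
  qed (use ini' in blast)
  have "w ((T + 1) * W + (i + 1)) = (if i + 1 = 0 then Wall else ccell (tm_run M T z) (i + 1 - 1))"
  proof (rule rows_simulate)
    show "W \<ge> 3" "T + 2 \<le> W" "i + 1 < W" using i by (auto simp: W_def)
    show "w 0 = SWall" "w W = Wall" using ini'[of 0] ini'[of W] \<open>W \<ge> 3\<close> by auto
    show "w i = Cell (snd (snd (tm_init z)) (i - 1)) None" if "1 \<le> i" "i < W" for i using ini'[of i] that by auto
    show "w (p + W + 1) = phi M (w p) (w (p + 1)) (w (p + 2))" if "p < (T + 1) * W" for p
      using rec'[OF that] .
  qed auto
  then have "cv ((T + 1) * W + i + 1) = code M (ccell (tm_run M T z) i)"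
    using cvw[of "(T + 1) * W + i + 1"] i by (simp add: W_def add.assoc)
  then show ?thesis unfolding cv_def ca_out_def W_def z_def .
qed

section \<open>Nim with two heaps\<close>

text \<open>Along a chain the number of points that survive a move is strictly increasing and below
  the size of the chain. An injection of this kind hits every smaller number.\<close>

lemma chain_cut:
  assumes "finite A" "is_po_on A le" "is_chain_on A le" "b < card A"
  shows "\<exists>x\<in>A. card {y\<in>A. \<not> le x y} = b"
proof -
  define f where "f x = card {y\<in>A. \<not> le x y}" for x
  have mono: "f x < f x'" if "x \<in> A" "x' \<in> A" "le x x'" "x \<noteq> x'" for x x'
  proof -
    have "{y\<in>A. \<not> le x y} \<subset> {y\<in>A. \<not> le x' y}"
      using assms(2) that unfolding is_po_on_def by blast
    then show ?thesis unfolding f_def using assms(1) by (intro psubset_card_mono) auto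
  qed
  have "inj_on f A"
  proof (rule inj_onI, rule ccontr)
    fix x x' assume "x \<in> A" "x' \<in> A" "f x = f x'" "x \<noteq> x'"
    then show False using mono[of x x'] mono[of x' x] assms(3) unfolding is_chain_on_def by auto
  qed
  moreover have "f ` A \<subseteq> {..<card A}"
  proof
    fix n assume "n \<in> f ` A"
    then obtain x where x: "x \<in> A" "n = f x" by blast
    then have "{y\<in>A. \<not> le x y} \<subset> A" using assms(2) unfolding is_po_on_def by blast
    then show "n \<in> {..<card A}" using x assms(1) by (auto simp: f_def intro: psubset_card_mono)
  qed
  ultimately have "f ` A = {..<card A}"
    by (intro card_subset_eq) (auto simp: card_image)
  then have "b \<in> f ` A" using assms(4) by simp
  then show ?thesis unfolding f_def by auto
qed

lemma is_po_on_subset: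
  assumes "is_po_on A le" "B \<subseteq> A"
  shows "is_po_on B le"
proof -
  have B: "x \<in> B \<Longrightarrow> x \<in> A" for x using assms(2) by blast
  have 1: "\<forall>x\<in>A. le x x" and 2: "\<forall>x\<in>A. \<forall>y\<in>A. le x y \<and> le y x \<longrightarrow> x = y"
    and 3: "\<forall>x\<in>A. \<forall>y\<in>A. \<forall>z\<in>A. le x y \<and> le y z \<longrightarrow> le x z"
    using assms(1) unfolding is_po_on_def by - (elim conjE, assumption)+
  show ?thesis unfolding is_po_on_def
  proof (intro conjI ballI impI)
    show "le x x" if "x \<in> B" for x using 1 B that by blast
    show "x = y" if "x \<in> B" "y \<in> B" "le x y \<and> le y x" for x y using 2 B that by blast
    show "le x z" if "x \<in> B" "y \<in> B" "z \<in> B" "le x y \<and> le y z" for x y z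
      using 3[rule_format, of x y z] B that by blast
  qed
qed

lemma is_chain_on_subset: "is_chain_on A le \<Longrightarrow> B \<subseteq> A \<Longrightarrow> is_chain_on B le"
  unfolding is_chain_on_def by (simp add: subset_iff)

definition two_heaps :: "('a \<Rightarrow> 'a \<Rightarrow> bool) \<Rightarrow> 'a set \<Rightarrow> 'a set \<Rightarrow> bool" where
  "two_heaps le A B \<longleftrightarrow> finite A \<and> finite B \<and> A \<inter> B = {} \<and> is_po_on A le \<and> is_po_on B le \<and>
     is_chain_on A le \<and> is_chain_on B le \<and> (\<forall>a\<in>A. \<forall>b\<in>B. \<not> le a b \<and> \<not> le b a)"

lemma two_heaps_sym: "two_heaps le A B \<Longrightarrow> two_heaps le B A"
  unfolding two_heaps_def by blast

lemma two_heaps_move: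
  assumes "two_heaps le A B" "x \<in> A"
  shows "two_heaps le {y\<in>A. \<not> le x y} B" "{y \<in> A \<union> B. \<not> le x y} = {y\<in>A. \<not> le x y} \<union> B"
    "card {y\<in>A. \<not> le x y} < card A"
proof -
  let ?A = "{y\<in>A. \<not> le x y}"
  have sub: "?A \<subseteq> A" by blast
  have h: "finite A" "finite B" "A \<inter> B = {}" "is_po_on A le" "is_po_on B le" "is_chain_on A le" "is_chain_on B le"
    and inc: "\<forall>a\<in>A. \<forall>b\<in>B. \<not> le a b \<and> \<not> le b a"
    using assms(1) unfolding two_heaps_def by - (elim conjE, assumption)+
  show "two_heaps le ?A B"
    unfolding two_heaps_def
  proof (intro conjI)
    show "finite ?A" using h(1) by simp
    show "?A \<inter> B = {}" using h(3) by blast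
    show "\<forall>a\<in>?A. \<forall>b\<in>B. \<not> le a b \<and> \<not> le b a" using inc by blast
  qed (rule h is_po_on_subset[OF h(4) sub] is_chain_on_subset[OF h(6) sub])+
  have xx: "le x x" using h(4) assms(2) unfolding is_po_on_def by blast
  show "{y \<in> A \<union> B. \<not> le x y} = {y\<in>A. \<not> le x y} \<union> B"
    using inc assms(2) by blast
  have "{y\<in>A. \<not> le x y} \<subset> A" using xx assms(2) by blast
  then show "card {y\<in>A. \<not> le x y} < card A"
    using h(1) by (rule psubset_card_mono[rotated])
qed

text \<open>The winning move equalises the two chains.\<close>
lemma pg_win_two_heaps:
  "two_heaps le A B \<Longrightarrow> card A + card B \<le> k \<Longrightarrow> pg_win le k (A \<union> B) \<longleftrightarrow> card A \<noteq> card B"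
proof (induction k arbitrary: A B)
  case 0
  then show ?case by simp
next
  case (Suc k)
  \<comment> \<open>A move in one chain leaves two heaps again, to which the induction hypothesis
    applies.\<close>
  have eq: "pg_win le k {y \<in> A \<union> B. \<not> le x y} \<longleftrightarrow> card {y\<in>A. \<not> le x y} \<noteq> card B"
    if "two_heaps le A B" "card A + card B \<le> Suc k" "x \<in> A" for A B x
  proof -
    note m = two_heaps_move[OF that(1,3)]
    show ?thesis unfolding m(2) by (rule Suc.IH[OF m(1)]) (use m(3) that(2) in linarith)
  qed
  have win: "pg_win le (Suc k) (A \<union> B)" if t: "two_heaps le A B" "card A + card B \<le> Suc k" "card B < card A" for A B
  proof -
    obtain x where x: "x \<in> A" "card {y\<in>A. \<not> le x y} = card B"
      using chain_cut[of A le "card B"] t unfolding two_heaps_def by blast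
    then show ?thesis using eq[OF t(1,2) x(1)] by auto
  qed
  consider "card B < card A" | "card A < card B" | "card A = card B" by linarith
  then show ?case
  proof cases
    case 1
    then show ?thesis using win[OF Suc.prems] by simp
  next
    case 2
    then have "pg_win le (Suc k) (B \<union> A)"
      using win[OF two_heaps_sym[OF Suc.prems(1)]] Suc.prems(2) by simp
    then show ?thesis using 2 by (metis Un_commute less_irrefl)
  next
    case 3
    \<comment> \<open>From equal chains every move makes the sizes differ, which is a win for the
      opponent.\<close>
    have "pg_win le k {y \<in> A \<union> B. \<not> le x y}" if "x \<in> A \<union> B" for x
    proof (cases "x \<in> A")
      case True
      then show ?thesis
        using eq[OF Suc.prems True] two_heaps_move(3)[OF Suc.prems(1) True] 3 by simp
    next
      case False
      then have xB: "x \<in> B" using that by simp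
      have s: "card B + card A \<le> Suc k" using Suc.prems(2) by simp
      have "pg_win le k {y \<in> B \<union> A. \<not> le x y}"
        using eq[OF two_heaps_sym[OF Suc.prems(1)] s xB] two_heaps_move(3)[OF two_heaps_sym[OF Suc.prems(1)] xB] 3 by simp
      then show ?thesis by (simp only: Un_commute)
    qed
    then show ?thesis using 3 by auto
  qed
qed

section \<open>The cube ordered by numerical value\<close>

lemma cube_Suc: "cube (Suc n) = (\<lambda>(b, y). b # y) ` (UNIV \<times> cube n)"
  by (auto simp: cube_def length_Suc_conv image_iff)

lemma finite_cube [simp]: "finite (cube n)"
proof (induction n)
  case 0
  then show ?case by (simp add: cube_def)
next
  case (Suc n)
  then show ?case unfolding cube_Suc by (intro finite_imageI finite_cartesian_product) auto
qed

lemma bin_val_bij: "bij_betw bin_val (cube n) {..<2 ^ n}"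
proof (induction n)
  case 0
  then show ?case by (simp add: cube_def bij_betw_def lessThan_Suc)
next
  case (Suc n)
  have inj: "inj_on bin_val (cube (Suc n))"
  proof (rule inj_onI)
    fix x y assume "x \<in> cube (Suc n)" "y \<in> cube (Suc n)" and e: "bin_val x = bin_val y"
    then obtain a x' b y' where xy: "x = a # x'" "y = b # y'" "x' \<in> cube n" "y' \<in> cube n"
      unfolding cube_Suc by auto
    have "(if a then 1 else 0) + 2 * bin_val x' = (if b then 1 else 0) + 2 * bin_val y'" using e xy by simp
    then have "a = b" "bin_val x' = bin_val y'" by (cases a; cases b; presburger)+
    then show "x = y" using xy Suc unfolding bij_betw_def by (auto dest: inj_onD)
  qed
  have "bin_val ` cube (Suc n) = {..<2 ^ Suc n}"
  proof
    show "bin_val ` cube (Suc n) \<subseteq> {..<2 ^ Suc n}"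
    proof
      fix v assume "v \<in> bin_val ` cube (Suc n)"
      then obtain a x' where v: "v = bin_val (a # x')" "x' \<in> cube n" unfolding cube_Suc by auto
      then have "bin_val x' < 2 ^ n" using Suc unfolding bij_betw_def by blast
      then show "v \<in> {..<2 ^ Suc n}" using v by (cases a) auto
    qed
    show "{..<2 ^ Suc n} \<subseteq> bin_val ` cube (Suc n)"
    proof
      fix v :: nat assume "v \<in> {..<2 ^ Suc n}"
      then have "v div 2 \<in> {..<2 ^ n}" by auto
      then obtain x' where "x' \<in> cube n" "bin_val x' = v div 2" using Suc unfolding bij_betw_def by (metis imageE)
      moreover from this have "bin_val (odd v # x') = v" by (simp add: odd_iff_mod_2_eq_one even_iff_mod_2_eq_zero)
      ultimately show "v \<in> bin_val ` cube (Suc n)" unfolding cube_Suc by (metis (mono_tags, lifting) SigmaI UNIV_I case_prod_conv image_eqI)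
    qed
  qed
  with inj show ?case unfolding bij_betw_def by blast
qed

lemma card_cube: "card (cube n) = 2 ^ n"
  using bij_betw_same_card[OF bin_val_bij[of n]] by simp

lemma bin_val_inj: "x \<in> cube n \<Longrightarrow> y \<in> cube n \<Longrightarrow> bin_val x = bin_val y \<Longrightarrow> x = y"
  using bin_val_bij[of n] unfolding bij_betw_def by (auto dest: inj_onD)

lemma card_bin_val_less:
  assumes "h \<le> 2 ^ n"
  shows "card {y \<in> cube n. bin_val y < h} = h"
proof -
  have "bij_betw bin_val {y \<in> cube n. bin_val y < h} {..<h}"
    using bin_val_bij[of n] assms unfolding bij_betw_def
    by (auto simp: inj_on_def image_iff)
  then show ?thesis using bij_betw_same_card by fastforce
qed

text \<open>\<open>bin_val\<close> is injective on the cube, hence orders each part linearly; the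
  parts have equal size iff one of them is half of the cube.\<close>

lemma nim2_split:
  assumes n: "circ_n Q = n"
    and ev: "\<And>y z. y \<in> cube n \<Longrightarrow> z \<in> cube n \<Longrightarrow> circ_eval Q y z \<longleftrightarrow> (D y \<longleftrightarrow> D z) \<and> bin_val y \<le> bin_val z"
  shows "nim2_promise Q" "nim2_yes Q \<longleftrightarrow> 2 * card {y \<in> cube n. D y} \<noteq> 2 ^ n"
proof -
  define A where "A = {y \<in> cube n. D y}"
  define B where "B = {y \<in> cube n. \<not> D y}"
  have AB: "A \<union> B = cube n" "A \<inter> B = {}" by (auto simp: A_def B_def)
  have po: "is_po_on (cube n) (circ_eval Q)"
    unfolding is_po_on_def using bin_val_inj by (auto simp: ev)
  have poAB: "is_po_on A (circ_eval Q)" "is_po_on B (circ_eval Q)"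
    using is_po_on_subset[OF po] AB(1) by blast+
  have ch: "is_chain_on A (circ_eval Q)" "is_chain_on B (circ_eval Q)"
    unfolding is_chain_on_def A_def B_def by (auto simp: ev)
  have inc: "\<forall>a\<in>A. \<forall>b\<in>B. \<not> circ_eval Q a b \<and> \<not> circ_eval Q b a"
    unfolding A_def B_def by (auto simp: ev)
  show "nim2_promise Q"
    unfolding nim2_promise_def union_of_two_chains_def n using po AB ch inc by blast
  have fin: "finite A" "finite B" by (auto simp: A_def B_def)
  have "two_heaps (circ_eval Q) A B"
    unfolding two_heaps_def using fin AB poAB ch inc by blast
  moreover have c: "card A + card B = 2 ^ n"
    using card_Un_disjoint[OF fin AB(2)] AB(1) card_cube by simp
  ultimately have "pg_win (circ_eval Q) (2 ^ n) (A \<union> B) \<longleftrightarrow> card A \<noteq> card B"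
    by (intro pg_win_two_heaps) auto
  then have "nim2_yes Q \<longleftrightarrow> card A \<noteq> card B"
    by (simp only: nim2_yes_def exists_game_def n AB card_cube)
  then show "nim2_yes Q \<longleftrightarrow> 2 * card {y \<in> cube n. D y} \<noteq> 2 ^ n"
    using c unfolding A_def by linarith
qed

text \<open>The first bit selects between the witnesses, padded by zeros, and the complement of an initial
  segment of length \<open>h\<close>. Hence exactly half of the cube satisfies \<open>D\<close> iff there are \<open>h\<close> witnesses.\<close>
lemma card_selector:
  assumes h: "h \<le> 2 ^ n" and m: "m \<le> n"
    and D: "\<And>b y. y \<in> cube n \<Longrightarrow>
      D (b # y) \<longleftrightarrow> (if b then h \<le> bin_val y else R (take m y) \<and> \<not> list_ex id (drop m y))"
  shows "2 * card {w \<in> cube (Suc n). D w} \<noteq> 2 ^ Suc n \<longleftrightarrow> card {y \<in> cube m. R y} \<noteq> h"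
proof -
  let ?T = "{y \<in> cube n. h \<le> bin_val y}" and ?F = "{y \<in> cube n. R (take m y) \<and> \<not> list_ex id (drop m y)}"
  have "{w \<in> cube (Suc n). D w} = Cons True ` ?T \<union> Cons False ` ?F"
    unfolding cube_Suc by (auto simp: D image_iff split: if_splits)
  then have "card {w \<in> cube (Suc n). D w} = card (Cons True ` ?T) + card (Cons False ` ?F)"
    by (subst card_Un_disjoint[symmetric]) auto
  then have 1: "card {w \<in> cube (Suc n). D w} = card ?T + card ?F"
    by (simp add: card_image)
  have "?T = cube n - {y \<in> cube n. bin_val y < h}" by auto
  then have 2: "card ?T = 2 ^ n - h"
    using card_Diff_subset[of "{y \<in> cube n. bin_val y < h}" "cube n"] card_bin_val_less[OF h] by (simp add: card_cube)
  \<comment> \<open>Appending zeros matches the witnesses of length m with the words counted on the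
    side of the selector \<open>False\<close>.\<close>
  have "bij_betw (\<lambda>y. y @ replicate (n - m) False) {y \<in> cube m. R y} ?F"
    unfolding bij_betw_def
  proof
    show "inj_on (\<lambda>y. y @ replicate (n - m) False) {y \<in> cube m. R y}" by (auto simp: inj_on_def)
    show "(\<lambda>y. y @ replicate (n - m) False) ` {y \<in> cube m. R y} = ?F"
    proof (intro equalityI subsetI)
      fix y assume "y \<in> (\<lambda>y. y @ replicate (n - m) False) ` {y \<in> cube m. R y}"
      then show "y \<in> ?F" using m by (auto simp: cube_def list_ex_iff)
    next
      fix y assume y: "y \<in> ?F"
      have "\<forall>b\<in>set (drop m y). b = False" using y by (auto simp: list_ex_iff)
      then have "drop m y = replicate (length (drop m y)) False" by (metis replicate_length_same)
      then have "drop m y = replicate (n - m) False" using y by (simp add: cube_def)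
      then have "y = take m y @ replicate (n - m) False" by (metis append_take_drop_id)
      moreover have "take m y \<in> {y \<in> cube m. R y}" using y m by (auto simp: cube_def)
      ultimately show "y \<in> (\<lambda>y. y @ replicate (n - m) False) ` {y \<in> cube m. R y}" by (rule image_eqI)
    qed
  qed
  then have 3: "card ?F = card {y \<in> cube m. R y}" using bij_betw_same_card by fastforce
  show ?thesis using h unfolding 1 2 3 by auto
qed

section \<open>Iterated circuits\<close>

text \<open>For tasks whose input grows with |x|, such as comparisons: a state of K bits passes
  through n copies of one block of constant size, and block i also reads its own r load gates
  \<open>ex i\<close>.\<close>

definition chain :: "nat \<Rightarrow> nat \<Rightarrow> nat \<Rightarrow> (bool list \<Rightarrow> bool list) \<Rightarrow> bool list \<Rightarrow> (nat \<Rightarrow> gate list) \<Rightarrow> nat \<Rightarrow> gate list" where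
  "chain q K r F ini ex n = (let B = bsize (K + r) K F in
     pad B (cgates ini) @
     concat (map (\<lambda>i. blk (q + (i + 1) * B) (copies (q + i * B + (B - K)) K @ ex i) (K + r) K F) [0..<n]))"

definition chain_len :: "nat \<Rightarrow> nat \<Rightarrow> (bool list \<Rightarrow> bool list) \<Rightarrow> nat \<Rightarrow> nat" where
  "chain_len K r F n = (n + 1) * bsize (K + r) K F"

definition chain_out :: "nat \<Rightarrow> nat \<Rightarrow> nat \<Rightarrow> (bool list \<Rightarrow> bool list) \<Rightarrow> nat \<Rightarrow> nat" where
  "chain_out q K r F n = q + n * bsize (K + r) K F + (bsize (K + r) K F - K)"

fun iter :: "('a list \<Rightarrow> 'a list) \<Rightarrow> 'a list \<Rightarrow> (nat \<Rightarrow> 'a list) \<Rightarrow> nat \<Rightarrow> 'a list" where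
  "iter F ini f 0 = ini"
| "iter F ini f (Suc i) = F (iter F ini f i @ f i)"

lemma length_cgates [simp]: "length (cgates bs) = length bs"
  by (simp add: cgates_def)

lemma length_chain:
  assumes "length ini = K" "\<And>i. i < n \<Longrightarrow> length (ex i) = r"
  shows "length (chain q K r F ini ex n) = chain_len K r F n"
proof -
  have "K \<le> bsize (K + r) K F" by (rule bsize_ge)
  moreover have "length (concat (map (\<lambda>i. blk (q + (i + 1) * bsize (K + r) K F)
      (copies (q + i * bsize (K + r) K F + (bsize (K + r) K F - K)) K @ ex i) (K + r) K F) [0..<n])) = n * bsize (K + r) K F"
    by (rule length_concat_const) (simp add: length_blk assms)
  ultimately show ?thesis by (simp add: chain_def chain_len_def Let_def length_pad assms)
qed

lemma pos_chain:
  fixes K r :: nat and F :: "bool list \<Rightarrow> bool list"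
  defines "B \<equiv> bsize (K + r) K F"
  assumes "length ini = K" "\<And>i. i < n \<Longrightarrow> length (ex i) = r"
  shows "pos P q (chain q K r F ini ex n) \<longleftrightarrow> pos P q (pad B (cgates ini)) \<and>
    (\<forall>i<n. pos P (q + (i + 1) * B) (blk (q + (i + 1) * B) (copies (q + i * B + (B - K)) K @ ex i) (K + r) K F))"
proof -
  have B: "K \<le> B" unfolding B_def by (rule bsize_ge)
  have l: "length (pad B (cgates ini)) = B" using B assms(2) by (simp add: length_pad)
  have c: "chain q K r F ini ex n = pad B (cgates ini) @
     concat (map (\<lambda>i. blk (q + (i + 1) * B) (copies (q + i * B + (B - K)) K @ ex i) (K + r) K F) [0..<n])"
    unfolding chain_def Let_def B_def ..
  have e: "q + B + i * B = q + (i + 1) * B" for i by simp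
  show ?thesis unfolding c pos_append l
    by (subst pos_concat[where B = B]) (auto simp: length_blk assms(3) B_def[symmetric] e)
qed

lemma wf_chain:
  assumes "length ini = K" "\<And>i. i < n \<Longrightarrow> length (ex i) = r"
    and "\<And>i q'. i < n \<Longrightarrow> q \<le> q' \<Longrightarrow> refs_ok q' (ex i)"
  shows "refs_ok q (chain q K r F ini ex n)"
proof -
  let ?B = "bsize (K + r) K F"
  have B: "K \<le> ?B" by (rule bsize_ge)
  have "refs_ok q (pad ?B (cgates ini))" by (rule wf_pad) (auto simp: cgates_def)
  moreover have "refs_ok (q + (i + 1) * ?B) (blk (q + (i + 1) * ?B) (copies (q + i * ?B + (?B - K)) K @ ex i) (K + r) K F)"
    if "i < n" for i
  proof (rule blk_wf)
    have "refs_ok (q + (i + 1) * ?B) (copies (q + i * ?B + (?B - K)) K)"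
      by (rule wf_copies) (use B in simp)
    moreover have "refs_ok (q + (i + 1) * ?B + K) (ex i)" by (rule assms(3)[OF that]) simp
    ultimately show "refs_ok (q + (i + 1) * ?B) (copies (q + i * ?B + (?B - K)) K @ ex i)" by simp
  qed (simp add: assms(2) that)
  ultimately show ?thesis by (subst pos_chain) (use assms(1,2) in auto)
qed

lemma chain_vals:
  assumes s: "sat inp V q (chain q K r F ini ex n)"
    and l: "length ini = K" "\<And>i. i < n \<Longrightarrow> length (ex i) = r"
    and F: "\<And>a b. length a = K \<Longrightarrow> length b = r \<Longrightarrow> length (F (a @ b)) = K"
  shows "vals V (chain_out q K r F n) K = iter F ini (\<lambda>i. map (gv inp V) (ex i)) n"
proof -
  let ?B = "bsize (K + r) K F" and ?f = "\<lambda>i. map (gv inp V) (ex i)"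
  have p: "sat inp V q (pad ?B (cgates ini))"
    "\<And>i. i < n \<Longrightarrow> sat inp V (q + (i + 1) * ?B) (blk (q + (i + 1) * ?B) (copies (q + i * ?B + (?B - K)) K @ ex i) (K + r) K F)"
    using s by (simp_all add: pos_chain[OF l])
  have len: "length (iter F ini ?f i) = K" if "i \<le> n" for i
    using that by (induction i) (auto simp: l F)
  have "i \<le> n \<Longrightarrow> vals V (q + i * ?B + (?B - K)) K = iter F ini ?f i" for i
  proof (induction i)
    case 0
    have "vals V (q + (?B - K)) K = map (gv inp V) (cgates ini)"
      by (rule pad_sat) (use p(1) l in simp_all)
    then show ?case by (simp add: gv_cgates)
  next
    case (Suc i)
    have "vals V (q + (i + 1) * ?B + (?B - K)) K =
        F (map (gv inp V) (copies (q + i * ?B + (?B - K)) K @ ex i))"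
    proof (rule blk_vals)
      show "sat inp V (q + (i + 1) * ?B) (blk (q + (i + 1) * ?B) (copies (q + i * ?B + (?B - K)) K @ ex i) (K + r) K F)"
        using p(2)[of i] Suc.prems by simp
    qed (use Suc.prems l F in auto)
    also have "\<dots> = iter F ini ?f (Suc i)" using Suc by (simp add: gv_copies)
    finally show ?case by simp
  qed
  then show ?thesis unfolding chain_out_def by blast
qed

section \<open>Index expressions\<close>

fun epow :: "exp \<Rightarrow> nat \<Rightarrow> exp" where
  "epow a 0 = EC 1"
| "epow a (Suc k) = Mul a (epow a k)"

lemma ev_epow [simp]: "ev (epow a k) e = ev a e ^ k"
  by (induction k) auto

definition ecopies :: "exp \<Rightarrow> nat \<Rightarrow> eg list" where
  "ecopies a K = map (\<lambda>l. EOr (Add a (EC l)) (Add a (EC l))) [0..<K]"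

lemma geg_ecopies: "map (geg x e) (ecopies a K) = copies (ev a e) K"
  by (simp add: ecopies_def copies_def)

lemma eg_ok_ecopies: "list_all (eg_ok x e) (ecopies a K)"
  by (simp add: ecopies_def list_all_iff)

definition epad :: "nat \<Rightarrow> eg list \<Rightarrow> cgen" where
  "epad B ls = CG (replicate (B - length ls) (EConst False) @ ls)"

lemma gl_epad: "gl (epad B ls) x e = pad B (map (geg x e) ls)"
  by (simp add: epad_def pad_def)

lemma cok_epad: "cok (epad B ls) x e = list_all (eg_ok x e) ls"
  by (auto simp: epad_def list_all_iff)

definition ebits :: "bool list \<Rightarrow> eg list" where
  "ebits bs = map EConst bs"

lemma geg_ebits: "map (geg x e) (ebits bs) = cgates bs"
  by (simp add: ebits_def cgates_def)

lemma eg_ok_ebits: "list_all (eg_ok x e) (ebits bs)"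
  by (simp add: ebits_def list_all_iff)

text \<open>Variable 0 holds the input length, variable 1 the side, variable 2 is the innermost loop variable.\<close>
definition echain :: "exp \<Rightarrow> nat \<Rightarrow> nat \<Rightarrow> (bool list \<Rightarrow> bool list) \<Rightarrow> bool list \<Rightarrow> eg list \<Rightarrow> exp \<Rightarrow> cgen" where
  "echain q K r F ini ex n = (let B = bsize (K + r) K F in
     CSeq (epad B (ebits ini))
       (CFor 2 n (eblk (Add q (Mul (Add (EV 2) (EC 1)) (EC B)))
          (ecopies (Add (Add q (Mul (EV 2) (EC B))) (EC (B - K))) K @ ex) (K + r) K F)))"

text \<open>The address q is evaluated inside the loop as well, so its value must not depend on the
  loop variable 2.\<close>

lemma gl_echain:
  assumes "\<And>i. ev q (e(2 := i)) = ev q e"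
  shows "gl (echain q K r F ini ex n) x e =
     chain (ev q e) K r F ini (\<lambda>i. map (geg x (e(2 := i))) ex) (ev n e)"
  by (simp add: echain_def chain_def Let_def gl_epad geg_ebits gl_eblk geg_ecopies assms)

lemma cok_echain:
  assumes "e 2 = 0" "\<And>i. i < ev n e \<Longrightarrow> list_all (eg_ok x (e(2 := i))) ex"
  shows "cok (echain q K r F ini ex n) x e"
  using assms by (simp add: echain_def Let_def cok_epad eg_ok_ebits cok_eblk eg_ok_ecopies)

definition ebitcell :: "tm \<Rightarrow> eg \<Rightarrow> cgen" where
  "ebitcell M g = epad (csize M) (g # replicate (cbits M - 1) (EConst False))"

lemma gl_ebitcell: "gl (ebitcell M g) x e = pad (csize M) (bitcell M (geg x e g))"
  by (simp add: ebitcell_def gl_epad bitcell_def)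

lemma cok_ebitcell: "cok (ebitcell M g) x e = eg_ok x e g"
  by (auto simp: ebitcell_def cok_epad list_all_iff)

text \<open>The input cells differ between the two machines, hence their generator
  \<open>bits\<close> is a parameter.\<close>

definition eca :: "tm \<Rightarrow> exp \<Rightarrow> cgen \<Rightarrow> exp \<Rightarrow> exp \<Rightarrow> cgen" where
  "eca M q bits L T = (let W = Add (Add L T) (EC 3); B = csize M; K = cbits M in
     CSeq (epad B (ebits (code M SWall)))
    (CSeq bits
    (CSeq (CFor 2 (Add T (EC 2)) (epad B (ebits (code M (Cell 0 None)))))
    (CSeq (epad B (ebits (code M Wall)))
       (CFor 2 (Mul (Add T (EC 1)) W)
         (eblk (Add q (Mul (Add (Add (EV 2) W) (EC 1)) (EC B)))
            (concat (map (\<lambda>d. ecopies (Add (Add q (Mul (Add (EV 2) (EC d)) (EC B))) (EC (B - K))) K) [0..<3]))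
            (3 * K) K (ca_rule M)))))))"

lemma concat_replicate_const: "concat (map (\<lambda>i. a) [0..<n]) = concat (replicate n a)"
  by (simp add: map_replicate_const)

lemma gl_eca:
  assumes q: "\<And>i. ev q (e(2 := i)) = ev q e" and LT: "\<And>i. ev L (e(2 := i)) = ev L e" "\<And>i. ev T (e(2 := i)) = ev T e"
    and b: "gl bits x e = concat (map (\<lambda>g. pad (csize M) (bitcell M g)) bgs)" "length bgs = ev L e"
  shows "gl (eca M q bits L T) x e = ca M (ev q e) bgs (ev T e)"
proof -
  have l: "concat (map (\<lambda>d. map (geg x e') (ecopies (Add (Add q (Mul (Add (EV 2) (EC d)) (EC (csize M)))) (EC (csize M - cbits M))) (cbits M))) [0..<3]) =
      caloads M (ev q e') (e' 2)" for e'
    by (simp add: caloads_def geg_ecopies)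
  show ?thesis
    unfolding eca_def ca_def Let_def inicells_def
    by (simp add: gl_epad geg_ebits gl_eblk l q LT b concat_replicate_const map_concat o_def del: replicate.simps add_2_eq_Suc add_2_eq_Suc' upt_Suc mult_Suc mult_Suc_right)
qed

lemma cok_eca:
  assumes "e 2 = 0" "cok bits x e"
  shows "cok (eca M q bits L T) x e"
proof -
  have "list_all (eg_ok x e') (concat (map (\<lambda>d. ecopies (Add (Add q (Mul (Add (EV 2) (EC d)) (EC (csize M)))) (EC (csize M - cbits M))) (cbits M)) [0..<3]))" for e'
    using eg_ok_ecopies unfolding list_all_iff by auto
  then show ?thesis using assms by (simp add: eca_def Let_def cok_epad eg_ok_ebits cok_eblk)
qed

section \<open>Comparison chains\<close>

lemma bin_val_append: "bin_val (xs @ ys) = bin_val xs + 2 ^ length xs * bin_val ys"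
  by (induction xs) (auto simp: algebra_simps)

lemma bin_val_replicate_False [simp]: "bin_val (replicate n False) = 0"
  by (induction n) auto

lemma bin_val_less: "bin_val xs < 2 ^ length xs"
  using bin_val_bij[of "length xs"] by (auto simp: bij_betw_def cube_def)

text \<open>The last bit is the most significant one. So a comparison can run upwards from the
  lowest bit with a single flag, which any later pair of different bits overrides.\<close>

lemma bin_val_snoc_less:
  assumes "length xs = length ys"
  shows "bin_val (xs @ [a]) < bin_val (ys @ [b]) \<longleftrightarrow> (if a = b then bin_val xs < bin_val ys else b)"
  using bin_val_less[of xs] bin_val_less[of ys] assms by (auto simp: bin_val_append)

definition or_step :: "bool list \<Rightarrow> bool list" where
  "or_step bs = [bs ! 0 \<or> bs ! 1]"

lemma iter_or: "iter or_step [False] (\<lambda>i. [f i]) n = [\<exists>i<n. f i]"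
  by (induction n) (auto simp: or_step_def less_Suc_eq)

definition le_step :: "bool list \<Rightarrow> bool list" where
  "le_step bs = [if bs ! 1 = bs ! 2 then bs ! 0 else bs ! 2]"

lemma iter_le:
  "iter le_step [True] (\<lambda>i. [f i, g i]) n = [bin_val (map f [0..<n]) \<le> bin_val (map g [0..<n])]"
proof (induction n)
  case (Suc n)
  have "bin_val (map f [0..<Suc n]) \<le> bin_val (map g [0..<Suc n]) \<longleftrightarrow>
      \<not> bin_val (map g [0..<n] @ [g n]) < bin_val (map f [0..<n] @ [f n])" by auto
  then show ?case using Suc
    by (subst (asm) bin_val_snoc_less) (auto simp: le_step_def)
qed simp

fun csym :: "cell \<Rightarrow> nat" where
  "csym (Cell a h) = a"
| "csym _ = 0"

text \<open>Input: a flag for the comparison so far, a flag telling that the output on the tape has not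
  ended yet, the code of the next cell, the next bit to be compared.\<close>
definition cmp_step :: "tm \<Rightarrow> bool list \<Rightarrow> bool list" where
  "cmp_step M bs = (let a = csym (dec M (take (cbits M) (drop 2 bs))); y = bs ! (2 + cbits M);
      alive = (bs ! 1 \<and> (a = 1 \<or> a = 2)); h = (alive \<and> a = 2) in
    [if y = h then bs ! 0 else h, alive])"

definition live :: "(nat \<Rightarrow> nat) \<Rightarrow> nat \<Rightarrow> bool" where
  "live t i \<longleftrightarrow> (\<forall>j<i. t j = 1 \<or> t j = 2)"

lemma cmp_step_code:
  "d \<in> cells M \<Longrightarrow> cmp_step M ([a, b] @ code M d @ [y]) =
     [if y = (b \<and> csym d = 2) then a else (b \<and> csym d = 2), b \<and> (csym d = 1 \<or> csym d = 2)]"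
  by (auto simp: cmp_step_def Let_def dec_code nth_append)

lemma iter_cmp:
  assumes "\<And>i. i < n \<Longrightarrow> cl i \<in> cells M \<and> csym (cl i) = t i"
  shows "iter (cmp_step M) [False, True] (\<lambda>i. code M (cl i) @ [y i]) n =
    [bin_val (map y [0..<n]) < bin_val (map (\<lambda>i. live t (Suc i) \<and> t i = 2) [0..<n]), live t n]"
  using assms
proof (induction n)
  case 0
  then show ?case by (simp add: live_def)
next
  case (Suc n)
  define h where "h i \<longleftrightarrow> live t (Suc i) \<and> t i = 2" for i
  have l: "live t (Suc n) \<longleftrightarrow> live t n \<and> (t n = 1 \<or> t n = 2)" by (auto simp: live_def less_Suc_eq)
  have c: "cl n \<in> cells M" "csym (cl n) = t n" using Suc.prems[of n] by auto
  have h: "h n \<longleftrightarrow> live t n \<and> t n = 2" by (auto simp: h_def l)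
  have "bin_val (map y [0..<Suc n]) < bin_val (map h [0..<Suc n]) \<longleftrightarrow>
      (if y n = h n then bin_val (map y [0..<n]) < bin_val (map h [0..<n]) else h n)"
    using bin_val_snoc_less[of "map y [0..<n]" "map h [0..<n]" "y n" "h n"] by simp
  moreover have IH: "iter (cmp_step M) [False, True] (\<lambda>i. code M (cl i) @ [y i]) n =
      [bin_val (map y [0..<n]) < bin_val (map h [0..<n]), live t n]"
    using Suc unfolding h_def by simp
  ultimately show ?case
    unfolding h_def[symmetric] iter.simps IH cmp_step_code[OF c(1)] c(2) l h by simp
qed

text \<open>From the first cell without a bit on, the output is continued by zeros, which does not
  change its value; the given m shows that such a cell exists in time.\<close>

lemma bin_val_live:
  assumes "t m \<noteq> 1" "t m \<noteq> 2" "m \<le> n"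
  shows "bin_val (map (\<lambda>i. live t (Suc i) \<and> t i = 2) [0..<n]) = bin_val (tape_out t)" "length (tape_out t) \<le> n"
proof -
  define L where "L = (LEAST k. t k \<noteq> 1 \<and> t k \<noteq> 2)"
  have L: "t L \<noteq> 1 \<and> t L \<noteq> 2" unfolding L_def by (rule LeastI[of _ m]) (use assms in auto)
  have "L \<le> m" unfolding L_def by (rule Least_le) (use assms in auto)
  then have Ln: "L \<le> n" using assms(3) by simp
  have lt: "t j = 1 \<or> t j = 2" if "j < L" for j using not_less_Least[of j] that unfolding L_def by blast
  have live: "live t (Suc i) \<longleftrightarrow> i < L" for i
  proof
    assume a: "live t (Suc i)"
    show "i < L"
    proof (rule ccontr)
      assume "\<not> i < L"
      then have "L < Suc i" by simp
      then show False using a L unfolding live_def by blast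
    qed
  next
    assume "i < L"
    then have "j < L" if "j < Suc i" for j using that by linarith
    then show "live t (Suc i)" using lt unfolding live_def by blast
  qed
  have out: "tape_out t = map (\<lambda>i. t i = 2) [0..<L]" unfolding tape_out_def L_def ..
  have "map (\<lambda>i. live t (Suc i) \<and> t i = 2) [0..<n] = tape_out t @ replicate (n - L) False"
    using Ln by (auto intro!: nth_equalityI simp: out live nth_append split: if_splits)
  then show "bin_val (map (\<lambda>i. live t (Suc i) \<and> t i = 2) [0..<n]) = bin_val (tape_out t)"
    by (simp add: bin_val_append)
  show "length (tape_out t) \<le> n" using Ln by (simp add: out)
qed

lemma tm_run_blank: "length x + n \<le> i \<Longrightarrow> snd (snd (tm_run M n x)) i = 0"
proof (induction n)
  case 0
  then show ?case by (simp add: tm_run_def tm_init_def)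
next
  case (Suc n)
  then have "snd (snd (tm_run M n x)) i = 0" "fst (snd (tm_run M n x)) \<noteq> i"
    using tm_run_head[of M n x] by auto
  then show ?case unfolding tm_run_Suc
    by (cases "tm_run M n x") (auto simp: tm_step_def split: prod.splits)
qed

lemma tm_run_ok:
  assumes "tm_wf M"
  shows "fst (tm_run M n x) < nstates M \<and> (\<forall>i. snd (snd (tm_run M n x)) i < nsyms M)"
proof (induction n)
  case 0
  then show ?case using assms by (auto simp: tm_run_def tm_init_def tm_wf_def)
next
  case (Suc n)
  obtain q h t where e: "tm_run M n x = (q, h, t)" by (cases "tm_run M n x")
  have "fst (delta M q (t h)) < nstates M \<and> fst (snd (delta M q (t h))) < nsyms M"
    using Suc assms unfolding tm_wf_def e by simp
  then show ?case using Suc unfolding tm_run_Suc e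
    by (auto simp: tm_step_def split: prod.splits)
qed

lemma ccell_in_cells: "tm_wf M \<Longrightarrow> ccell (tm_run M n x) i \<in> cells M"
  using tm_run_ok[of M n x] by (cases "tm_run M n x") (auto simp: Cell_in_cells)

lemma csym_ccell: "csym (ccell u i) = snd (snd u) i"
  by (cases u) auto

text \<open>Input: the selector bit, the code of the first cell of the verifier's tape, the two flags of the
  comparison with \<open>h\<close>, the disjunction of the padding bits.\<close>
definition sel_step :: "tm \<Rightarrow> bool list \<Rightarrow> bool list" where
  "sel_step M bs = [if bs ! 0 then \<not> bs ! (1 + cbits M)
     else csym (dec M (take (cbits M) (drop 1 bs))) = 2 \<and> \<not> bs ! (3 + cbits M)]"

text \<open>Input: the values of D at the two arguments, and the result of their numerical
  comparison.\<close>

definition fin_step :: "bool list \<Rightarrow> bool list" where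
  "fin_step bs = [bs ! 0 = bs ! 1 \<and> bs ! 2]"

section \<open>The reduction\<close>

text \<open>\<open>M1\<close> decides the witness relation within \<open>c1 * n ^ k1 + c1\<close> steps for witnesses of length
  \<open>c * n ^ k + c\<close>, and \<open>M2\<close> computes \<open>h\<close> within \<open>c2 * n ^ k2 + c2\<close> steps. The circuits have \<open>dimn\<close>
  variables per side: a selector bit, the witness, and padding.\<close>
locale reduction =
  fixes M1 M2 :: tm and c k c1 k1 c2 k2 :: nat
begin

definition mN :: "nat \<Rightarrow> nat" where "mN N = c * N ^ k + c"
definition T2N :: "nat \<Rightarrow> nat" where "T2N N = c2 * N ^ k2 + c2"
text \<open>The length of \<open>pair_enc x y\<close>: \<open>sd\<close> doubles x and adds a
  closing bit.\<close>

definition LN :: "nat \<Rightarrow> nat" where "LN N = 2 * N + 1 + mN N"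
definition T1N :: "nat \<Rightarrow> nat" where "T1N N = c1 * LN N ^ k1 + c1"
text \<open>\<open>T2N\<close> steps suffice for \<open>M2\<close>. Running it for \<open>mN\<close>
  more steps changes nothing after the halt, and gives its diagram exactly \<open>nN\<close> tape
  cells (\<open>nN_alt\<close>), one for each bit of the number compared with h.\<close>

definition TgN :: "nat \<Rightarrow> nat" where "TgN N = mN N + T2N N"
definition zN :: "nat \<Rightarrow> nat" where "zN N = N + T2N N + 2"
definition nN :: "nat \<Rightarrow> nat" where "nN N = mN N + zN N"
definition dimn :: "nat \<Rightarrow> nat" where "dimn N = nN N + 1"

definition zA :: "nat \<Rightarrow> nat" where "zA N = ca_len M1 (LN N) (T1N N)"
definition zB :: "nat \<Rightarrow> nat" where "zB N = ca_len M2 N (TgN N)"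
definition zC :: "nat \<Rightarrow> nat" where "zC N = chain_len 2 (cbits M2 + 1) (cmp_step M2) (nN N)"
definition zZ :: "nat \<Rightarrow> nat" where "zZ N = chain_len 1 1 or_step (zN N)"
definition zD :: nat where "zD = bsize (4 + cbits M1) 1 (sel_step M1)"
definition zS :: "nat \<Rightarrow> nat" where "zS N = zA N + zB N + zC N + zZ N + zD"

text \<open>The bits of \<open>pair_enc x y\<close> with x hard-wired; the witness bits are inputs
  of side v, and the offset 1 skips the selector bit.\<close>

definition bgs1 :: "bits \<Rightarrow> nat \<Rightarrow> gate list" where
  "bgs1 x v = concat (map (\<lambda>i. [GConst True, GConst (x ! i)]) [0..<length x]) @ [GConst False] @
     map (\<lambda>i. GIn (v * dimn (length x) + 1 + i)) [0..<mN (length x)]"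

definition bgs2 :: "bits \<Rightarrow> gate list" where
  "bgs2 x = map (\<lambda>i. GConst (x ! i)) [0..<length x]"

definition exC :: "nat \<Rightarrow> nat \<Rightarrow> nat \<Rightarrow> nat \<Rightarrow> gate list" where
  "exC N q v i = copies (ca_out M2 (q + zA N) N (TgN N) i) (cbits M2) @ [GIn (v * dimn N + 1 + i)]"

definition exZ :: "nat \<Rightarrow> nat \<Rightarrow> nat \<Rightarrow> gate list" where
  "exZ N v i = [GIn (v * dimn N + 1 + mN N + i)]"

definition lsD :: "nat \<Rightarrow> nat \<Rightarrow> nat \<Rightarrow> gate list" where
  "lsD N q v = [GIn (v * dimn N)] @ copies (ca_out M1 q (LN N) (T1N N) 0) (cbits M1) @
     copies (chain_out (q + zA N + zB N) 2 (cbits M2 + 1) (cmp_step M2) (nN N)) 2 @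
     copies (chain_out (q + zA N + zB N + zC N) 1 1 or_step (zN N)) 1"

definition side :: "bits \<Rightarrow> nat \<Rightarrow> nat \<Rightarrow> gate list" where
  "side x q v = (let N = length x in
     ca M1 q (bgs1 x v) (T1N N) @
     ca M2 (q + zA N) (bgs2 x) (TgN N) @
     chain (q + zA N + zB N) 2 (cbits M2 + 1) (cmp_step M2) [False, True] (exC N q v) (nN N) @
     chain (q + zA N + zB N + zC N) 1 1 or_step [False] (exZ N v) (zN N) @
     blk (q + zA N + zB N + zC N + zZ N) (lsD N q v) (4 + cbits M1) 1 (sel_step M1))"

definition outD :: "nat \<Rightarrow> nat \<Rightarrow> nat" where
  "outD N q = q + zA N + zB N + zC N + zZ N + (zD - 1)"

text \<open>Copy 0 of \<open>side\<close> evaluates D at the first argument, copy 1 at the second;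
  then come their comparison and the final conjunction.\<close>

definition whole :: "bits \<Rightarrow> gate list" where
  "whole x = (let N = length x; n = dimn N; p = 2 * zS N in
     concat (map (\<lambda>v. side x (v * zS N) v) [0..<2]) @
     chain p 1 2 le_step [True] (\<lambda>i. [GIn i, GIn (n + i)]) n @
     blk (p + chain_len 1 2 le_step n)
       (copies (outD N 0) 1 @ copies (outD N (zS N)) 1 @ copies (chain_out p 1 2 le_step n) 1) 3 1 fin_step)"

lemma length_bgs1: "length (bgs1 x v) = LN (length x)"
proof -
  have "length (concat (map (\<lambda>i. [GConst True, GConst (x ! i)]) [0..<length x])) = length x * 2"
    by (rule length_concat_const) simp
  then show ?thesis by (simp add: bgs1_def LN_def)
qed

lemma length_bgs2: "length (bgs2 x) = length x"
  by (simp add: bgs2_def)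

lemma length_side: "length (side x q v) = zS (length x)"
proof -
  have "length (lsD (length x) q v) = 4 + cbits M1" by (simp add: lsD_def)
  then show ?thesis
    by (simp add: side_def Let_def length_ca length_bgs1 length_bgs2 length_chain exC_def exZ_def length_blk
        zS_def zA_def zB_def zC_def zZ_def zD_def)
qed

lemma pos_side:
  "pos P q (side x q v) \<longleftrightarrow> (let N = length x in
     pos P q (ca M1 q (bgs1 x v) (T1N N)) \<and>
     pos P (q + zA N) (ca M2 (q + zA N) (bgs2 x) (TgN N)) \<and>
     pos P (q + zA N + zB N) (chain (q + zA N + zB N) 2 (cbits M2 + 1) (cmp_step M2) [False, True] (exC N q v) (nN N)) \<and>
     pos P (q + zA N + zB N + zC N) (chain (q + zA N + zB N + zC N) 1 1 or_step [False] (exZ N v) (zN N)) \<and>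
     pos P (q + zA N + zB N + zC N + zZ N) (blk (q + zA N + zB N + zC N + zZ N) (lsD N q v) (4 + cbits M1) 1 (sel_step M1)))"
proof -
  let ?N = "length x"
  have l: "length (ca M1 q (bgs1 x v) (T1N ?N)) = zA ?N" "length (ca M2 (q + zA ?N) (bgs2 x) (TgN ?N)) = zB ?N"
    by (simp_all add: length_ca length_bgs1 length_bgs2 zA_def zB_def)
  have c: "length (chain (q + zA ?N + zB ?N) 2 (cbits M2 + 1) (cmp_step M2) [False, True] (exC ?N q v) (nN ?N)) = zC ?N"
    unfolding zC_def by (rule length_chain) (auto simp: exC_def)
  have z: "length (chain (q + zA ?N + zB ?N + zC ?N) 1 1 or_step [False] (exZ ?N v) (zN ?N)) = zZ ?N"
    unfolding zZ_def by (rule length_chain) (auto simp: exZ_def)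
  show ?thesis unfolding side_def Let_def pos_append l c z ..
qed

lemma ca_out_bound:
  assumes "i < L + T + 2"
  shows "ca_out M q L T i + cbits M \<le> q + ca_len M L T"
proof -
  have "ca_out M q L T i + cbits M = q + ((T + 1) * (L + T + 3) + i + 2) * csize M"
  proof -
    obtain d where "csize M = cbits M + d" using csize_ge le_Suc_ex by blast
    then show ?thesis by (simp add: ca_out_def algebra_simps)
  qed
  also have "\<dots> \<le> q + ((L + T + 3) + 1 + (T + 1) * (L + T + 3)) * csize M"
    using assms by (intro add_left_mono mult_right_mono) auto
  finally show ?thesis unfolding ca_len_def Let_def .
qed

lemma chain_out_bound: "chain_out q K r F n + K \<le> q + chain_len K r F n"
  using bsize_ge[of K "K + r" F] by (simp add: chain_out_def chain_len_def)

lemma nN_alt: "nN N = N + TgN N + 2"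
  by (simp add: nN_def zN_def TgN_def)

lemma wf_side: "refs_ok q (side x q v)"
  unfolding pos_side Let_def
proof (intro conjI)
  let ?N = "length x"
  show "refs_ok q (ca M1 q (bgs1 x v) (T1N ?N))" by (rule wf_ca) (auto simp: bgs1_def split: if_splits)
  show "refs_ok (q + zA ?N) (ca M2 (q + zA ?N) (bgs2 x) (TgN ?N))" by (rule wf_ca) (auto simp: bgs2_def)
  show "refs_ok (q + zA ?N + zB ?N) (chain (q + zA ?N + zB ?N) 2 (cbits M2 + 1) (cmp_step M2) [False, True] (exC ?N q v) (nN ?N))"
  proof (rule wf_chain)
    fix i q' assume i: "i < nN ?N" and q': "q + zA ?N + zB ?N \<le> q'"
    have "ca_out M2 (q + zA ?N) ?N (TgN ?N) i + cbits M2 \<le> q + zA ?N + zB ?N"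
      unfolding zB_def by (rule ca_out_bound) (use i nN_alt in simp)
    then show "refs_ok q' (exC ?N q v i)" unfolding exC_def using q' by (simp add: wf_copies)
  qed (auto simp: exC_def)
  show "refs_ok (q + zA ?N + zB ?N + zC ?N) (chain (q + zA ?N + zB ?N + zC ?N) 1 1 or_step [False] (exZ ?N v) (zN ?N))"
    by (rule wf_chain) (auto simp: exZ_def)
  show "refs_ok (q + zA ?N + zB ?N + zC ?N + zZ ?N)
     (blk (q + zA ?N + zB ?N + zC ?N + zZ ?N) (lsD ?N q v) (4 + cbits M1) 1 (sel_step M1))"
  proof (rule blk_wf)
    have "ca_out M1 q (LN ?N) (T1N ?N) 0 + cbits M1 \<le> q + zA ?N"
      unfolding zA_def by (rule ca_out_bound) simp
    moreover have "chain_out (q + zA ?N + zB ?N) 2 (cbits M2 + 1) (cmp_step M2) (nN ?N) + 2 \<le> q + zA ?N + zB ?N + zC ?N"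
      unfolding zC_def by (rule chain_out_bound)
    moreover have "chain_out (q + zA ?N + zB ?N + zC ?N) 1 1 or_step (zN ?N) + 1 \<le> q + zA ?N + zB ?N + zC ?N + zZ ?N"
      unfolding zZ_def by (rule chain_out_bound)
    ultimately show "refs_ok (q + zA ?N + zB ?N + zC ?N + zZ ?N) (lsD ?N q v)"
      unfolding lsD_def by (simp add: wf_copies)
  qed (simp add: lsD_def)
qed

lemma length_whole:
  "length (whole x) = 2 * zS (length x) + chain_len 1 2 le_step (dimn (length x)) + bsize 3 1 fin_step"
proof -
  have "length (concat (map (\<lambda>v. side x (v * zS (length x)) v) [0..<2])) = 2 * zS (length x)"
    by (rule length_concat_const) (rule length_side)
  then show ?thesis by (simp add: whole_def Let_def length_chain length_blk)
qed

lemma pos_whole: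
  "pos P 0 (whole x) \<longleftrightarrow> (let N = length x; n = dimn N; p = 2 * zS N in
     pos P 0 (side x 0 0) \<and> pos P (zS N) (side x (zS N) 1) \<and>
     pos P p (chain p 1 2 le_step [True] (\<lambda>i. [GIn i, GIn (n + i)]) n) \<and>
     pos P (p + chain_len 1 2 le_step n) (blk (p + chain_len 1 2 le_step n)
       (copies (outD N 0) 1 @ copies (outD N (zS N)) 1 @ copies (chain_out p 1 2 le_step n) 1) 3 1 fin_step))"
  unfolding whole_def Let_def by (simp add: length_side length_chain numeral_2_eq_2)

lemma outD_less: "outD N q < q + zS N"
  using bsize_ge[of 1 "4 + cbits M1" "sel_step M1"] by (simp add: outD_def zS_def zD_def)

lemma wf_whole: "refs_ok 0 (whole x)"
  unfolding pos_whole Let_def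
proof (intro conjI)
  let ?N = "length x"
  show "refs_ok 0 (side x 0 0)" "refs_ok (zS ?N) (side x (zS ?N) 1)" by (rule wf_side)+
  show "refs_ok (2 * zS ?N) (chain (2 * zS ?N) 1 2 le_step [True] (\<lambda>i. [GIn i, GIn (dimn ?N + i)]) (dimn ?N))"
    by (rule wf_chain) auto
  show "refs_ok (2 * zS ?N + chain_len 1 2 le_step (dimn ?N)) (blk (2 * zS ?N + chain_len 1 2 le_step (dimn ?N))
       (copies (outD ?N 0) 1 @ copies (outD ?N (zS ?N)) 1 @ copies (chain_out (2 * zS ?N) 1 2 le_step (dimn ?N)) 1) 3 1 fin_step)"
  proof (rule blk_wf)
    show "refs_ok (2 * zS ?N + chain_len 1 2 le_step (dimn ?N))
      (copies (outD ?N 0) 1 @ copies (outD ?N (zS ?N)) 1 @ copies (chain_out (2 * zS ?N) 1 2 le_step (dimn ?N)) 1)"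
      using outD_less[of ?N 0] outD_less[of ?N "zS ?N"] chain_out_bound[of "2 * zS ?N" 1 2 le_step "dimn ?N"]
      by (simp add: wf_copies)
  qed simp
qed

lemma side_value:
  assumes M: "tm_wf M1" "tm_wf M2" and s: "sat inp V q (side x q v)"
  defines "N \<equiv> length x"
  defines "y \<equiv> map (\<lambda>i. inp (v * dimn N + 1 + i)) [0..<nN N]"
  shows "V (outD N q) \<longleftrightarrow> (if inp (v * dimn N)
      then bin_val (tape_out (snd (snd (tm_run M2 (TgN N) x)))) \<le> bin_val y
      else snd (snd (tm_run M1 (T1N N) (pair_enc x (take (mN N) y)))) 0 = 2 \<and> \<not> list_ex id (drop (mN N) y))"
    and "length (tape_out (snd (snd (tm_run M2 (TgN N) x)))) \<le> nN N"
proof -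
  define u1 where "u1 = tm_run M1 (T1N N) (pair_enc x (take (mN N) y))"
  define u2 where "u2 = tm_run M2 (TgN N) x"
  define t where "t = snd (snd u2)"
  have pA: "sat inp V q (ca M1 q (bgs1 x v) (T1N N))"
    and pB: "sat inp V (q + zA N) (ca M2 (q + zA N) (bgs2 x) (TgN N))"
    and pC: "sat inp V (q + zA N + zB N) (chain (q + zA N + zB N) 2 (cbits M2 + 1) (cmp_step M2) [False, True] (exC N q v) (nN N))"
    and pZ: "sat inp V (q + zA N + zB N + zC N) (chain (q + zA N + zB N + zC N) 1 1 or_step [False] (exZ N v) (zN N))"
    and pD: "sat inp V (q + zA N + zB N + zC N + zZ N) (blk (q + zA N + zB N + zC N + zZ N) (lsD N q v) (4 + cbits M1) 1 (sel_step M1))"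
    using s unfolding pos_side Let_def N_def by blast+
  have "concat (map (\<lambda>i. [True, x ! i]) [0..<length x]) = concat (map (\<lambda>b. [True, b]) x)"
    by (rule arg_cong[of _ _ concat]) (auto intro!: nth_equalityI)
  then have b1: "map (gv inp V) (bgs1 x v) = pair_enc x (take (mN N) y)"
    by (simp add: bgs1_def pair_enc_def sd_def map_concat o_def N_def y_def take_map nN_def)
  have b2: "map (gv inp V) (bgs2 x) = x"
    by (simp add: bgs2_def o_def map_nth)
  have A: "vals V (ca_out M1 q (LN N) (T1N N) 0) (cbits M1) = code M1 (ccell u1 0)"
    using ca_simulates[OF M(1) pA, of 0] unfolding b1 length_bgs1 u1_def N_def by simp
  have B: "vals V (ca_out M2 (q + zA N) N (TgN N) i) (cbits M2) = code M2 (ccell u2 i)" if "i < nN N" for i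
    using ca_simulates[OF M(2) pB, of i] that
    unfolding b2 length_bgs2 u2_def N_def nN_alt by simp
  \<comment> \<open>This blank is the cell at which, for \<open>bin_val_live\<close>, the output has
    ended.\<close>
  have blank: "t (N + TgN N) = 0" unfolding t_def u2_def N_def by (rule tm_run_blank) simp
  have le: "N + TgN N \<le> nN N" by (simp add: nN_alt)
  have live: "bin_val (map (\<lambda>i. live t (Suc i) \<and> t i = 2) [0..<nN N]) = bin_val (tape_out t)"
    "length (tape_out t) \<le> nN N"
    using bin_val_live[of t "N + TgN N" "nN N"] blank le by auto
  then show "length (tape_out (snd (snd (tm_run M2 (TgN N) x)))) \<le> nN N" unfolding t_def u2_def by simp
  define f where "f i = code M2 (ccell u2 i) @ [inp (v * dimn N + 1 + i)]" for i
  have exC: "map (gv inp V) (exC N q v i) = f i" if "i < nN N" for i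
    unfolding exC_def map_append gv_copies B[OF that] f_def by simp
  have "vals V (chain_out (q + zA N + zB N) 2 (cbits M2 + 1) (cmp_step M2) (nN N)) 2 =
      iter (cmp_step M2) [False, True] (\<lambda>i. map (gv inp V) (exC N q v i)) (nN N)"
    by (rule chain_vals[OF pC]) (auto simp: exC_def cmp_step_def Let_def)
  \<comment> \<open>The loads are known only for i < \<open>nN N\<close>, hence the replacement
    proceeds by induction on the rounds.\<close>
  also have "\<dots> = iter (cmp_step M2) [False, True] f (nN N)"
  proof -
    have "i \<le> nN N \<Longrightarrow> iter (cmp_step M2) [False, True] (\<lambda>i. map (gv inp V) (exC N q v i)) i = iter (cmp_step M2) [False, True] f i" for i
      by (induction i) (auto simp: exC)
    then show ?thesis by simp
  qed
  also have "\<dots> = [bin_val y < bin_val (tape_out t), live t (nN N)]"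
    unfolding f_def y_def live(1)[symmetric]
    by (rule iter_cmp) (auto simp: u2_def t_def csym_ccell ccell_in_cells M)
  finally have C: "vals V (chain_out (q + zA N + zB N) 2 (cbits M2 + 1) (cmp_step M2) (nN N)) 2 =
      [bin_val y < bin_val (tape_out t), live t (nN N)]" .
  have "vals V (chain_out (q + zA N + zB N + zC N) 1 1 or_step (zN N)) 1 =
      iter or_step [False] (\<lambda>i. map (gv inp V) (exZ N v i)) (zN N)"
    by (rule chain_vals[OF pZ]) (auto simp: exZ_def or_step_def)
  also have "\<dots> = [\<exists>i<zN N. inp (v * dimn N + 1 + mN N + i)]"
    unfolding iter_or[symmetric] by (simp add: exZ_def)
  also have "\<dots> = [list_ex id (drop (mN N) y)]"
  proof -
    have "drop (mN N) y = map (\<lambda>i. inp (v * dimn N + 1 + mN N + i)) [0..<zN N]"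
      by (auto intro!: nth_equalityI simp: y_def nN_def add.assoc)
    then show ?thesis by (auto simp: list_ex_iff)
  qed
  finally have Z: "vals V (chain_out (q + zA N + zB N + zC N) 1 1 or_step (zN N)) 1 = [list_ex id (drop (mN N) y)]" .
  have ls: "map (gv inp V) (lsD N q v) = inp (v * dimn N) # code M1 (ccell u1 0) @
      [bin_val y < bin_val (tape_out t), live t (nN N), list_ex id (drop (mN N) y)]"
    unfolding lsD_def map_append gv_copies A C Z by simp
  have "V (q + zA N + zB N + zC N + zZ N + (bsize (4 + cbits M1) 1 (sel_step M1) - 1) + 0) =
      sel_step M1 (map (gv inp V) (lsD N q v)) ! 0"
    by (rule blk_sat[OF pD]) (auto simp: lsD_def)
  then have "V (outD N q) = sel_step M1 (map (gv inp V) (lsD N q v)) ! 0"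
    by (simp add: outD_def zD_def)
  also have "\<dots> \<longleftrightarrow> (if inp (v * dimn N) then \<not> bin_val y < bin_val (tape_out t)
      else snd (snd u1) 0 = 2 \<and> \<not> list_ex id (drop (mN N) y))"
    unfolding ls sel_step_def
    by (simp add: nth_append dec_code u1_def ccell_in_cells M csym_ccell)
  finally show "V (outD N q) \<longleftrightarrow> (if inp (v * dimn N)
      then bin_val (tape_out (snd (snd (tm_run M2 (TgN N) x)))) \<le> bin_val y
      else snd (snd (tm_run M1 (T1N N) (pair_enc x (take (mN N) y)))) 0 = 2 \<and> \<not> list_ex id (drop (mN N) y))"
    unfolding t_def u1_def u2_def by (simp add: not_less)
qed

definition sel :: "bits \<Rightarrow> bits \<Rightarrow> bool" where
  "sel x w = (let N = length x; y = tl w in if hd w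
      then bin_val (tape_out (snd (snd (tm_run M2 (TgN N) x)))) \<le> bin_val y
      else snd (snd (tm_run M1 (T1N N) (pair_enc x (take (mN N) y)))) 0 = 2 \<and> \<not> list_ex id (drop (mN N) y))"

lemma circ_eval_whole:
  assumes M: "tm_wf M1" "tm_wf M2" and yz: "y \<in> cube (dimn (length x))" "z \<in> cube (dimn (length x))"
  shows "circ_eval (Circuit (dimn (length x)) (whole x)) y z \<longleftrightarrow> (sel x y \<longleftrightarrow> sel x z) \<and> bin_val y \<le> bin_val z"
proof -
  let ?N = "length x"
  let ?n = "dimn ?N" and ?p = "2 * zS ?N"
  have len: "length y = ?n" "length z = ?n" using yz by (auto simp: cube_def)
  have b1: "bsize 3 1 fin_step > 0" by (simp add: bsize_def)
  have ne: "whole x \<noteq> []" using length_whole[of x] b1 by (metis add_gr_0 length_greater_0_conv)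
  obtain V where s: "sat (\<lambda>i. i < 2 * ?n \<and> (y @ z) ! i) V 0 (whole x)"
    and out: "circ_eval (Circuit ?n (whole x)) y z = V (length (whole x) - 1)"
    by (rule circ_eval_sat[OF wf_whole ne len])
  define inp where "inp i \<longleftrightarrow> i < 2 * ?n \<and> (y @ z) ! i" for i
  have p0: "sat inp V 0 (side x 0 0)" and p1: "sat inp V (zS ?N) (side x (zS ?N) 1)"
    and pL: "sat inp V ?p (chain ?p 1 2 le_step [True] (\<lambda>i. [GIn i, GIn (?n + i)]) ?n)"
    and pF: "sat inp V (?p + chain_len 1 2 le_step ?n) (blk (?p + chain_len 1 2 le_step ?n)
       (copies (outD ?N 0) 1 @ copies (outD ?N (zS ?N)) 1 @ copies (chain_out ?p 1 2 le_step ?n) 1) 3 1 fin_step)"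
    using s[folded inp_def] unfolding pos_whole Let_def by blast+
  have iy: "inp i = y ! i" if "i < ?n" for i using that len by (simp add: inp_def nth_append)
  have iz: "inp (?n + i) = z ! i" if "i < ?n" for i using that len by (simp add: inp_def nth_append)
  have hd_tl: "hd w = w ! 0" "tl w = map (\<lambda>i. w ! (1 + i)) [0..<nN ?N]" if "length w = ?n" for w
    using that by (cases w; auto simp: dimn_def intro!: nth_equalityI)+
  have y: "map (\<lambda>i. inp (0 * ?n + 1 + i)) [0..<nN ?N] = tl y" "inp (0 * ?n) = hd y"
    unfolding hd_tl[OF len(1)] by (auto simp: iy dimn_def)
  have z: "map (\<lambda>i. inp (1 * ?n + 1 + i)) [0..<nN ?N] = tl z" "inp (1 * ?n) = hd z"
    unfolding hd_tl[OF len(2)] using iz[of "1 + _"] iz[of 0] by (auto simp: dimn_def)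
  have 0: "V (outD ?N 0) = sel x y"
    using side_value(1)[OF M p0] unfolding y sel_def Let_def by blast
  have 1: "V (outD ?N (zS ?N)) = sel x z"
    using side_value(1)[OF M p1] unfolding z sel_def Let_def by blast
  have "vals V (chain_out ?p 1 2 le_step ?n) 1 = iter le_step [True] (\<lambda>i. map (gv inp V) [GIn i, GIn (?n + i)]) ?n"
    by (rule chain_vals[OF pL]) (auto simp: le_step_def)
  also have "\<dots> = [bin_val (map inp [0..<?n]) \<le> bin_val (map (\<lambda>i. inp (?n + i)) [0..<?n])]"
    unfolding iter_le[symmetric] by simp
  also have "map inp [0..<?n] = y" using len iy by (auto intro: nth_equalityI)
  also have "map (\<lambda>i. inp (?n + i)) [0..<?n] = z" using len iz by (auto intro: nth_equalityI)
  finally have 2: "vals V (chain_out ?p 1 2 le_step ?n) 1 = [bin_val y \<le> bin_val z]" .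
  have c1: "vals V a 1 = [V a]" for a by (simp add: vals_def)
  let ?ls = "copies (outD ?N 0) 1 @ copies (outD ?N (zS ?N)) 1 @ copies (chain_out ?p 1 2 le_step ?n) 1"
  have "V (?p + chain_len 1 2 le_step ?n + (bsize 3 1 fin_step - 1) + 0) = fin_step (map (gv inp V) ?ls) ! 0"
    by (rule blk_sat[OF pF]) auto
  also have "map (gv inp V) ?ls = [sel x y, sel x z, bin_val y \<le> bin_val z]"
    unfolding map_append gv_copies 2 unfolding c1 0 1 by simp
  also have "fin_step [sel x y, sel x z, bin_val y \<le> bin_val z] = [(sel x y = sel x z) \<and> bin_val y \<le> bin_val z]"
    by (simp add: fin_step_def)
  finally have "V (length (whole x) - 1) \<longleftrightarrow> (sel x y = sel x z) \<and> bin_val y \<le> bin_val z"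
    using b1 by (simp add: length_whole)
  then show ?thesis using out by blast
qed

end

section \<open>Generators for the circuits of the reduction\<close>

definition eca_len :: "tm \<Rightarrow> exp \<Rightarrow> exp \<Rightarrow> exp" where
  "eca_len M L T = (let W = Add (Add L T) (EC 3) in
     Mul (Add (Add W (EC 1)) (Mul (Add T (EC 1)) W)) (EC (csize M)))"

lemma ev_eca_len [simp]: "ev (eca_len M L T) e = ca_len M (ev L e) (ev T e)"
  by (simp only: eca_len_def ca_len_def Let_def ev.simps)

definition eca_out :: "tm \<Rightarrow> exp \<Rightarrow> exp \<Rightarrow> exp \<Rightarrow> exp \<Rightarrow> exp" where
  "eca_out M q L T i = Add (Add q (Mul (Add (Add (Mul (Add T (EC 1)) (Add (Add L T) (EC 3))) i) (EC 1)) (EC (csize M))))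
     (EC (csize M - cbits M))"

lemma ev_eca_out [simp]: "ev (eca_out M q L T i) e = ca_out M (ev q e) (ev L e) (ev T e) (ev i e)"
  by (simp add: eca_out_def ca_out_def)

definition echain_len :: "nat \<Rightarrow> nat \<Rightarrow> (bool list \<Rightarrow> bool list) \<Rightarrow> exp \<Rightarrow> exp" where
  "echain_len K r F n = Mul (Add n (EC 1)) (EC (bsize (K + r) K F))"

lemma ev_echain_len [simp]: "ev (echain_len K r F n) e = chain_len K r F (ev n e)"
  by (simp add: echain_len_def chain_len_def)

definition echain_out :: "exp \<Rightarrow> nat \<Rightarrow> nat \<Rightarrow> (bool list \<Rightarrow> bool list) \<Rightarrow> exp \<Rightarrow> exp" where
  "echain_out q K r F n = Add (Add q (Mul n (EC (bsize (K + r) K F)))) (EC (bsize (K + r) K F - K))"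

lemma ev_echain_out [simp]: "ev (echain_out q K r F n) e = chain_out (ev q e) K r F (ev n e)"
  by (simp add: echain_out_def chain_out_def)

context reduction
begin

definition eM :: exp where "eM = Add (Mul (EC c) (epow (EV 0) k)) (EC c)"
definition eT2 :: exp where "eT2 = Add (Mul (EC c2) (epow (EV 0) k2)) (EC c2)"
definition eL :: exp where "eL = Add (Add (Mul (EC 2) (EV 0)) (EC 1)) eM"
definition eT1 :: exp where "eT1 = Add (Mul (EC c1) (epow eL k1)) (EC c1)"
definition eTg :: exp where "eTg = Add eM eT2"
definition ez :: exp where "ez = Add (Add (EV 0) eT2) (EC 2)"
definition en :: exp where "en = Add eM ez"
definition ed :: exp where "ed = Add en (EC 1)"
definition ezA :: exp where "ezA = eca_len M1 eL eT1"
definition ezB :: exp where "ezB = eca_len M2 (EV 0) eTg"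
definition ezC :: exp where "ezC = echain_len 2 (cbits M2 + 1) (cmp_step M2) en"
definition ezZ :: exp where "ezZ = echain_len 1 1 or_step ez"
definition ezS :: exp where "ezS = Add (Add (Add (Add ezA ezB) ezC) ezZ) (EC zD)"

lemma ev_sizes [simp]:
  "ev eM e = mN (e 0)" "ev eT2 e = T2N (e 0)" "ev eL e = LN (e 0)" "ev eT1 e = T1N (e 0)" "ev eTg e = TgN (e 0)"
  "ev ez e = zN (e 0)" "ev en e = nN (e 0)" "ev ed e = dimn (e 0)" "ev ezA e = zA (e 0)" "ev ezB e = zB (e 0)"
  "ev ezC e = zC (e 0)" "ev ezZ e = zZ (e 0)" "ev ezS e = zS (e 0)"
  by (simp_all add: eM_def mN_def eT2_def T2N_def eL_def LN_def eT1_def T1N_def eTg_def TgN_def ez_def zN_def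
      en_def nN_def ed_def dimn_def ezA_def zA_def ezB_def zB_def ezC_def zC_def ezZ_def zZ_def ezS_def zS_def)

definition ebits1 :: cgen where
  "ebits1 = CSeq (CFor 2 (EV 0) (CSeq (ebitcell M1 (EConst True)) (ebitcell M1 (EBit (EV 2)))))
     (CSeq (ebitcell M1 (EConst False)) (CFor 2 eM (ebitcell M1 (EIn (Add (Add (Mul (EV 1) ed) (EC 1)) (EV 2))))))"

definition ebits2 :: cgen where
  "ebits2 = CFor 2 (EV 0) (ebitcell M2 (EBit (EV 2)))"

text \<open>The side enters through variable 1, so one loop over the values 0 and 1 prints both
  copies.\<close>

definition eside :: "exp \<Rightarrow> cgen" where
  "eside q = CSeq (eca M1 q ebits1 eL eT1)
    (CSeq (eca M2 (Add q ezA) ebits2 (EV 0) eTg)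
    (CSeq (echain (Add (Add q ezA) ezB) 2 (cbits M2 + 1) (cmp_step M2) [False, True]
       (ecopies (eca_out M2 (Add q ezA) (EV 0) eTg (EV 2)) (cbits M2) @ [EIn (Add (Add (Mul (EV 1) ed) (EC 1)) (EV 2))]) en)
    (CSeq (echain (Add (Add (Add q ezA) ezB) ezC) 1 1 or_step [False]
       [EIn (Add (Add (Add (Mul (EV 1) ed) (EC 1)) eM) (EV 2))] ez)
    (eblk (Add (Add (Add (Add q ezA) ezB) ezC) ezZ)
       ([EIn (Mul (EV 1) ed)] @ ecopies (eca_out M1 q eL eT1 (EC 0)) (cbits M1) @
        ecopies (echain_out (Add (Add q ezA) ezB) 2 (cbits M2 + 1) (cmp_step M2) en) 2 @
        ecopies (echain_out (Add (Add (Add q ezA) ezB) ezC) 1 1 or_step ez) 1)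
       (4 + cbits M1) 1 (sel_step M1)))))"

definition eoutD :: "exp \<Rightarrow> exp" where
  "eoutD q = Add (Add (Add (Add (Add q ezA) ezB) ezC) ezZ) (EC (zD - 1))"

lemma ev_eoutD [simp]: "ev (eoutD q) e = outD (e 0) (ev q e)"
  by (simp add: eoutD_def outD_def)

definition ewhole :: cgen where
  "ewhole = (let p = Mul (EC 2) ezS in
    CSeq (CFor 1 (EC 2) (eside (Mul (EV 1) ezS)))
   (CSeq (echain p 1 2 le_step [True] [EIn (EV 2), EIn (Add ed (EV 2))] ed)
    (eblk (Add p (echain_len 1 2 le_step ed))
       (ecopies (eoutD (EC 0)) 1 @ ecopies (eoutD ezS) 1 @ ecopies (echain_out p 1 2 le_step ed) 1) 3 1 fin_step)))"

definition elen :: exp where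
  "elen = Add (Add (Mul (EC 2) ezS) (echain_len 1 2 le_step ed)) (EC (bsize 3 1 fin_step))"

lemma gl_eside:
  assumes e: "e 0 = length x" and q: "\<And>i. ev q (e(2 := i)) = ev q e"
  shows "gl (eside q) x e = side x (ev q e) (e 1)"
proof -
  have b1: "gl ebits1 x e = concat (map (\<lambda>g. pad (csize M1) (bitcell M1 g)) (bgs1 x (e 1)))"
    by (simp add: ebits1_def bgs1_def gl_ebitcell o_def e concat_map_concat)
  have b2: "gl ebits2 x e = concat (map (\<lambda>g. pad (csize M2) (bitcell M2 g)) (bgs2 x))"
    by (simp add: ebits2_def bgs2_def gl_ebitcell o_def e)
  have A: "gl (eca M1 q ebits1 eL eT1) x e = ca M1 (ev q e) (bgs1 x (e 1)) (T1N (length x))"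
    by (subst gl_eca[where bgs = "bgs1 x (e 1)"]) (simp_all add: q b1 length_bgs1 e)
  have B: "gl (eca M2 (Add q ezA) ebits2 (EV 0) eTg) x e = ca M2 (ev q e + zA (length x)) (bgs2 x) (TgN (length x))"
    by (subst gl_eca[where bgs = "bgs2 x"]) (simp_all add: q b2 length_bgs2 e)
  show ?thesis unfolding eside_def side_def Let_def gl.simps A B
    by (simp add: gl_echain gl_eblk q e geg_ecopies exC_def[abs_def] exZ_def[abs_def] lsD_def)
qed

lemma gl_ewhole:
  assumes "e 0 = length x" "e 1 = 0" "e 2 = 0"
  shows "gl ewhole x e = whole x"
  unfolding ewhole_def whole_def Let_def gl.simps
  by (simp add: gl_eside gl_echain gl_eblk geg_ecopies assms)

lemma cok_eside:
  assumes "e 0 = length x" "e 2 = 0"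
  shows "cok (eside q) x e"
proof -
  have "cok ebits1 x e" "cok ebits2 x e"
    using assms by (simp_all add: ebits1_def ebits2_def cok_ebitcell)
  then show ?thesis using assms
    by (simp add: eside_def cok_eca cok_echain cok_eblk eg_ok_ecopies)
qed

lemma cok_ewhole:
  assumes "e 0 = length x" "e 1 = 0" "e 2 = 0"
  shows "cok ewhole x e"
  using assms by (simp add: ewhole_def Let_def cok_eside cok_echain cok_eblk eg_ok_ecopies)

lemma polytime_whole: "polytime_fun (\<lambda>x. enc_circuit (Circuit (dimn (length x)) (whole x)))"
proof -
  have e: "env0 N 0 = N" "env0 N 1 = 0" "env0 N 2 = 0" for N by (simp_all add: env0_def)
  have g: "gl ewhole x (env0 (length x)) = whole x" for x by (rule gl_ewhole) (simp_all add: env0_def)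
  have "polytime_fun (\<lambda>x. enc_circuit (Circuit (ev ed (env0 (length x))) (gl ewhole x (env0 (length x)))))"
  proof (rule polytime_circuit)
    show "cok ewhole x (env0 (length x))" for x by (rule cok_ewhole) (simp_all add: env0_def)
    show "length (gl ewhole x (env0 (length x))) = ev elen (env0 (length x))" for x
      unfolding g by (simp add: length_whole elen_def env0_def)
  qed
  then show ?thesis by (simp add: g e)
qed

lemma length_pair_enc: "length (pair_enc x y) = 2 * length x + 1 + length y"
  by (induction x) (auto simp: pair_enc_def sd_def)

text \<open>The verdict of a decider can be read off cell 0, which is why \<open>lsD\<close> fetches
  only that cell of the diagram of \<open>M1\<close>.\<close>

lemma tape_out_single: "tape_out t = [b] \<Longrightarrow> t 0 = 2 \<longleftrightarrow> b"
  by (auto simp: tape_out_def map_eq_Cons_conv upt_eq_Cons_conv)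

lemma reduces:
  assumes M: "tm_wf M1" "tm_wf M2"
    and R: "\<And>z. \<exists>n\<le>c1 * length z ^ k1 + c1. fst (tm_run M1 n z) = 1 \<and> tape_out (snd (snd (tm_run M1 n z))) = [R z]"
    and g: "\<And>z. \<exists>n\<le>c2 * length z ^ k2 + c2. fst (tm_run M2 n z) = 1 \<and> tape_out (snd (snd (tm_run M2 n z))) = g z"
    and L: "\<And>x. x \<in> L \<longleftrightarrow> card {y. length y = c * length x ^ k + c \<and> R (pair_enc x y)} \<noteq> bin_val (g x)"
  shows "reduces_to_nim2 L"
  unfolding reduces_to_nim2_def
proof (intro exI conjI allI)
  show "polytime_fun (\<lambda>x. enc_circuit (Circuit (dimn (length x)) (whole x)))" by (rule polytime_whole)
  fix x :: bits
  let ?N = "length x"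
  let ?Q = "Circuit (dimn ?N) (whole x)"
  show "enc_circuit (Circuit (dimn ?N) (whole x)) = enc_circuit ?Q" ..
  have cn: "circ_n ?Q = dimn ?N" by simp
  note split = nim2_split[of ?Q "dimn ?N" "sel x", OF cn circ_eval_whole[OF M]]
  show "nim2_promise ?Q" by (rule split(1))
  obtain n where n: "n \<le> T2N ?N" "fst (tm_run M2 n x) = 1" "tape_out (snd (snd (tm_run M2 n x))) = g x"
    using g[of x] unfolding T2N_def by blast
  have nT: "n \<le> TgN ?N" using n(1) by (simp add: TgN_def)
  \<comment> \<open>The halting configuration persists, so it can be inspected at the fixed time
    \<open>TgN\<close>, whatever the actual running time is.\<close>
  have g_out: "tape_out (snd (snd (tm_run M2 (TgN ?N) x))) = g x"
    unfolding tm_run_halted[OF n(2) nT] by (rule n(3))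
  \<comment> \<open>The output ends before the cells that the head cannot have reached, so h has at
    most \<open>nN\<close> bits; this gives the bound on h that \<open>card_selector\<close>
    requires.\<close>
  have "length (g x) \<le> nN ?N"
    using bin_val_live(2)[of "snd (snd (tm_run M2 (TgN ?N) x))" "?N + TgN ?N" "nN ?N"] tm_run_blank[of x "TgN ?N" "?N + TgN ?N" M2]
    unfolding g_out by (simp add: nN_alt)
  then have "2 ^ length (g x) \<le> (2 :: nat) ^ nN ?N" by (rule power_increasing) simp
  then have h: "bin_val (g x) \<le> 2 ^ nN ?N" using bin_val_less[of "g x"] by linarith
  have R_out: "snd (snd (tm_run M1 (T1N ?N) (pair_enc x y))) 0 = 2 \<longleftrightarrow> R (pair_enc x y)" if "length y = mN ?N" for y
  proof -
    have len: "length (pair_enc x y) = LN ?N" using that by (simp add: length_pair_enc LN_def)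
    obtain j where j: "j \<le> T1N ?N" "fst (tm_run M1 j (pair_enc x y)) = 1" "tape_out (snd (snd (tm_run M1 j (pair_enc x y)))) = [R (pair_enc x y)]"
      using R[of "pair_enc x y"] unfolding T1N_def len by blast
    then show ?thesis using tm_run_halted[OF j(2,1)] tape_out_single by metis
  qed
  have "nim2_yes ?Q \<longleftrightarrow> 2 * card {w \<in> cube (Suc (nN ?N)). sel x w} \<noteq> 2 ^ Suc (nN ?N)"
    using split(2) by (simp add: dimn_def)
  also have "\<dots> \<longleftrightarrow> card {y \<in> cube (mN ?N). R (pair_enc x y)} \<noteq> bin_val (g x)"
  proof (rule card_selector[OF h])
    show m: "mN ?N \<le> nN ?N" by (simp add: nN_def)
    fix b y assume "y \<in> cube (nN ?N)"
    then have "length (take (mN ?N) y) = mN ?N" using m by (simp add: cube_def)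
    then show "sel x (b # y) \<longleftrightarrow> (if b then bin_val (g x) \<le> bin_val y
        else R (pair_enc x (take (mN ?N) y)) \<and> \<not> list_ex id (drop (mN ?N) y))"
      by (simp only: sel_def Let_def list.sel g_out R_out)
  qed
  finally show "x \<in> L \<longleftrightarrow> nim2_yes ?Q" unfolding L by (simp add: cube_def mN_def)
qed

end

theorem mainTheorem12:
  shows "\<forall>L. coCeqP L \<longrightarrow> reduces_to_nim2 L"
proof (intro allI impI)
  fix L assume "coCeqP L"
  then obtain f h where f: "sharpP f" and h: "polytime_nat h" and L: "\<And>x. x \<in> - L \<longleftrightarrow> f x = h x"
    unfolding coCeqP_def CeqP_def by blast
  obtain R c k where R: "polytime_pred R"
    and fR: "\<And>x. f x = card {y. length y = c * length x ^ k + c \<and> R (pair_enc x y)}"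
    using f unfolding sharpP_def by blast
  obtain g where g: "polytime_fun g" and gh: "\<And>x. bin_val (g x) = h x"
    using h unfolding polytime_nat_def by blast
  obtain M1 c1 k1 where M1: "tm_wf M1" "\<And>z. \<exists>n\<le>c1 * length z ^ k1 + c1.
      fst (tm_run M1 n z) = 1 \<and> tape_out (snd (snd (tm_run M1 n z))) = [R z]"
    using R unfolding polytime_pred_def polytime_fun_def by blast
  obtain M2 c2 k2 where M2: "tm_wf M2" "\<And>z. \<exists>n\<le>c2 * length z ^ k2 + c2.
      fst (tm_run M2 n z) = 1 \<and> tape_out (snd (snd (tm_run M2 n z))) = g z"
    using g unfolding polytime_fun_def by blast
  show "reduces_to_nim2 L"
  proof (rule reduction.reduces[OF M1(1) M2(1) M1(2) M2(2)])
    show "x \<in> L \<longleftrightarrow> card {y. length y = c * length x ^ k + c \<and> R (pair_enc x y)} \<noteq> bin_val (g x)" for x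
      using L[of x] fR[of x] gh[of x] by auto
  qed
qed

end
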